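(* Let $p$ and $q$ be irreducible monic polynomials with degree $2$ over $\mathbb{F}$. Assume that $p$ is separable and that $q$ is inseparable. Let $u$ be an endomorphism of a finite-dimensional vector space $V$ over $\mathbb{F}$. Then, the following conditions are equivalent: (i) $u$ is a d-exceptional $(p,q)$-difference. (ii) The minimal polynomial of $u$ is a power of $F_{p,q}$ and the invariant factors of $u$ read $r_1,\dots,r_k,\dots$, where, for each positive integer $k$, either $r_{2k}=r_{2k-1}$ or $r_{2k-1}=r_{2k}\,F_{p,q}$. (iii) In some basis of $V$, the endomorphism $u$ is represented by a block-diagonal matrix in which every diagonal block equals $C(F_{p,q}^{n+\epsilon})\oplus C(F_{p,q}^n)$ for some non-negative integer $n$ and some $\epsilon\in\{0,1\}$.
   Context: $\mathbb{F}$ is a field with algebraic closure $\overline{\mathbb{F}}$. $\operatorname{Root}(p)$ is the set of roots of $p$ in $\overline{\mathbb{F}}$. If $p(t)=(t-x_1)(t-x_2)$ and $q(t)=(t-y_1)(t-y_2)$ in $\overline{\mathbb{F}}[t]$, then $F_{p,q}(t):=\prod_{1\leq i,j\leq 2}\bigl(t-(x_i-y_j)\bigr)$, a monic polynomial of degree $4$ in $\mathbb{F}[t]$. An endomorphism $u$ of $V$ is a $(p,q)$-difference if $u=a-b$ for some endomorphisms $a,b$ of $V$ with $p(a)=0$ and $q(b)=0$. It is d-exceptional with respect to $(p,q)$ if all its eigenvalues in $\overline{\mathbb{F}}$ belong to $\operatorname{Root}(p)-\operatorname{Root}(q)=\{x-y: x\in\operatorname{Root}(p),\,y\in\operatorname{Root}(q)\}$;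 a d-exceptional $(p,q)$-difference is a $(p,q)$-difference that is d-exceptional with respect to $(p,q)$. $C(r)$ is the companion matrix of the monic polynomial $r$ ($C(1)$ is the $0\times0$ matrix), and $\oplus$ is block-diagonal sum. The invariant factors of $u$ are the monic polynomials $r_1,r_2,\dots$ with $r_{i+1}\mid r_i$ such that $u$ is represented in some basis by $C(r_1)\oplus C(r_2)\oplus\cdots$; the finite list of nonconstant ones is extended to an infinite sequence by $r_i=1$. *)

theory Defs
  imports
    "HOL-Algebra.Algebraic_Closure_Type"
    "Jordan_Normal_Form.Char_Poly"
begin

definition ac_poly :: "'k::field poly \<Rightarrow> 'k alg_closure poly" where
  "ac_poly p = map_poly to_ac p"

definition Root :: "'k::field poly \<Rightarrow> 'k alg_closure set" where
  "Root p = {x. poly (ac_poly p) x = 0}"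

definition separable_poly :: "'k::field poly \<Rightarrow> bool" where
  "separable_poly p \<longleftrightarrow> rsquarefree (ac_poly p)"

text \<open>The multiset \<^term>\<open>proots f\<close> lists the roots of \<open>f\<close> with multiplicity. That the product
  below has its coefficients in the base field when \<open>p\<close> and \<open>q\<close> are monic of degree 2
  is shown in \<open>ac_poly_F_poly\<close>.\<close>

definition F_poly :: "'k::field poly \<Rightarrow> 'k poly \<Rightarrow> 'k poly" where
  "F_poly p q = (THE f. ac_poly f =
     (\<Prod>x\<in>#proots (ac_poly p). \<Prod>y\<in>#proots (ac_poly q). [:- (x - y), 1:]))"

lemma ac_poly_inj: "ac_poly f = ac_poly g \<Longrightarrow> f = g"
  by (auto simp: ac_poly_def poly_eq_iff coeff_map_poly)

lemma ac_poly_hom: "map_poly_inj_idom_hom (to_ac :: 'k::field \<Rightarrow> 'k alg_closure)"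
  by unfold_locales auto

lemma degree_ac_poly: "degree (ac_poly p) = degree p"
  unfolding ac_poly_def by (rule degree_map_poly) auto

lemma monic_quadratic_splits:
  fixes p :: "'k::field poly"
  assumes "monic p" "degree p = 2"
  obtains x1 x2 where "ac_poly p = [:- x1, 1:] * [:- x2, 1:]"
proof -
  have deg: "degree (ac_poly p) = 2" and lead: "lead_coeff (ac_poly p) = 1"
    using assms degree_ac_poly[of p] by (simp_all add: ac_poly_def coeff_map_poly)
  then obtain A where A: "size A = 2" "ac_poly p = (\<Prod>x\<in>#A. [:- x, 1:])"
    using alg_closed_imp_factorization[of "ac_poly p"] by force
  obtain x1 B where B: "A = add_mset x1 B" "size B = 1"
    using A(1) by (cases A) auto
  obtain x2 where "B = {#x2#}"
    using size_1_singleton_mset[OF B(2)] by blast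
  with B have "A = {#x1, x2#}" by simp
  then show ?thesis using that A(2) by simp
qed

lemma ac_poly_F_poly_exists:
  fixes p q :: "'k::field poly"
  assumes p: "monic p" "degree p = 2" and q: "monic q" "degree q = 2"
  shows "\<exists>f. ac_poly f = (\<Prod>x\<in>#proots (ac_poly p). \<Prod>y\<in>#proots (ac_poly q). [:- (x - y), 1:])"
proof -
  interpret hom: map_poly_inj_idom_hom "to_ac :: 'k \<Rightarrow> 'k alg_closure"
    by (rule ac_poly_hom)
  obtain x1 x2 where x: "ac_poly p = [:- x1, 1:] * [:- x2, 1:]"
    using monic_quadratic_splits[OF p] .
  obtain y1 y2 where y: "ac_poly q = [:- y1, 1:] * [:- y2, 1:]"
    using monic_quadratic_splits[OF q] .
  have px: "proots (ac_poly p) = {#x1, x2#}" and qy: "proots (ac_poly q) = {#y1, y2#}"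
    unfolding x y by (subst proots_mult; simp)+
  have cp: "to_ac (coeff p 1) = - x1 - x2"
    using arg_cong[OF x, of "\<lambda>f. coeff f 1"] by (simp add: ac_poly_def)
  have cq: "to_ac (coeff q 1) = - y1 - y2" "to_ac (coeff q 0) = y1 * y2"
    using arg_cong[OF y, of "\<lambda>f. coeff f 1"] arg_cong[OF y, of "\<lambda>f. coeff f 0"]
    by (simp_all add: ac_poly_def)
  define c d S where "c = [:- coeff q 1:]" and "d = [:coeff q 0:]" and "S = [:coeff p 1, 2:]"
  let ?f = "p\<^sup>2 + c * p * S + d * (S\<^sup>2 - 2 * p) + c\<^sup>2 * p + c * d * S + d\<^sup>2"
  have c: "ac_poly c = [:y1:] + [:y2:]" and d: "ac_poly d = [:y1:] * [:y2:]"
    and S: "ac_poly S = [:- x1, 1:] + [:- x2, 1:]"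
    using cp cq by (simp_all add: c_def d_def S_def ac_poly_def Polynomial.map_poly_pCons mult.commute)
  have lin: "[:- (a - b), 1:] = [:- a, 1:] + [:b:]" for a b :: "'k alg_closure"
    by simp
  have expand: "(a * b)\<^sup>2 + (y + z) * (a * b) * (a + b) + y * z * ((a + b)\<^sup>2 - 2 * (a * b))
      + (y + z)\<^sup>2 * (a * b) + (y + z) * (y * z) * (a + b) + (y * z)\<^sup>2
      = (a + y) * (a + z) * ((b + y) * (b + z))" for a b y z :: "'k alg_closure poly"
    by (simp add: power2_eq_square algebra_simps)
  have "ac_poly ?f = (ac_poly p)\<^sup>2 + ac_poly c * ac_poly p * ac_poly S
      + ac_poly d * ((ac_poly S)\<^sup>2 - 2 * ac_poly p) + (ac_poly c)\<^sup>2 * ac_poly p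
      + ac_poly c * ac_poly d * ac_poly S + (ac_poly d)\<^sup>2"
    unfolding ac_poly_def by (simp only: hom.hom_add hom.hom_mult hom.hom_minus hom.hom_power
        hom.hom_numeral)
  also have "\<dots> = (\<Prod>x\<in>#proots (ac_poly p). \<Prod>y\<in>#proots (ac_poly q). [:- (x - y), 1:])"
    unfolding px qy
    unfolding image_mset_add_mset image_mset_empty prod_mset.add_mset prod_mset_empty
      mult_1_right lin c d S x
    by (rule expand)
  finally show ?thesis by blast
qed

lemma ac_poly_F_poly:
  fixes p q :: "'k::field poly"
  assumes "monic p" "degree p = 2" "monic q" "degree q = 2"
  shows "ac_poly (F_poly p q) =
    (\<Prod>x\<in>#proots (ac_poly p). \<Prod>y\<in>#proots (ac_poly q). [:- (x - y), 1:])"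
  unfolding F_poly_def
  by (rule theI') (use ac_poly_F_poly_exists[OF assms] ac_poly_inj in metis)

text \<open>A vector space is a type \<^typ>\<open>'v\<close> with scalar multiplication \<open>scale\<close>.\<close>

definition ordered_basis :: "('k::field \<Rightarrow> 'v::ab_group_add \<Rightarrow> 'v) \<Rightarrow> 'v list \<Rightarrow> bool" where
  "ordered_basis scale bs \<longleftrightarrow>
     distinct bs \<and> module.independent scale (set bs) \<and> module.span scale (set bs) = UNIV"

definition represents ::
  "('k::field \<Rightarrow> 'v::ab_group_add \<Rightarrow> 'v) \<Rightarrow> ('v \<Rightarrow> 'v) \<Rightarrow> 'v list \<Rightarrow> 'k mat \<Rightarrow> bool" where
  "represents scale u bs A \<longleftrightarrow>
     ordered_basis scale bs \<and> A \<in> carrier_mat (length bs) (length bs) \<and>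
     (\<forall>j<length bs. u (bs ! j) = (\<Sum>i<length bs. scale (A $$ (i, j)) (bs ! i)))"

definition poly_endo ::
  "('k::field \<Rightarrow> 'v::ab_group_add \<Rightarrow> 'v) \<Rightarrow> 'k poly \<Rightarrow> ('v \<Rightarrow> 'v) \<Rightarrow> 'v \<Rightarrow> 'v" where
  "poly_endo scale f u = (\<lambda>v. \<Sum>i\<le>degree f. scale (coeff f i) ((u ^^ i) v))"

definition is_minimal_poly ::
  "('k::field \<Rightarrow> 'v::ab_group_add \<Rightarrow> 'v) \<Rightarrow> ('v \<Rightarrow> 'v) \<Rightarrow> 'k poly \<Rightarrow> bool" where
  "is_minimal_poly scale u m \<longleftrightarrow>
     monic m \<and> poly_endo scale m u = (\<lambda>v. 0) \<and>
     (\<forall>f. poly_endo scale f u = (\<lambda>v. 0) \<longrightarrow> m dvd f)"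

text \<open>Eigenvalues in the algebraic closure are those of a matrix of \<open>u\<close> viewed over the closure.\<close>

definition ac_eigenvalue ::
  "('k::field \<Rightarrow> 'v::ab_group_add \<Rightarrow> 'v) \<Rightarrow> ('v \<Rightarrow> 'v) \<Rightarrow> 'k alg_closure \<Rightarrow> bool" where
  "ac_eigenvalue scale u l \<longleftrightarrow> (\<exists>bs A. represents scale u bs A \<and> eigenvalue (map_mat to_ac A) l)"

definition companion_mat :: "'k::field poly \<Rightarrow> 'k mat" where
  "companion_mat r = mat (degree r) (degree r)
     (\<lambda>(i, j). if Suc j = degree r then - coeff r i else if i = Suc j then 1 else 0)"

text \<open>The invariant factors are \<open>r 1, r 2, \<dots>\<close>; the value \<open>r 0\<close> is irrelevant. Trailing
  factors 1 contribute \<open>0 \<times> 0\<close> blocks.\<close>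

definition is_invariant_factors ::
  "('k::field \<Rightarrow> 'v::ab_group_add \<Rightarrow> 'v) \<Rightarrow> ('v \<Rightarrow> 'v) \<Rightarrow> (nat \<Rightarrow> 'k poly) \<Rightarrow> bool" where
  "is_invariant_factors scale u r \<longleftrightarrow>
     (\<forall>i\<ge>1. monic (r i) \<and> r (Suc i) dvd r i) \<and>
     (\<exists>m. (\<forall>i>m. r i = 1) \<and>
       (\<exists>bs. represents scale u bs (diag_block_mat (map (\<lambda>i. companion_mat (r i)) [1..<Suc m]))))"

definition is_difference ::
  "('k::field \<Rightarrow> 'v::ab_group_add \<Rightarrow> 'v) \<Rightarrow> 'k poly \<Rightarrow> 'k poly \<Rightarrow> ('v \<Rightarrow> 'v) \<Rightarrow> bool" where
  "is_difference scale p q u \<longleftrightarrow>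
     (\<exists>a b. Vector_Spaces.linear scale scale a \<and> Vector_Spaces.linear scale scale b \<and>
        u = (\<lambda>v. a v - b v) \<and>
        poly_endo scale p a = (\<lambda>v. 0) \<and> poly_endo scale q b = (\<lambda>v. 0))"

definition d_exceptional ::
  "('k::field \<Rightarrow> 'v::ab_group_add \<Rightarrow> 'v) \<Rightarrow> 'k poly \<Rightarrow> 'k poly \<Rightarrow> ('v \<Rightarrow> 'v) \<Rightarrow> bool" where
  "d_exceptional scale p q u \<longleftrightarrow>
     {l. ac_eigenvalue scale u l} \<subseteq> {x - y | x y. x \<in> Root p \<and> y \<in> Root q}"

end

theory Submission
  imports Defs "HOL-Library.Function_Algebras"
begin

text \<open>The hypotheses force characteristic 2, so that \<open>p = t\<^sup>2 + \<tau> t + c\<close> with \<open>\<tau> \<noteq> 0\<close>,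
  \<open>q = t\<^sup>2 + \<delta>\<close>, and \<open>F = (p + \<delta>)\<^sup>2 + \<tau>\<^sup>2 \<delta>\<close> is irreducible of degree 4. Put
  \<open>\<omega> = (p + \<delta>) / \<tau>\<close> and \<open>\<pi> = F / \<tau>\<^sup>2 = \<omega>\<^sup>2 + \<delta>\<close>. The substitution \<open>\<sigma> : t \<mapsto> t + \<tau>\<close> is an
  involution of the polynomial ring that fixes \<open>\<omega>\<close> and \<open>\<pi>\<close>.

  If \<open>u = a - b\<close> with \<open>p(a) = 0\<close> and \<open>q(b) = 0\<close>, then \<open>\<omega>(u)\<close> commutes with \<open>b\<close>, and
  \<open>\<beta> = b + \<omega>(u)\<close> is a \<open>\<sigma>\<close>-semilinear square root of \<open>\<pi>(u)\<close>; conversely such a \<open>\<beta>\<close> gives back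
  \<open>b = \<beta> + \<omega>(u)\<close> and \<open>a = u + b\<close>. Being d-exceptional means that \<open>F(u)\<close> is nilpotent, and
  then \<open>u\<close> and \<open>\<beta>\<close> generate a ring over which the space is a direct sum of uniserial modules,
  \<open>\<beta>\<close> playing the role of the uniformizer. A summand generated by \<open>v\<close> with annihilator
  \<open>\<beta>\<^sup>m\<close> splits over the polynomial ring into the cyclic modules generated by \<open>v\<close> and \<open>\<beta> v\<close>,
  with annihilators \<open>F\<close> to the powers \<open>\<lceil>m / 2\<rceil>\<close> and \<open>\<lfloor>m / 2\<rfloor>\<close>; this is the block form. On
  a block with exponents \<open>n + \<epsilon>\<close> and \<open>n\<close>, the map \<open>(x, y) \<mapsto> (\<pi> \<sigma> y, \<sigma> x)\<close> is a suitable
  \<open>\<beta>\<close>. Sorting the exponents gives the condition on the invariant factors.\<close>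

section \<open>Modules with a semilinear square root\<close>

text \<open>The module is the internal direct sum of the cyclic submodules generated by the
  \<open>v i\<close>, and \<open>g i\<close> generates the annihilator of \<open>v i\<close>: the
  last clause describes the kernel of the surjection from the free module on
  \<open>I\<close>.\<close>

definition cyclic_decomp ::
  "('r::comm_ring_1 \<Rightarrow> 'v::ab_group_add \<Rightarrow> 'v) \<Rightarrow> 'i set \<Rightarrow> ('i \<Rightarrow> 'v) \<Rightarrow> ('i \<Rightarrow> 'r) \<Rightarrow> bool" where
  "cyclic_decomp scale I v g \<longleftrightarrow> finite I \<and> (\<forall>x. \<exists>f. x = (\<Sum>i\<in>I. scale (f i) (v i))) \<and>
     (\<forall>f. (\<Sum>i\<in>I. scale (f i) (v i)) = 0 \<longleftrightarrow> (\<forall>i\<in>I. g i dvd f i))"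

lemma cyclic_decomp_eq_0_iff:
  "cyclic_decomp scale I v g \<Longrightarrow> (\<Sum>i\<in>I. scale (f i) (v i)) = 0 \<longleftrightarrow> (\<forall>i\<in>I. g i dvd f i)"
  unfolding cyclic_decomp_def by blast

lemma cyclic_decomp_reindex:
  assumes "cyclic_decomp scale I v g" "bij_betw h J I"
    "\<And>j. j \<in> J \<Longrightarrow> v' j = v (h j)" "\<And>j. j \<in> J \<Longrightarrow> g' j = g (h j)"
  shows "cyclic_decomp scale J v' g'"
proof -
  have fin: "finite J" using assms(1,2) bij_betw_finite unfolding cyclic_decomp_def by blast
  have *: "(\<Sum>j\<in>J. scale (f (h j)) (v' j)) = (\<Sum>i\<in>I. scale (f i) (v i))" for f
    using sum.reindex_bij_betw[OF assms(2), of "\<lambda>i. scale (f i) (v i)"] assms(3) by simp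
  have inv: "the_inv_into J h (h j) = j" if "j \<in> J" for j
    using assms(2) that by (simp add: bij_betw_def the_inv_into_f_f)
  have "\<exists>f. x = (\<Sum>j\<in>J. scale (f j) (v' j))" for x
  proof -
    obtain f where "x = (\<Sum>i\<in>I. scale (f i) (v i))" using assms(1) unfolding cyclic_decomp_def by blast
    then have "x = (\<Sum>j\<in>J. scale (f (h j)) (v' j))" by (simp add: *)
    then show ?thesis by (rule exI[of _ "f \<circ> h", unfolded o_def])
  qed
  moreover have "(\<Sum>j\<in>J. scale (f j) (v' j)) = 0 \<longleftrightarrow> (\<forall>j\<in>J. g' j dvd f j)" for f
  proof -
    let ?f = "\<lambda>i. f (the_inv_into J h i)"
    have "(\<Sum>j\<in>J. scale (f j) (v' j)) = (\<Sum>j\<in>J. scale (?f (h j)) (v' j))" by (simp add: inv)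
    also have "\<dots> = 0 \<longleftrightarrow> (\<forall>i\<in>I. g i dvd ?f i)"
      using *[of ?f] cyclic_decomp_eq_0_iff[OF assms(1), of ?f] by simp
    also have "\<dots> \<longleftrightarrow> (\<forall>j\<in>J. g (h j) dvd ?f (h j))"
      using assms(2) unfolding bij_betw_def by auto
    finally show ?thesis by (simp add: inv assms(4))
  qed
  ultimately show ?thesis using fin unfolding cyclic_decomp_def by blast
qed

lemma cyclic_decomp_annihilates:
  assumes "Modules.module scale" "cyclic_decomp scale I v g" "i \<in> I"
  shows "scale f (v i) = 0 \<longleftrightarrow> g i dvd f"
proof -
  interpret Modules.module scale by fact
  have fin: "finite I" using assms(2) by (simp add: cyclic_decomp_def)
  have "(\<Sum>j\<in>I. scale (if j = i then f else 0) (v j)) = (\<Sum>j\<in>I. if j = i then scale f (v j) else 0)"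
    by (rule sum.cong) auto
  also have "\<dots> = scale f (v i)" using fin assms(3) by simp
  finally have "scale f (v i) = 0 \<longleftrightarrow> (\<Sum>j\<in>I. scale (if j = i then f else 0) (v j)) = 0" by simp
  also have "\<dots> \<longleftrightarrow> (\<forall>j\<in>I. g j dvd (if j = i then f else 0))"
    by (rule cyclic_decomp_eq_0_iff[OF assms(2)])
  also have "\<dots> \<longleftrightarrow> g i dvd f" using assms(3) by auto
  finally show ?thesis .
qed

text \<open>The module carries an action of the ring extended by \<beta>, where \<beta> twists
  scalars by \<sigma>. \<open>rank\<close> stands for any measure that is strictly monotone on
  submodules; it supports maximal choices and inductions and will be the dimension over the field.
  \<open>bezout\<close> makes every scalar outside the ideal of \<pi> invertible modulo
  \<pi>.\<close>

locale semilinear_root = Modules.module scale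
  for scale :: "'r::comm_ring_1 \<Rightarrow> 'v::ab_group_add \<Rightarrow> 'v" (infixr \<open>*s\<close> 75) +
  fixes \<sigma> :: "'r \<Rightarrow> 'r" and \<beta> :: "'v \<Rightarrow> 'v" and \<pi> :: 'r and rank :: "'v set \<Rightarrow> nat"
  assumes \<sigma>_mult: "\<sigma> (f * g) = \<sigma> f * \<sigma> g"
    and \<sigma>_invol: "\<sigma> (\<sigma> f) = f"
    and \<sigma>_fix: "\<sigma> \<pi> = \<pi>"
    and \<beta>_add: "\<beta> (x + y) = \<beta> x + \<beta> y"
    and \<beta>_scale: "\<beta> (f *s x) = \<sigma> f *s \<beta> x"
    and \<beta>_square: "\<beta> (\<beta> x) = \<pi> *s x"
    and rank_less: "subspace W \<Longrightarrow> subspace U \<Longrightarrow> W \<subset> U \<Longrightarrow> rank W < rank U"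
    and bezout: "\<not> \<pi> dvd h \<Longrightarrow> \<exists>a b. a * h + b * \<pi> = 1"
begin

lemma \<beta>_0 [simp]: "\<beta> 0 = 0"
  using \<beta>_add[of 0 0] by simp

lemma \<beta>_minus: "\<beta> (- x) = - \<beta> x"
  using \<beta>_add[of x "- x"] by (simp add: eq_neg_iff_add_eq_0 add.commute)

lemma \<beta>_diff: "\<beta> (x - y) = \<beta> x - \<beta> y"
  using \<beta>_add[of x "- y"] by (simp add: \<beta>_minus)

lemma \<beta>_pow_0 [simp]: "(\<beta> ^^ j) 0 = 0"
  by (induction j) auto

lemma \<beta>_pow_add: "(\<beta> ^^ j) (x + y) = (\<beta> ^^ j) x + (\<beta> ^^ j) y"
  by (induction j) (auto simp: \<beta>_add)

lemma \<sigma>_pow_fix: "(\<sigma> ^^ j) f \<in> {f, \<sigma> f}"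
  by (induction j) (auto simp: \<sigma>_invol)

lemma \<beta>_pow_scale: "(\<beta> ^^ j) (f *s x) = (\<sigma> ^^ j) f *s (\<beta> ^^ j) x"
  by (induction j) (auto simp: \<beta>_scale)

lemma dvd_\<sigma>: "\<pi> dvd \<sigma> f \<longleftrightarrow> \<pi> dvd f"
  by (metis \<sigma>_mult \<sigma>_invol \<sigma>_fix dvd_def)

lemma dvd_\<sigma>_pow: "\<pi> dvd (\<sigma> ^^ j) f \<longleftrightarrow> \<pi> dvd f"
  using \<sigma>_pow_fix[of j f] by (auto simp: dvd_\<sigma>)

lemma \<beta>_pow_even: "(\<beta> ^^ (2 * k)) x = \<pi> ^ k *s x"
  by (induction k arbitrary: x) (auto simp: \<beta>_square mult.commute)

text \<open>On the kernel of \<beta> the scalar \<pi> acts as zero, so a scalar prime to \<pi> acts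
  there invertibly.\<close>

lemma eq_0_if_coprime:
  assumes "h *s x = 0" "\<not> \<pi> dvd h" "\<beta> x = 0"
  shows "x = 0"
proof -
  obtain a b where ab: "a * h + b * \<pi> = 1" using bezout[OF assms(2)] by blast
  have "x = (a * h + b * \<pi>) *s x" by (simp add: ab)
  also have "\<dots> = a *s (h *s x) + b *s \<beta> (\<beta> x)" by (simp add: scale_left_distrib \<beta>_square)
  also have "\<dots> = 0" using assms by simp
  finally show ?thesis .
qed

text \<open>Because the square of \<beta> is a scalar, two terms suffice: this is the cyclic
  submodule of \<open>v\<close> over the ring extended by \<beta>.\<close>

definition gen :: "'v \<Rightarrow> 'v set" where
  "gen v = {f *s v + g *s \<beta> v | f g. True}"

definition stable :: "'v set \<Rightarrow> bool" where
  "stable W \<longleftrightarrow> subspace W \<and> (\<forall>x\<in>W. \<beta> x \<in> W)"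

lemma genI: "f *s v + g *s \<beta> v \<in> gen v" by (auto simp: gen_def)

lemma stable_gen: "stable (gen v)"
  unfolding stable_def
proof (intro conjI ballI subspaceI)
  show "0 \<in> gen v" using genI[of 0 v 0] by simp
next
  fix x y assume "x \<in> gen v" "y \<in> gen v"
  then obtain f g f' g' where "x = f *s v + g *s \<beta> v" "y = f' *s v + g' *s \<beta> v"
    by (auto simp: gen_def)
  then have "x + y = (f + f') *s v + (g + g') *s \<beta> v" by (simp add: scale_left_distrib)
  then show "x + y \<in> gen v" by (simp only: genI)
next
  fix c x assume "x \<in> gen v"
  then obtain f g where "x = f *s v + g *s \<beta> v" by (auto simp: gen_def)
  then have "c *s x = (c * f) *s v + (c * g) *s \<beta> v" by (simp add: scale_right_distrib)
  then show "c *s x \<in> gen v" by (simp only: genI)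
next
  fix x assume "x \<in> gen v"
  then obtain f g where "x = f *s v + g *s \<beta> v" by (auto simp: gen_def)
  then have "\<beta> x = (\<sigma> g * \<pi>) *s v + \<sigma> f *s \<beta> v"
    by (simp add: \<beta>_add \<beta>_scale \<beta>_square add.commute)
  then show "\<beta> x \<in> gen v" by (simp only: genI)
qed

lemma stable_pow: "stable W \<Longrightarrow> x \<in> W \<Longrightarrow> (\<beta> ^^ j) x \<in> W"
  by (induction j) (auto simp: stable_def)

lemma subspace_sums:
  assumes "subspace W" "subspace W'"
  shows "subspace {x + y | x y. x \<in> W \<and> y \<in> W'}"
proof (rule subspaceI)
  show "0 \<in> {x + y | x y. x \<in> W \<and> y \<in> W'}" using assms subspace_0 by force
next
  fix a b assume "a \<in> {x + y | x y. x \<in> W \<and> y \<in> W'}" "b \<in> {x + y | x y. x \<in> W \<and> y \<in> W'}"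
  then obtain x y x' y' where "x \<in> W" "y \<in> W'" "x' \<in> W" "y' \<in> W'" "a = x + y" "b = x' + y'" by blast
  then have "x + x' \<in> W" "y + y' \<in> W'" "a + b = (x + x') + (y + y')"
    using assms by (simp_all add: subspace_add algebra_simps)
  then show "a + b \<in> {x + y | x y. x \<in> W \<and> y \<in> W'}" by blast
next
  fix c a assume "a \<in> {x + y | x y. x \<in> W \<and> y \<in> W'}"
  then obtain x y where "x \<in> W" "y \<in> W'" "a = x + y" by blast
  then have "c *s x \<in> W" "c *s y \<in> W'" "c *s a = c *s x + c *s y"
    using assms by (simp_all add: subspace_scale scale_right_distrib)
  then show "c *s a \<in> {x + y | x y. x \<in> W \<and> y \<in> W'}" by blast
qed

lemma stable_sum:
  assumes "stable W" "stable W'"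
  shows "stable {x + y | x y. x \<in> W \<and> y \<in> W'}"
  unfolding stable_def
proof (intro conjI ballI)
  show "subspace {x + y | x y. x \<in> W \<and> y \<in> W'}"
    using assms by (intro subspace_sums) (simp_all add: stable_def)
next
  fix z assume "z \<in> {x + y | x y. x \<in> W \<and> y \<in> W'}"
  then obtain x y where "x \<in> W" "y \<in> W'" "z = x + y" by blast
  then have "\<beta> x \<in> W" "\<beta> y \<in> W'" "\<beta> z = \<beta> x + \<beta> y"
    using assms by (auto simp: stable_def \<beta>_add)
  then show "\<beta> z \<in> {x + y | x y. x \<in> W \<and> y \<in> W'}" by blast
qed

text \<open>Induction on the order \<open>m\<close>, passing from \<open>v\<close> to
  \<open>\<beta> v\<close>. A relation between \<open>v\<close> and \<open>\<beta> v\<close> forces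
  \<pi> to divide \<open>f\<close>; dividing it out gives a relation between
  \<open>\<beta> v\<close> and \<open>\<beta> (\<beta> v)\<close> with the two coefficients
  exchanged. This exchange is what makes the ceiling and the floor of \<open>m / 2\<close>
  alternate.\<close>

lemma annihilator:
  assumes "(\<beta> ^^ m) v = 0" "\<And>j. j < m \<Longrightarrow> (\<beta> ^^ j) v \<noteq> 0"
  shows "f *s v + g *s \<beta> v = 0 \<longleftrightarrow> \<pi> ^ ((m + 1) div 2) dvd f \<and> \<pi> ^ (m div 2) dvd g"
proof -
  \<comment> \<open>A multiple of \<open>\<pi> ^ k\<close> acts on \<open>(\<beta> ^^ j) v\<close>
    through the power \<open>2 * k + j\<close> of \<beta>, which is zero once it reaches
    \<open>m\<close>.\<close>
  have van: "h *s (\<beta> ^^ j) v = 0" if h: "\<pi> ^ k dvd h" and le: "m \<le> 2 * k + j" for h k j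
  proof -
    obtain h' where "h = h' * \<pi> ^ k" using h by (metis dvdE mult.commute)
    then have "h *s (\<beta> ^^ j) v = h' *s (\<beta> ^^ (2 * k)) ((\<beta> ^^ j) v)" by (simp add: \<beta>_pow_even)
    also have "(\<beta> ^^ (2 * k)) ((\<beta> ^^ j) v) = (\<beta> ^^ (2 * k + j - m)) ((\<beta> ^^ m) v)"
      using le by (simp flip: funpow_add comp_apply[of "\<beta> ^^ _"])
    finally show ?thesis by (simp add: assms(1))
  qed
  have "f *s v + g *s \<beta> v = 0" if "\<pi> ^ ((m + 1) div 2) dvd f" "\<pi> ^ (m div 2) dvd g"
    using van[OF that(1), of 0] van[OF that(2), of 1] by simp
  moreover have "\<pi> ^ ((m + 1) div 2) dvd f \<and> \<pi> ^ (m div 2) dvd g"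
    if "f *s v + g *s \<beta> v = 0"
    using assms that
  proof (induction m arbitrary: v f g)
    case 0
    then show ?case by simp
  next
    case (Suc m)
    let ?y = "(\<beta> ^^ m) v"
    have y: "?y \<noteq> 0" "\<beta> ?y = 0" using Suc.prems by auto
    \<comment> \<open>The last nonzero power of \<beta> on \<open>v\<close> isolates
      \<open>f\<close>, because it annihilates \<open>\<beta> v\<close>.\<close>
    have "0 = (\<beta> ^^ m) (f *s v + g *s \<beta> v)" by (simp only: Suc.prems(3) \<beta>_pow_0)
    also have "\<dots> = (\<sigma> ^^ m) f *s ?y"
      using y(2) by (simp add: \<beta>_pow_add \<beta>_pow_scale flip: funpow_swap1)
    finally have "\<pi> dvd f" using eq_0_if_coprime[of "(\<sigma> ^^ m) f" ?y] y dvd_\<sigma>_pow by metis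
    then obtain f' where f': "f = f' * \<pi>" by (auto simp: dvd_def mult.commute)
    have "g *s \<beta> v + f' *s \<beta> (\<beta> v) = 0"
      using Suc.prems(3) by (simp add: f' \<beta>_square add.commute)
    moreover have "(\<beta> ^^ m) (\<beta> v) = 0" "\<And>j. j < m \<Longrightarrow> (\<beta> ^^ j) (\<beta> v) \<noteq> 0"
      using Suc.prems(1) Suc.prems(2)[of "Suc j" for j] by (auto simp: funpow_swap1) 
    ultimately have "\<pi> ^ ((m + 1) div 2) dvd g" "\<pi> ^ (m div 2) dvd f'"
      using Suc.IH[of "\<beta> v" g f'] by auto
    then show ?case by (auto simp: f' mult.commute intro: mult_dvd_mono)
  qed
  ultimately show ?thesis by blast
qed

text \<open>Here \<open>v\<close> has the largest possible order in \<open>U\<close>. Among the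
  stable submodules meeting \<open>gen v\<close> trivially one of greatest rank is taken; if it did
  not complement \<open>gen v\<close>, adjoining one suitable vector would enlarge it.\<close>

lemma complement:
  assumes U: "stable U" "v \<in> U" "\<And>x. x \<in> U \<Longrightarrow> (\<beta> ^^ Suc m) x = 0"
    and v: "(\<beta> ^^ m) v \<noteq> 0"
  obtains W where "stable W" "W \<subseteq> U" "W \<inter> gen v = {0}" "U = {x + y | x y. x \<in> W \<and> y \<in> gen v}"
proof -
  define P where "P W \<longleftrightarrow> stable W \<and> W \<subseteq> U \<and> W \<inter> gen v = {0}" for W
  have genU: "gen v \<subseteq> U"
    using U(1,2) unfolding gen_def stable_def by (auto intro!: subspace_add subspace_scale)
  have "P {0}"
    using U(1) stable_gen[of v] subspace_0 unfolding P_def stable_def by auto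
  \<comment> \<open>The rank of the whole module bounds all ranks, so a candidate of greatest rank
    exists.\<close>
  moreover have "\<forall>W. P W \<longrightarrow> rank W < Suc (rank UNIV)"
    using rank_less[of _ UNIV] unfolding P_def stable_def by (metis less_Suc_eq psubsetI subspace_UNIV top_greatest)
  ultimately obtain W where W: "P W" and max: "\<And>W'. P W' \<Longrightarrow> rank W' \<le> rank W"
    using ex_has_greatest_nat[of P "{0}" rank] by blast
  define S where "S = {x + y | x y. x \<in> W \<and> y \<in> gen v}"
  have S: "stable S" using stable_sum[OF _ stable_gen] W unfolding P_def S_def by blast
  have sub: "subspace W" "subspace (gen v)" "subspace S"
    using W stable_gen S by (auto simp: P_def stable_def)
  have WS: "W \<subseteq> S" "gen v \<subseteq> S"
    using sub[THEN subspace_0] unfolding S_def by force+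
  have SU: "S \<subseteq> U" using W genU U(1) unfolding S_def P_def stable_def by (auto intro!: subspace_add)
  have "U \<subseteq> S"
  proof (rule ccontr)
    assume "\<not> U \<subseteq> S"
    then obtain x\<^sub>0 where x\<^sub>0: "x\<^sub>0 \<in> U" "x\<^sub>0 \<notin> S" by blast
    have "(\<beta> ^^ Suc m) x\<^sub>0 \<in> S" using U(3) x\<^sub>0(1) subspace_0[OF sub(3)] by metis
    \<comment> \<open>The iterates of the missing vector start outside \<open>S\<close> and end at
      0; the last one before entering \<open>S\<close> is outside \<open>S\<close> but has its image
      under \<beta> inside.\<close>
    moreover have "\<exists>i. (\<beta> ^^ i) x\<^sub>0 \<notin> S \<and> (\<beta> ^^ Suc i) x\<^sub>0 \<in> S" if "(\<beta> ^^ n) x\<^sub>0 \<in> S" for n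
      using that
    proof (induction n)
      case 0
      with x\<^sub>0(2) show ?case by simp
    next
      case (Suc n)
      then show ?case by blast
    qed
    ultimately obtain i where i: "(\<beta> ^^ i) x\<^sub>0 \<notin> S" "(\<beta> ^^ Suc i) x\<^sub>0 \<in> S" by blast
    define x where "x = (\<beta> ^^ i) x\<^sub>0"
    have x: "x \<notin> S" "\<beta> x \<in> S" "x \<in> U"
      using i stable_pow[OF U(1) x\<^sub>0(1)] by (auto simp: x_def)
    obtain w f g where w: "w \<in> W" "\<beta> x = w + (f *s v + g *s \<beta> v)"
      using x(2) by (auto simp: S_def gen_def)
    \<comment> \<open>Applying the \<open>m\<close>-th power of \<beta> to \<open>\<beta> x\<close>
      gives zero by the maximality of the order. What remains lies in both \<open>W\<close> and
      \<open>gen v\<close>, hence vanishes, and \<pi> divides \<open>f\<close>.\<close>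
    have "(\<beta> ^^ Suc m) v = 0" using U by blast
    then have "(\<beta> ^^ m) (\<beta> v) = 0" by (simp add: funpow_swap1)
    then have "(\<beta> ^^ m) (\<beta> x) = (\<beta> ^^ m) w + (\<sigma> ^^ m) f *s (\<beta> ^^ m) v"
      by (simp add: w(2) \<beta>_pow_add \<beta>_pow_scale)
    moreover have "(\<beta> ^^ m) (\<beta> x) = 0" using U(3)[OF x(3)] by (simp add: funpow_swap1)
    ultimately have eq: "(\<beta> ^^ m) w = - ((\<sigma> ^^ m) f *s (\<beta> ^^ m) v)"
      by (simp add: eq_neg_iff_add_eq_0)
    moreover have "(\<beta> ^^ m) v \<in> gen v"
      using stable_pow[OF stable_gen] genI[of 1 v 0] by simp
    ultimately have "(\<beta> ^^ m) w \<in> W \<inter> gen v"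
      using stable_pow[of W w m] W w(1) sub(2) subspace_neg subspace_scale unfolding P_def by (metis IntI)
    then have "(\<beta> ^^ m) w = 0" using W by (auto simp: P_def)
    then have "(\<sigma> ^^ m) f *s (\<beta> ^^ m) v = 0" using eq by simp
    moreover have "\<beta> ((\<beta> ^^ m) v) = 0" using U by force
    ultimately have "\<pi> dvd f" using eq_0_if_coprime v dvd_\<sigma>_pow by metis
    then obtain f' where f': "f = f' * \<pi>" by (metis dvdE mult.commute)
    \<comment> \<open>Since \<pi> divides \<open>f\<close>, the component of
      \<open>\<beta> x\<close> in \<open>gen v\<close> has a preimage under \<beta> in
      \<open>gen v\<close>. Subtracting it from \<open>x\<close> leaves a vector whose image is just
      \<open>w\<close>.\<close>
    define x' where "x' = x - (\<sigma> f' *s \<beta> v + \<sigma> g *s v)"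
    have "\<sigma> g *s v + \<sigma> f' *s \<beta> v \<in> gen v" by (rule genI)
    then have z: "x - x' \<in> gen v" by (simp add: x'_def add.commute)
    have x'w: "\<beta> x' = w"
      unfolding x'_def \<beta>_diff \<beta>_add \<beta>_scale \<sigma>_invol \<beta>_square w(2) f' by simp
    have x'U: "x' \<in> U" using x(3) z genU U(1) subspace_diff[of U x "x - x'"] unfolding stable_def by auto
    have x'S: "x' \<notin> S" using x(1) z WS(2) subspace_add[OF sub(3), of x' "x - x'"] by auto
    \<comment> \<open>Adjoining \<open>x'\<close> keeps stability because \<open>\<beta> x'\<close>
      is already in \<open>W\<close>.\<close>
    define W' where "W' = {y + z | y z. y \<in> W \<and> z \<in> span {x'}}"
    have spanx': "span {x'} = range (\<lambda>h. h *s x')" by (rule span_singleton)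
    have "stable W'"
      unfolding stable_def
    proof (intro conjI ballI)
      show sW': "subspace W'" unfolding W'_def by (intro subspace_sums sub subspace_span)
      fix y assume "y \<in> W'"
      then obtain y' h where y: "y' \<in> W" "y = y' + h *s x'" by (auto simp: W'_def spanx')
      then have "\<beta> y = \<beta> y' + \<sigma> h *s w" by (simp add: \<beta>_add \<beta>_scale x'w)
      also have "\<dots> \<in> W" using y(1) w(1) sub(1) W unfolding P_def stable_def
        by (auto intro!: subspace_add subspace_scale)
      finally show "\<beta> y \<in> W'" unfolding W'_def using span_zero[of "{x'}"] by force
    qed
    moreover have "W' \<subseteq> U"
      using W U(1) x'U unfolding W'_def spanx' P_def stable_def
      by (auto intro!: subspace_add subspace_scale)
    moreover have "y = 0" if yW: "y \<in> W' \<inter> gen v" for y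
    proof -
      obtain y' h where y: "y' \<in> W" "y = y' + h *s x'" using yW unfolding W'_def spanx' by blast
      \<comment> \<open>If \<open>h\<close> were invertible modulo \<pi>, then \<open>x'\<close>
        could be recovered from \<open>y\<close>, \<open>y'\<close> and
        \<open>\<pi> *s x' = \<beta> w\<close>, all in \<open>S\<close>. Once \<pi> divides
        \<open>h\<close>, the vector \<open>y\<close> falls into \<open>W\<close> and is
        zero.\<close>
      have "\<pi> dvd h"
      proof (rule ccontr)
        assume "\<not> \<pi> dvd h"
        then obtain a b where ab: "a * h + b * \<pi> = 1" using bezout by blast
        have "x' = (a * h + b * \<pi>) *s x'" by (simp add: ab)
        also have "\<dots> = (b *s \<beta> w - a *s y') + a *s y"
          by (simp add: scale_left_distrib scale_right_distrib y(2) \<beta>_square flip: x'w)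
        also have "b *s \<beta> w - a *s y' \<in> W"
          using y(1) w(1) W sub(1) unfolding P_def stable_def
          by (intro subspace_diff subspace_scale) simp_all
        then have "(b *s \<beta> w - a *s y') + a *s y \<in> S"
          using subspace_scale[OF sub(2), of y a] yW unfolding S_def by blast
        finally show False using x'S by blast
      qed
      then obtain h' where h': "h = h' * \<pi>" by (metis dvdE mult.commute)
      have "y = y' + h' *s \<beta> w" by (simp add: y(2) h' \<beta>_square flip: x'w)
      also have "\<dots> \<in> W" using y(1) w(1) W sub(1) unfolding P_def stable_def
        by (auto intro!: subspace_add subspace_scale)
      finally show "y = 0" using yW W by (auto simp: P_def)
    qed
    moreover have "0 \<in> W'" unfolding W'_def using subspace_0[OF sub(1)] span_zero by force
    ultimately have "P W'" unfolding P_def using subspace_0[OF sub(2)] by auto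
    moreover have "W \<subset> W'"
    proof
      show "W \<subseteq> W'" unfolding W'_def using span_zero by force
      have "x' \<in> W'" unfolding W'_def using subspace_0[OF sub(1)] span_base[of x' "{x'}"] by force
      then show "W \<noteq> W'" using x'S WS(1) by blast
    qed
    ultimately show False
      using max[of W'] rank_less[of W W'] W unfolding P_def stable_def by force
  qed
  with SU have "U = S" by blast
  then show ?thesis using that[of W] W unfolding P_def S_def by blast
qed

text \<open>Splits off \<open>gen v\<close> for a \<open>v\<close> of maximal order and recurses on
  the complement, which has smaller rank. Independence is asserted only between the blocks; the
  relations inside one block are left to \<open>annihilator\<close>.\<close>

lemma decomposition_stable:
  assumes "stable U" "\<forall>x\<in>U. (\<beta> ^^ N) x = 0"
  shows "\<exists>(r::nat) v m. (\<forall>i<r. v i \<in> U \<and> (\<beta> ^^ m i) (v i) = 0 \<and> (\<forall>j<m i. (\<beta> ^^ j) (v i) \<noteq> 0)) \<and>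
    (\<forall>x\<in>U. \<exists>f g. x = (\<Sum>i<r. f i *s v i + g i *s \<beta> (v i))) \<and>
    (\<forall>f g. (\<Sum>i<r. f i *s v i + g i *s \<beta> (v i)) = 0 \<longrightarrow> (\<forall>i<r. f i *s v i + g i *s \<beta> (v i) = 0))"
  using assms
proof (induction "rank U" arbitrary: U rule: less_induct)
  case less
  show ?case
  proof (cases "U = {0}")
    case True
    then show ?thesis by (intro exI[of _ "0::nat"]) auto
  next
    case False
    \<comment> \<open>The least exponent killing \<open>U\<close>; minimality yields a vector not
      killed by the preceding power, hence one of maximal order.\<close>
    define m where "m = (LEAST m. \<forall>x\<in>U. (\<beta> ^^ m) x = 0)"
    have m: "\<forall>x\<in>U. (\<beta> ^^ m) x = 0" unfolding m_def by (rule LeastI[of _ N]) (use less.prems in blast)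
    have "m \<noteq> 0" using m False less.prems(1) subspace_0 by (cases m) (auto simp: stable_def)
    then obtain k where k: "m = Suc k" using not0_implies_Suc by blast
    then have "\<not> (\<forall>x\<in>U. (\<beta> ^^ k) x = 0)" unfolding m_def by (intro not_less_Least) simp
    then obtain v where v: "v \<in> U" "(\<beta> ^^ k) v \<noteq> 0" by blast
    obtain W where W: "stable W" "W \<subseteq> U" "W \<inter> gen v = {0}"
      and UW: "U = {x + y | x y. x \<in> W \<and> y \<in> gen v}"
      by (rule complement[OF less.prems(1) v(1) m[unfolded k, rule_format] v(2)])
    have v': "v \<in> gen v" using genI[of 1 v 0] by simp
    have "v \<noteq> 0" using v(2) by auto
    then have "v \<notin> W" using W(3) v' by blast
    then have "W \<subset> U" using W(2) v(1) by blast
    then have rW: "rank W < rank U" using W(1) less.prems(1) rank_less by (simp add: stable_def)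
    have nW: "\<forall>x\<in>W. (\<beta> ^^ N) x = 0" using W(2) less.prems(2) by blast
    obtain r :: nat and vs ms where IH:
      "\<forall>i<r. vs i \<in> W \<and> (\<beta> ^^ ms i) (vs i) = 0 \<and> (\<forall>j<ms i. (\<beta> ^^ j) (vs i) \<noteq> 0)"
      "\<forall>x\<in>W. \<exists>f g. x = (\<Sum>i<r. f i *s vs i + g i *s \<beta> (vs i))"
      "\<forall>f g. (\<Sum>i<r. f i *s vs i + g i *s \<beta> (vs i)) = 0 \<longrightarrow> (\<forall>i<r. f i *s vs i + g i *s \<beta> (vs i) = 0)"
      using less.hyps[OF rW W(1) nW] by (elim exE conjE) (rule that; assumption)
    define vs' ms' where "vs' = vs(r := v)" and "ms' = ms(r := m)"
    have split: "(\<Sum>i<Suc r. f i *s vs' i + g i *s \<beta> (vs' i)) =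
      (\<Sum>i<r. f i *s vs i + g i *s \<beta> (vs i)) + (f r *s v + g r *s \<beta> v)" for f g
    proof -
      have "(\<Sum>i<r. f i *s vs' i + g i *s \<beta> (vs' i)) = (\<Sum>i<r. f i *s vs i + g i *s \<beta> (vs i))"
        by (rule sum.cong) (auto simp: vs'_def)
      then show ?thesis by (simp add: vs'_def)
    qed
    have inW: "(\<Sum>i<r. f i *s vs i + g i *s \<beta> (vs i)) \<in> W" for f g
    proof (rule subspace_sum)
      show "subspace W" using W(1) by (simp add: stable_def)
      fix i assume "i \<in> {..<r}"
      then have "vs i \<in> W" using IH(1) by blast
      then have "vs i \<in> W" "\<beta> (vs i) \<in> W" using W(1) by (simp_all add: stable_def)
      then show "f i *s vs i + g i *s \<beta> (vs i) \<in> W"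
        using W(1) by (simp add: stable_def subspace_add subspace_scale)
    qed
    have "(\<beta> ^^ j) v \<noteq> 0" if "j < m" for j
    proof
      assume "(\<beta> ^^ j) v = 0"
      then have "(\<beta> ^^ (k - j)) ((\<beta> ^^ j) v) = 0" by simp
      moreover have "(\<beta> ^^ (k - j)) ((\<beta> ^^ j) v) = (\<beta> ^^ k) v"
        using that k by (simp flip: funpow_add comp_apply[of "\<beta> ^^ (k - j)"])
      ultimately show False using v(2) by simp
    qed
    then have 1: "\<forall>i<Suc r. vs' i \<in> U \<and> (\<beta> ^^ ms' i) (vs' i) = 0 \<and> (\<forall>j<ms' i. (\<beta> ^^ j) (vs' i) \<noteq> 0)"
      using IH(1) W(2) v m unfolding vs'_def ms'_def by (auto simp: less_Suc_eq)
    have 2: "\<exists>f g. x = (\<Sum>i<Suc r. f i *s vs' i + g i *s \<beta> (vs' i))" if x: "x \<in> U" for x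
    proof -
      obtain w a b where w: "w \<in> W" "x = w + (a *s v + b *s \<beta> v)"
        using x unfolding UW gen_def by blast
      obtain f g where fg: "w = (\<Sum>i<r. f i *s vs i + g i *s \<beta> (vs i))" using IH(2) w(1) by blast
      have "x = (\<Sum>i<Suc r. (f(r:=a)) i *s vs' i + (g(r:=b)) i *s \<beta> (vs' i))"
        unfolding split w(2) fg by (auto intro!: arg_cong2[of _ _ _ _ plus] sum.cong)
      then show ?thesis by (intro exI[of _ "f(r:=a)"] exI[of _ "g(r:=b)"])
    qed
    have 3: "\<forall>i<Suc r. f i *s vs' i + g i *s \<beta> (vs' i) = 0"
      if "(\<Sum>i<Suc r. f i *s vs' i + g i *s \<beta> (vs' i)) = 0" for f g
    proof -
      define w where "w = (\<Sum>i<r. f i *s vs i + g i *s \<beta> (vs i))"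
      have "w \<in> W" unfolding w_def by (rule inW)
      \<comment> \<open>The vanishing sum places its part in \<open>W\<close> also in
        \<open>gen v\<close>, and these meet only in zero.\<close>
      moreover have eq: "w = - (f r *s v + g r *s \<beta> v)"
        using that[unfolded split] unfolding w_def eq_neg_iff_add_eq_0 .
      then have "w \<in> gen v" using stable_gen subspace_neg genI unfolding stable_def by metis
      ultimately have "w = 0" using W(3) by blast
      have "f r *s v + g r *s \<beta> v = 0" using eq \<open>w = 0\<close> by (metis neg_equal_0_iff_equal)
      moreover have "\<forall>i<r. f i *s vs i + g i *s \<beta> (vs i) = 0" using IH(3)[rule_format, of f g] \<open>w = 0\<close> w_def by simp
      ultimately show ?thesis by (auto simp: vs'_def less_Suc_eq)
    qed
    have 2: "\<forall>x\<in>U. \<exists>f g. x = (\<Sum>i<Suc r. f i *s vs' i + g i *s \<beta> (vs' i))"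
      by (intro ballI 2)
    have 3: "\<forall>f g. (\<Sum>i<Suc r. f i *s vs' i + g i *s \<beta> (vs' i)) = 0 \<longrightarrow>
      (\<forall>i<Suc r. f i *s vs' i + g i *s \<beta> (vs' i) = 0)"
      by (rule allI, rule allI, rule impI, rule 3)
    show ?thesis
      by (rule exI[of _ "Suc r"], rule exI[of _ vs'], rule exI[of _ ms'], intro conjI 1 2 3)
  qed
qed

text \<open>By \<open>annihilator\<close> a block is itself a direct sum of two cyclic modules over
  the base ring. The Boolean in the index tells the generator \<open>v i\<close> from
  \<open>\<beta> (v i)\<close>.\<close>

lemma decomposition:
  assumes "\<And>x. (\<beta> ^^ N) x = 0"
  obtains r :: nat and v m where "cyclic_decomp scale ({..<r} \<times> UNIV)
    (\<lambda>(i, b). if b then \<beta> (v i) else v i) (\<lambda>(i, b). if b then \<pi> ^ (m i div 2) else \<pi> ^ ((m i + 1) div 2))"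
proof -
  have "stable UNIV" by (simp add: stable_def)
  have "\<forall>x\<in>UNIV. (\<beta> ^^ N) x = 0" using assms by blast
  from decomposition_stable[OF \<open>stable UNIV\<close> this] obtain r :: nat and v m where
    v: "\<forall>i<r. v i \<in> UNIV \<and> (\<beta> ^^ m i) (v i) = 0 \<and> (\<forall>j<m i. (\<beta> ^^ j) (v i) \<noteq> 0)"
    and ex: "\<forall>x\<in>UNIV. \<exists>f g. x = (\<Sum>i<r. f i *s v i + g i *s \<beta> (v i))"
    and un: "\<forall>f g. (\<Sum>i<r. f i *s v i + g i *s \<beta> (v i)) = 0 \<longrightarrow>
      (\<forall>i<r. f i *s v i + g i *s \<beta> (v i) = 0)"
    by (elim exE conjE) (rule that; assumption)
  let ?v = "\<lambda>(i, b). if b then \<beta> (v i) else v i"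
  have sum: "(\<Sum>p\<in>{..<r} \<times> UNIV. f p *s ?v p) = (\<Sum>i<r. f (i, False) *s v i + f (i, True) *s \<beta> (v i))" for f
  proof -
    have "(\<Sum>p\<in>{..<r} \<times> UNIV. f p *s ?v p) = (\<Sum>(i, b)\<in>{..<r} \<times> UNIV. f (i, b) *s ?v (i, b))"
      by (rule sum.cong) auto
    also have "\<dots> = (\<Sum>i<r. \<Sum>b\<in>UNIV. f (i, b) *s ?v (i, b))" by (rule sum.cartesian_product[symmetric])
    finally show ?thesis by (simp add: UNIV_bool)
  qed
  have 1: "\<exists>f. x = (\<Sum>p\<in>{..<r} \<times> UNIV. f p *s ?v p)" for x
  proof -
    obtain f g where "x = (\<Sum>i<r. f i *s v i + g i *s \<beta> (v i))" using ex by blast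
    then have "x = (\<Sum>p\<in>{..<r} \<times> UNIV. (\<lambda>(i, b). if b then g i else f i) p *s ?v p)"
      unfolding sum by simp
    then show ?thesis by (rule exI[of _ "\<lambda>(i, b). if b then g i else f i"])
  qed
  have 2: "(\<Sum>p\<in>{..<r} \<times> UNIV. f p *s ?v p) = 0 \<longleftrightarrow>
    (\<forall>p\<in>{..<r} \<times> UNIV. (\<lambda>(i, b). if b then \<pi> ^ (m i div 2) else \<pi> ^ ((m i + 1) div 2)) p dvd f p)" for f
  proof -
    have "(\<Sum>p\<in>{..<r} \<times> UNIV. f p *s ?v p) = 0 \<longleftrightarrow>
        (\<forall>i<r. f (i, False) *s v i + f (i, True) *s \<beta> (v i) = 0)"
      unfolding sum using un[rule_format, of "\<lambda>i. f (i, False)" "\<lambda>i. f (i, True)"] by auto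
    also have "\<dots> \<longleftrightarrow> (\<forall>i<r. \<pi> ^ ((m i + 1) div 2) dvd f (i, False) \<and> \<pi> ^ (m i div 2) dvd f (i, True))"
      using v by (intro all_cong annihilator) auto
    finally show ?thesis by (auto split: if_splits)
  qed
  show ?thesis by (rule that[of r v m]) (use 1 2 in \<open>simp add: cyclic_decomp_def\<close>)
qed

end

section \<open>Cyclic decompositions and companion matrices\<close>

lemma sum_lessThan_add:
  fixes f :: "nat \<Rightarrow> 'c::comm_monoid_add"
  shows "(\<Sum>i<n + m. f i) = (\<Sum>i<n. f i) + (\<Sum>i<m. f (n + i))"
  by (induction m) (auto simp: add.assoc)

lemma all_less_add: "(\<forall>j<n + (m::nat). P j) \<longleftrightarrow> (\<forall>j<n. P j) \<and> (\<forall>j<m. P (n + j))"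
proof (intro iffI allI impI)
  fix j assume "(\<forall>j<n. P j) \<and> (\<forall>j<m. P (n + j))" "j < n + m"
  then show "P j" by (cases "j < n") (auto dest: spec[of _ "j - n"])
qed auto

lemma all_less_Suc0: "(\<forall>j<Suc m. P j) \<longleftrightarrow> P 0 \<and> (\<forall>j<m. P (Suc j))"
  using all_less_add[of 1 m P] by simp

lemma dim_companion_mat [simp]: "dim_row (companion_mat g) = degree g" "dim_col (companion_mat g) = degree g"
  by (simp_all add: companion_mat_def)

lemma dim_diag_companion:
  "diag_block_mat (map companion_mat gs) \<in> carrier_mat (sum_list (map degree gs)) (sum_list (map degree gs))"
  by (induction gs) (auto simp: Let_def)

locale endomorphism = vector_space scale
  for scale :: "'k::field \<Rightarrow> 'v::ab_group_add \<Rightarrow> 'v" +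
  fixes u :: "'v \<Rightarrow> 'v"
  assumes linear_u: "Vector_Spaces.linear scale scale u"
begin

abbreviation pact :: "'k poly \<Rightarrow> 'v \<Rightarrow> 'v" (infixr \<open>\<star>\<close> 75) where
  "f \<star> x \<equiv> poly_endo scale f u x"

lemma u_add: "u (x + y) = u x + u y"
  using linear_u by (simp add: Vector_Spaces.linear_iff)

lemma u_scale: "u (scale c x) = scale c (u x)"
  using linear_u by (simp add: Vector_Spaces.linear_iff)

lemma u_0 [simp]: "u 0 = 0"
  using u_add[of 0 0] by simp

lemma u_sum: "u (sum f A) = (\<Sum>x\<in>A. u (f x))"
  by (induction A rule: infinite_finite_induct) (auto simp: u_add)

lemma u_pow_add: "(u ^^ i) (x + y) = (u ^^ i) x + (u ^^ i) y"
  by (induction i) (auto simp: u_add)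

lemma u_pow_scale: "(u ^^ i) (scale c x) = scale c ((u ^^ i) x)"
  by (induction i) (auto simp: u_scale)

lemma pact_eq_sum:
  assumes "degree f \<le> n"
  shows "f \<star> x = (\<Sum>i\<le>n. scale (coeff f i) ((u ^^ i) x))"
  unfolding poly_endo_def
  using assms by (intro sum.mono_neutral_left) (auto simp: coeff_eq_0)

lemma pact_pCons: "pCons a f \<star> x = scale a x + u (f \<star> x)"
proof -
  have "pCons a f \<star> x = (\<Sum>i\<le>Suc (degree f). scale (coeff (pCons a f) i) ((u ^^ i) x))"
    by (rule pact_eq_sum) (rule degree_pCons_le)
  also have "\<dots> = scale a x + (\<Sum>i\<le>degree f. scale (coeff f i) (u ((u ^^ i) x)))"
    by (subst sum.atMost_Suc_shift) simp
  finally show ?thesis by (simp add: poly_endo_def u_sum u_scale)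
qed

lemma pact_0 [simp]: "0 \<star> x = 0"
  by (simp add: poly_endo_def)

lemma pact_add_left: "(f + g) \<star> x = f \<star> x + g \<star> x"
proof -
  define n where "n = max (degree f) (degree g)"
  have "degree f \<le> n" "degree g \<le> n" "degree (f + g) \<le> n"
    by (auto simp: n_def degree_add_le_max)
  then show ?thesis by (simp add: pact_eq_sum scale_left_distrib sum.distrib)
qed

lemma pact_add_right: "f \<star> (x + y) = f \<star> x + f \<star> y"
  by (simp add: poly_endo_def u_pow_add scale_right_distrib sum.distrib)

lemma pact_scale: "f \<star> scale c x = scale c (f \<star> x)"
  by (simp add: poly_endo_def u_pow_scale scale_sum_right mult.commute)

lemma pact_u: "f \<star> u x = u (f \<star> x)"
  by (simp add: poly_endo_def u_sum u_scale flip: funpow_swap1)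

lemma pact_smult: "smult c f \<star> x = scale c (f \<star> x)"
  by (induction f) (auto simp: pact_pCons scale_right_distrib u_scale)

lemma pact_mult: "(f * g) \<star> x = f \<star> g \<star> x"
  by (induction f) (auto simp: pact_add_left pact_smult pact_pCons)

lemma pact_1: "1 \<star> x = x"
  by (simp add: one_pCons pact_pCons)

lemma pact_const: "[:c:] \<star> x = scale c x"
  by (simp add: pact_pCons)

lemma pact_monom: "monom c i \<star> x = scale c ((u ^^ i) x)"
  by (induction i) (simp_all add: monom_0 monom_Suc pact_pCons u_scale)

text \<open>The standard module over the polynomial ring, with the indeterminate acting as
  \<open>u\<close>; its submodules are the \<open>u\<close>-invariant subspaces.\<close>

sublocale pmod: Modules.module "\<lambda>f x. f \<star> x"
  by unfold_locales (simp_all add: pact_add_left pact_add_right pact_mult pact_1)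

lemma subspace_pmod: "pmod.subspace W \<Longrightarrow> subspace W"
  unfolding pmod.subspace_def subspace_def by (metis pact_const)

text \<open>Kept apart from the basis condition because this part alone splits along block-diagonal
  matrices, as \<open>rep_append\<close> shows.\<close>

definition rep :: "'v list \<Rightarrow> 'k mat \<Rightarrow> bool" where
  "rep bs A \<longleftrightarrow> A \<in> carrier_mat (length bs) (length bs) \<and>
     (\<forall>j<length bs. u (bs ! j) = (\<Sum>i<length bs. scale (A $$ (i, j)) (bs ! i)))"

lemma represents_iff_rep: "represents scale u bs A \<longleftrightarrow> ordered_basis scale bs \<and> rep bs A"
  by (auto simp: represents_def rep_def)

lemma rep_append:
  assumes "A \<in> carrier_mat n n" "B \<in> carrier_mat m m" "length bs = n" "length cs = m"
  shows "rep (bs @ cs) (four_block_mat A (0\<^sub>m n m) (0\<^sub>m m n) B) \<longleftrightarrow> rep bs A \<and> rep cs B"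
proof -
  let ?M = "four_block_mat A (0\<^sub>m n m) (0\<^sub>m m n) B"
  have 1: "(\<Sum>i<n + m. scale (?M $$ (i, j)) ((bs @ cs) ! i)) = (\<Sum>i<n. scale (A $$ (i, j)) (bs ! i))"
    if "j < n" for j
    using assms that by (simp add: sum_lessThan_add nth_append)
  have 2: "(\<Sum>i<n + m. scale (?M $$ (i, n + j)) ((bs @ cs) ! i)) = (\<Sum>i<m. scale (B $$ (i, j)) (cs ! i))"
    if "j < m" for j
    using assms that by (simp add: sum_lessThan_add nth_append)
  have M: "?M \<in> carrier_mat (n + m) (n + m)" using assms by auto
  have "rep (bs @ cs) ?M \<longleftrightarrow>
      (\<forall>j<n. u ((bs @ cs) ! j) = (\<Sum>i<n + m. scale (?M $$ (i, j)) ((bs @ cs) ! i))) \<and>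
      (\<forall>j<m. u ((bs @ cs) ! (n + j)) = (\<Sum>i<n + m. scale (?M $$ (i, n + j)) ((bs @ cs) ! i)))"
    unfolding rep_def length_append assms(3,4) all_less_add using M by blast
  also have "\<dots> \<longleftrightarrow> (\<forall>j<n. u (bs ! j) = (\<Sum>i<n. scale (A $$ (i, j)) (bs ! i))) \<and>
      (\<forall>j<m. u (cs ! j) = (\<Sum>i<m. scale (B $$ (i, j)) (cs ! i)))"
    by (intro arg_cong2[of _ _ _ _ conj] all_cong, unfold 1 2) (simp_all add: nth_append assms(3))
  also have "\<dots> \<longleftrightarrow> rep bs A \<and> rep cs B"
    unfolding rep_def using assms by simp
  finally show ?thesis .
qed

definition orbit :: "'v \<Rightarrow> 'k poly \<Rightarrow> 'v list" where
  "orbit v g = map (\<lambda>l. (u ^^ l) v) [0..<degree g]"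

lemma length_orbit [simp]: "length (orbit v g) = degree g"
  by (simp add: orbit_def)

lemma nth_orbit: "i < degree g \<Longrightarrow> orbit v g ! i = (u ^^ i) v"
  by (simp add: orbit_def)

lemma pact_monic:
  assumes "monic g"
  shows "g \<star> v = (\<Sum>i<degree g. scale (coeff g i) ((u ^^ i) v)) + (u ^^ degree g) v"
  using assms by (simp add: poly_endo_def flip: lessThan_Suc_atMost)

text \<open>All columns but the last say that the list consists of successive images of its first
  vector; the last column says that \<open>g\<close> annihilates that vector.\<close>

lemma rep_companion:
  assumes g: "monic g"
  shows "rep bs (companion_mat g) \<longleftrightarrow> (\<exists>v. bs = orbit v g \<and> g \<star> v = 0)"
proof (cases "degree g = 0")
  \<comment> \<open>A constant monic \<open>g\<close> is 1: the block is empty and the generator it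
    belongs to must be 0.\<close>
  case True
  then have "g = 1" using g by (metis monic_degree_0)
  then show ?thesis by (auto simp: rep_def companion_mat_def orbit_def pact_1)
next
  case False
  then obtain d where d: "degree g = Suc d" using not0_implies_Suc by blast
  have last: "(\<Sum>i<Suc d. scale (companion_mat g $$ (i, d)) (cs ! i)) =
      - (\<Sum>i<Suc d. scale (coeff g i) (cs ! i))" for cs :: "'v list"
    unfolding sum_negf[symmetric] by (rule sum.cong) (auto simp: companion_mat_def d)
  have step: "(\<Sum>i<Suc d. scale (companion_mat g $$ (i, j)) (cs ! i)) = cs ! Suc j"
    if "j < d" for j and cs :: "'v list"
  proof -
    have "(\<Sum>i<Suc d. scale (companion_mat g $$ (i, j)) (cs ! i)) =
        (\<Sum>i<Suc d. if i = Suc j then cs ! i else 0)"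
      using that by (intro sum.cong) (auto simp: companion_mat_def d)
    also have "\<dots> = cs ! Suc j" using that by simp
    finally show ?thesis .
  qed
  have rep: "rep cs (companion_mat g) \<longleftrightarrow> length cs = Suc d \<and> (\<forall>j<d. u (cs ! j) = cs ! Suc j) \<and>
      u (cs ! d) = - (\<Sum>i<Suc d. scale (coeff g i) (cs ! i))" for cs
    unfolding rep_def carrier_mat_def using last step
    by (auto simp: d All_less_Suc less_Suc_eq simp del: sum.lessThan_Suc)
  show ?thesis
  proof
    assume r: "rep bs (companion_mat g)"
    define v where "v = bs ! 0"
    have nth: "bs ! i = (u ^^ i) v" if "i < Suc d" for i
      using that by (induction i) (use r rep in \<open>auto simp: v_def\<close>)
    have "bs = orbit v g"
      using r rep nth by (intro nth_equalityI) (auto simp: nth_orbit d)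
    moreover have "g \<star> v = 0"
      using r rep[of bs] nth by (simp add: pact_monic[OF g] d del: sum.lessThan_Suc)
    ultimately show "\<exists>v. bs = orbit v g \<and> g \<star> v = 0" by blast
  next
    assume "\<exists>v. bs = orbit v g \<and> g \<star> v = 0"
    then obtain v where bs: "bs = orbit v g" and "g \<star> v = 0" by blast
    then have "(\<Sum>i<Suc d. scale (coeff g i) ((u ^^ i) v)) + u ((u ^^ d) v) = 0"
      using pact_monic[OF g, of v] by (simp add: d del: sum.lessThan_Suc)
    then have "u ((u ^^ d) v) = - (\<Sum>i<Suc d. scale (coeff g i) ((u ^^ i) v))"
      by (metis add.commute eq_neg_iff_add_eq_0)
    then show "rep bs (companion_mat g)"
      unfolding rep bs by (simp add: d nth_orbit del: sum.lessThan_Suc)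
  qed
qed

definition orbits :: "'v list \<Rightarrow> 'k poly list \<Rightarrow> 'v list" where
  "orbits vs gs = concat (map2 orbit vs gs)"

lemma length_orbits: "length vs = length gs \<Longrightarrow> length (orbits vs gs) = sum_list (map degree gs)"
  by (induction vs gs rule: list_induct2) (auto simp: orbits_def)

lemma rep_diag_companion:
  assumes "\<forall>g\<in>set gs. monic g"
  shows "rep bs (diag_block_mat (map companion_mat gs)) \<longleftrightarrow>
    (\<exists>vs. length vs = length gs \<and> bs = orbits vs gs \<and> (\<forall>i<length gs. (gs ! i) \<star> (vs ! i) = 0))"
  using assms
proof (induction gs arbitrary: bs)
  case Nil
  then show ?case by (auto simp: rep_def orbits_def)
next
  case (Cons g gs)
  let ?n = "degree g" and ?m = "sum_list (map degree gs)"
  let ?B = "diag_block_mat (map companion_mat gs)"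
  have B: "?B \<in> carrier_mat ?m ?m" by (rule dim_diag_companion)
  have A: "companion_mat g \<in> carrier_mat ?n ?n" by (rule carrier_matI) simp_all
  have M: "diag_block_mat (map companion_mat (g # gs)) =
      four_block_mat (companion_mat g) (0\<^sub>m ?n ?m) (0\<^sub>m ?m ?n) ?B"
    using carrier_matD[OF B] by (simp add: Let_def)
  have app: "rep (bs\<^sub>1 @ bs\<^sub>2) (diag_block_mat (map companion_mat (g # gs))) \<longleftrightarrow>
      (\<exists>v. bs\<^sub>1 = orbit v g \<and> g \<star> v = 0) \<and> (\<exists>vs. length vs = length gs \<and> bs\<^sub>2 = orbits vs gs \<and>
        (\<forall>i<length gs. (gs ! i) \<star> (vs ! i) = 0))"
    if "length bs\<^sub>1 = ?n" "length bs\<^sub>2 = ?m" for bs\<^sub>1 bs\<^sub>2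
  proof -
    have "rep bs\<^sub>1 (companion_mat g) \<longleftrightarrow> (\<exists>v. bs\<^sub>1 = orbit v g \<and> g \<star> v = 0)"
      using Cons.prems by (intro rep_companion) simp
    moreover have "rep bs\<^sub>2 ?B \<longleftrightarrow> (\<exists>vs. length vs = length gs \<and> bs\<^sub>2 = orbits vs gs \<and>
        (\<forall>i<length gs. (gs ! i) \<star> (vs ! i) = 0))"
      by (rule Cons.IH) (simp add: Cons.prems)
    ultimately show ?thesis unfolding M rep_append[OF A B that] by (simp only:)
  qed
  show ?case
  proof
    assume r: "rep bs (diag_block_mat (map companion_mat (g # gs)))"
    then have len: "length bs = ?n + ?m" using A B unfolding M rep_def by auto
    have "rep (take ?n bs @ drop ?n bs) (diag_block_mat (map companion_mat (g # gs)))" using r by simp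
    then obtain v vs where "take ?n bs = orbit v g" "g \<star> v = 0" "length vs = length gs"
      "drop ?n bs = orbits vs gs" "\<forall>i<length gs. (gs ! i) \<star> (vs ! i) = 0"
      using app[of "take ?n bs" "drop ?n bs"] len by auto
    then have "bs = orbits (v # vs) (g # gs)"
      using append_take_drop_id[of ?n bs] by (simp add: orbits_def)
    moreover have "\<forall>i<length (g # gs). ((g # gs) ! i) \<star> ((v # vs) ! i) = 0"
      using \<open>g \<star> v = 0\<close> \<open>\<forall>i<length gs. (gs ! i) \<star> (vs ! i) = 0\<close>
      by (auto simp: nth_Cons split: nat.splits)
    ultimately show "\<exists>vs. length vs = length (g # gs) \<and> bs = orbits vs (g # gs) \<and>
        (\<forall>i<length (g # gs). ((g # gs) ! i) \<star> (vs ! i) = 0)"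
      using \<open>length vs = length gs\<close> by (intro exI[of _ "v # vs"]) auto
  next
    assume "\<exists>vs. length vs = length (g # gs) \<and> bs = orbits vs (g # gs) \<and>
        (\<forall>i<length (g # gs). ((g # gs) ! i) \<star> (vs ! i) = 0)"
    then obtain v vs where vs: "length vs = length gs" "bs = orbit v g @ orbits vs gs"
      "\<forall>i<length (g # gs). ((g # gs) ! i) \<star> ((v # vs) ! i) = 0"
      by (auto simp: length_Suc_conv orbits_def)
    have "g \<star> v = 0" using vs(3)[rule_format, of 0] by simp
    moreover have "\<forall>i<length gs. (gs ! i) \<star> (vs ! i) = 0"
      using vs(3)[rule_format, of "Suc i" for i] by simp
    ultimately show "rep bs (diag_block_mat (map companion_mat (g # gs)))"
      unfolding vs(2) using app[of "orbit v g" "orbits vs gs"] length_orbits[OF vs(1)] vs(1) by auto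
  qed
qed

end

section \<open>Ordered bases and coordinates indexed by position\<close>

definition lincomb ::
  "('k::field \<Rightarrow> 'v::ab_group_add \<Rightarrow> 'v) \<Rightarrow> (nat \<Rightarrow> 'k) \<Rightarrow> 'v list \<Rightarrow> 'v" where
  "lincomb scale c bs = (\<Sum>i<length bs. scale (c i) (bs ! i))"

lemma lincomb_distinct:
  assumes "distinct bs"
  shows "lincomb scale (\<lambda>i. c (bs ! i)) bs = (\<Sum>v\<in>set bs. scale (c v) v)"
  unfolding lincomb_def
  by (rule sum.reindex_bij_betw[OF bij_betw_nth[OF assms refl refl], of "\<lambda>v. scale (c v) v"])

text \<open>Coefficients belong to positions, so two equal entries give a nontrivial relation with
  coefficients 1 and -1. Uniqueness of coordinates therefore yields distinctness as well as
  independence.\<close>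

lemma independent_list:
  fixes scale :: "'k::field \<Rightarrow> 'v::ab_group_add \<Rightarrow> 'v"
  assumes "vector_space scale"
    and a: "\<forall>c. lincomb scale c bs = 0 \<longrightarrow> (\<forall>i<length bs. c i = 0)"
  shows "distinct bs" "\<not> module.dependent scale (set bs)"
proof -
  interpret vector_space scale by fact
  show d: "distinct bs"
  proof (rule ccontr)
    assume "\<not> distinct bs"
    then obtain i j where ij: "i < length bs" "j < length bs" "i \<noteq> j" "bs ! i = bs ! j"
      by (auto simp: distinct_conv_nth)
    define c where "c l = (if l = i then 1 else 0) - (if l = j then 1 else 0 :: 'k)" for l
    have "lincomb scale c bs = (\<Sum>l<length bs. (if l = i then bs ! l else 0) - (if l = j then bs ! l else 0))"
      unfolding lincomb_def by (rule sum.cong) (auto simp: c_def)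
    also have "\<dots> = 0" using ij by (simp add: sum_subtractf)
    finally have "c i = 0" using a ij(1) by blast
    then show False using ij(3) by (simp add: c_def)
  qed
  show "independent (set bs)"
    unfolding dependent_finite[OF finite_set]
  proof clarify
    fix c v assume v: "v \<in> set bs" "c v \<noteq> 0" and z: "(\<Sum>v\<in>set bs. scale (c v) v) = 0"
    obtain i where i: "i < length bs" "v = bs ! i" using v(1) by (auto simp: in_set_conv_nth)
    have "lincomb scale (\<lambda>i. c (bs ! i)) bs = 0" using lincomb_distinct[OF d, of scale c] z by simp
    then have "c (bs ! i) = 0" using a i(1) by blast
    then show False using v(2) i(2) by simp
  qed
qed

lemma ordered_basis_iff:
  fixes scale :: "'k::field \<Rightarrow> 'v::ab_group_add \<Rightarrow> 'v"
  assumes "vector_space scale"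
  shows "ordered_basis scale bs \<longleftrightarrow> (\<forall>x. \<exists>c. x = lincomb scale c bs) \<and>
     (\<forall>c. lincomb scale c bs = 0 \<longrightarrow> (\<forall>i<length bs. c i = 0))"
proof -
  interpret vector_space scale by fact
  show ?thesis
  proof
    assume b: "ordered_basis scale bs"
    then have d: "distinct bs" and i: "independent (set bs)" and s: "span (set bs) = UNIV"
      by (auto simp: ordered_basis_def)
    have "\<exists>c. x = lincomb scale c bs" for x
    proof -
      have "x \<in> range (\<lambda>c. \<Sum>v\<in>set bs. scale (c v) v)" using s span_finite[of "set bs"] by auto
      then obtain c where "x = (\<Sum>v\<in>set bs. scale (c v) v)" by blast
      then show ?thesis using lincomb_distinct[OF d, of scale c] by metis
    qed
    moreover have "c i = 0" if z: "lincomb scale c bs = 0" and i_less: "i < length bs" for c i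
    proof -
      \<comment> \<open>Distinctness identifies positions with vectors, so \<open>c\<close> can be
        read as a function of the vectors.\<close>
      define c' where "c' v = c (the_inv_into {..<length bs} ((!) bs) v)" for v
      have inj: "inj_on ((!) bs) {..<length bs}" using d by (simp add: inj_on_nth)
      have c': "c' (bs ! j) = c j" if "j < length bs" for j
        using the_inv_into_f_f[OF inj, of j] that by (simp add: c'_def)
      have "lincomb scale (\<lambda>i. c' (bs ! i)) bs = lincomb scale c bs"
        unfolding lincomb_def by (rule sum.cong) (auto simp: c')
      then have "(\<Sum>v\<in>set bs. scale (c' v) v) = 0" using lincomb_distinct[OF d, of scale c'] z by simp
      then have "c' (bs ! i) = 0" using independentD[OF i finite_set subset_refl] i_less nth_mem by blast
      then show ?thesis using c' i_less by simp
    qed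
    ultimately show "(\<forall>x. \<exists>c. x = lincomb scale c bs) \<and>
       (\<forall>c. lincomb scale c bs = 0 \<longrightarrow> (\<forall>i<length bs. c i = 0))" by blast
  next
    assume a: "(\<forall>x. \<exists>c. x = lincomb scale c bs) \<and>
       (\<forall>c. lincomb scale c bs = 0 \<longrightarrow> (\<forall>i<length bs. c i = 0))"
    have "x \<in> span (set bs)" for x
    proof -
      obtain c where "x = lincomb scale c bs" using a by blast
      moreover have "lincomb scale c bs \<in> span (set bs)"
        unfolding lincomb_def by (intro span_sum span_scale span_base) auto
      ultimately show ?thesis by simp
    qed
    moreover have "distinct bs" "independent (set bs)"
      using independent_list[OF vector_space_axioms] a by blast+
    ultimately show "ordered_basis scale bs" by (auto simp: ordered_basis_def)
  qed
qed

section \<open>Coordinates in a basis of orbits and reduced families of polynomials\<close>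

context endomorphism
begin

text \<open>Canonical representatives in the product of the quotients by the \<open>gs ! i\<close>.
  The zero polynomial is listed separately because its degree 0 is not below the degree of a
  constant modulus.\<close>

definition low :: "'k poly list \<Rightarrow> (nat \<Rightarrow> 'k poly) \<Rightarrow> bool" where
  "low gs f \<longleftrightarrow> (\<forall>i<length gs. f i = 0 \<or> degree (f i) < degree (gs ! i))"

lemma pact_low:
  assumes "f = 0 \<or> degree f < d"
  shows "f \<star> v = (\<Sum>j<d. scale (coeff f j) ((u ^^ j) v))"
proof (cases "f = 0")
  case False
  with assms show ?thesis
    unfolding poly_endo_def by (intro sum.mono_neutral_left) (auto simp: coeff_eq_0)
qed simp

lemma lincomb_orbits_Cons:
  assumes "length vs = length gs"
  shows "lincomb scale c (orbits (v # vs) (g # gs)) =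
    (\<Sum>j<degree g. scale (c j) ((u ^^ j) v)) + lincomb scale (\<lambda>j. c (degree g + j)) (orbits vs gs)"
proof -
  have "orbits (v # vs) (g # gs) = orbit v g @ orbits vs gs" by (simp add: orbits_def)
  then show ?thesis
    by (simp add: lincomb_def sum_lessThan_add nth_append nth_orbit)
qed

text \<open>Cutting the coordinates into blocks, one for each modulus, gives the coefficients of a
  reduced family. The final clause carries vanishing back to the coordinates;
  \<open>low_to_lincomb\<close> is the reverse passage.\<close>

lemma lincomb_to_low:
  assumes "length vs = length gs"
  shows "\<exists>f. low gs f \<and> lincomb scale c (orbits vs gs) = (\<Sum>i<length gs. f i \<star> (vs ! i)) \<and>
    ((\<forall>i<length gs. f i = 0) \<longrightarrow> (\<forall>j<length (orbits vs gs). c j = 0))"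
  using assms
proof (induction vs gs arbitrary: c rule: list_induct2)
  case Nil
  then show ?case by (simp add: low_def orbits_def lincomb_def)
next
  case (Cons v vs g gs)
  obtain f where f: "low gs f" "lincomb scale (\<lambda>j. c (degree g + j)) (orbits vs gs) = (\<Sum>i<length gs. f i \<star> (vs ! i))"
    "(\<forall>i<length gs. f i = 0) \<longrightarrow> (\<forall>j<length (orbits vs gs). c (degree g + j) = 0)"
    using Cons.IH[of "\<lambda>j. c (degree g + j)"] by blast
  define h where "h = (\<Sum>j<degree g. monom (c j) j)"
  have coeff_h: "coeff h j = (if j < degree g then c j else 0)" for j
    by (simp add: h_def coeff_sum)
  have h: "h = 0 \<or> degree h < degree g"
  proof (rule disjCI)
    assume "\<not> degree h < degree g"
    then have "coeff h (degree h) = 0" unfolding coeff_h by (rule if_not_P)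
    then show "h = 0" by (rule iffD1[OF leading_coeff_0_iff])
  qed
  define f' where "f' i = (case i of 0 \<Rightarrow> h | Suc i \<Rightarrow> f i)" for i
  have "low (g # gs) f'" using h f(1) by (simp add: low_def all_less_Suc0 f'_def)
  moreover have "lincomb scale c (orbits (v # vs) (g # gs)) = (\<Sum>i<length (g # gs). f' i \<star> ((v # vs) ! i))"
    unfolding lincomb_orbits_Cons[OF Cons.hyps] f(2) length_Cons sum.lessThan_Suc_shift
    by (simp add: f'_def pact_low[OF h] coeff_h)
  moreover have "\<forall>j<length (orbits (v # vs) (g # gs)). c j = 0" if "\<forall>i<length (g # gs). f' i = 0"
  proof -
    have "h = 0" "\<forall>i<length gs. f i = 0" using that by (simp_all add: all_less_Suc0 f'_def)
    moreover have "length (orbits (v # vs) (g # gs)) = degree g + length (orbits vs gs)"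
      by (simp add: orbits_def)
    moreover have "\<forall>j<degree g. c j = 0" using coeff_h unfolding \<open>h = 0\<close> by (metis coeff_0)
    ultimately show ?thesis using f(3) by (simp add: all_less_add)
  qed
  ultimately show ?case by blast
qed

lemma low_to_lincomb:
  assumes "length vs = length gs" "low gs f"
  shows "\<exists>c. lincomb scale c (orbits vs gs) = (\<Sum>i<length gs. f i \<star> (vs ! i)) \<and>
    ((\<forall>j<length (orbits vs gs). c j = 0) \<longrightarrow> (\<forall>i<length gs. f i = 0))"
  using assms
proof (induction vs gs arbitrary: f rule: list_induct2)
  case Nil
  then show ?case by (simp add: orbits_def lincomb_def)
next
  case (Cons v vs g gs)
  have h: "f 0 = 0 \<or> degree (f 0) < degree g" and "low gs (\<lambda>i. f (Suc i))"
    using Cons.prems by (simp_all add: low_def all_less_Suc0)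
  then obtain c where c: "lincomb scale c (orbits vs gs) = (\<Sum>i<length gs. f (Suc i) \<star> (vs ! i))"
    "(\<forall>j<length (orbits vs gs). c j = 0) \<longrightarrow> (\<forall>i<length gs. f (Suc i) = 0)"
    using Cons.IH[of "\<lambda>i. f (Suc i)"] by blast
  define c' where "c' j = (if j < degree g then coeff (f 0) j else c (j - degree g))" for j
  have "lincomb scale c' (orbits (v # vs) (g # gs)) = (\<Sum>i<length (g # gs). f i \<star> ((v # vs) ! i))"
    unfolding lincomb_orbits_Cons[OF Cons.hyps] length_Cons sum.lessThan_Suc_shift
    by (simp add: c'_def pact_low[OF h] c(1))
  moreover have "\<forall>i<length (g # gs). f i = 0" if "\<forall>j<length (orbits (v # vs) (g # gs)). c' j = 0"
  proof -
    have "length (orbits (v # vs) (g # gs)) = degree g + length (orbits vs gs)"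
      by (simp add: orbits_def)
    then have "\<forall>j<degree g. c' j = 0" "\<forall>j<length (orbits vs gs). c' (degree g + j) = 0"
      using that all_less_add[of "degree g" "length (orbits vs gs)" "\<lambda>j. c' j = 0"] by simp_all
    then have "\<forall>j<degree g. coeff (f 0) j = 0" "\<forall>j<length (orbits vs gs). c j = 0"
      by (simp_all add: c'_def)
    then have "f 0 = 0" "\<forall>i<length gs. f (Suc i) = 0"
      using h c(2) leading_coeff_0_iff by blast+
    then show ?thesis by (simp add: all_less_Suc0)
  qed
  ultimately show ?case by blast
qed

text \<open>If each modulus annihilates its generator, division with remainder replaces any family
  of polynomials by a reduced one without changing the sum, and reduced families are the same as
  coordinates in the orbits.\<close>

lemma ordered_basis_orbits_iff:
  assumes len: "length vs = length gs" and monic: "\<forall>g\<in>set gs. monic g"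
  shows "ordered_basis scale (orbits vs gs) \<and> (\<forall>i<length gs. (gs ! i) \<star> (vs ! i) = 0) \<longleftrightarrow>
    cyclic_decomp (\<lambda>f x. f \<star> x) {..<length gs} ((!) vs) ((!) gs)"
proof -
  let ?r = "length gs"
  have nz: "gs ! i \<noteq> 0" if "i < ?r" for i using monic that nth_mem by fastforce
  have low_mod: "low gs (\<lambda>i. f i mod gs ! i)" for f
    unfolding low_def using nz degree_mod_less by blast
  have sum_mod: "(\<Sum>i<?r. (f i mod gs ! i) \<star> (vs ! i)) = (\<Sum>i<?r. f i \<star> (vs ! i))"
    if ann: "\<forall>i<?r. (gs ! i) \<star> (vs ! i) = 0" for f
  proof (rule sum.cong)
    fix i assume "i \<in> {..<?r}"
    then have z: "(gs ! i) \<star> (vs ! i) = 0" using ann by blast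
    have "f i \<star> (vs ! i) = (f i div gs ! i * gs ! i + f i mod gs ! i) \<star> (vs ! i)"
      by (simp only: div_mult_mod_eq)
    also have "\<dots> = (f i mod gs ! i) \<star> (vs ! i)"
      unfolding pact_add_left pact_mult z by simp
    finally show "(f i mod gs ! i) \<star> (vs ! i) = f i \<star> (vs ! i)" by simp
  qed simp
  show ?thesis
  proof
    assume b: "ordered_basis scale (orbits vs gs) \<and> (\<forall>i<?r. (gs ! i) \<star> (vs ! i) = 0)"
    then have ex: "\<forall>x. \<exists>c. x = lincomb scale c (orbits vs gs)"
      and un: "\<forall>c. lincomb scale c (orbits vs gs) = 0 \<longrightarrow> (\<forall>i<length (orbits vs gs). c i = 0)"
      and ann: "\<forall>i<?r. (gs ! i) \<star> (vs ! i) = 0"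
      using ordered_basis_iff[OF vector_space_axioms] by simp_all
    have "\<exists>f. x = (\<Sum>i<?r. f i \<star> (vs ! i))" for x
    proof -
      obtain c where "x = lincomb scale c (orbits vs gs)" using ex by blast
      then show ?thesis using lincomb_to_low[OF len, of c] by metis
    qed
    moreover have "(\<Sum>i<?r. f i \<star> (vs ! i)) = 0 \<longleftrightarrow> (\<forall>i<?r. gs ! i dvd f i)" for f
    proof
      assume "(\<Sum>i<?r. f i \<star> (vs ! i)) = 0"
      then have "(\<Sum>i<?r. (f i mod gs ! i) \<star> (vs ! i)) = 0" using sum_mod[OF ann] by simp
      moreover obtain c where "lincomb scale c (orbits vs gs) = (\<Sum>i<?r. (f i mod gs ! i) \<star> (vs ! i))"
        "(\<forall>j<length (orbits vs gs). c j = 0) \<longrightarrow> (\<forall>i<?r. f i mod gs ! i = 0)"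
        using low_to_lincomb[OF len low_mod, of f] by blast
      ultimately have "\<forall>i<?r. f i mod gs ! i = 0" using un by simp
      then show "\<forall>i<?r. gs ! i dvd f i" by (simp add: dvd_eq_mod_eq_0)
    next
      assume "\<forall>i<?r. gs ! i dvd f i"
      then have "\<forall>i<?r. f i mod gs ! i = 0" by simp
      then have "(\<Sum>i<?r. (f i mod gs ! i) \<star> (vs ! i)) = 0" by simp
      then show "(\<Sum>i<?r. f i \<star> (vs ! i)) = 0" using sum_mod[OF ann] by simp
    qed
    ultimately show "cyclic_decomp (\<lambda>f x. f \<star> x) {..<?r} ((!) vs) ((!) gs)"
      by (simp add: cyclic_decomp_def Ball_def)
  next
    assume c: "cyclic_decomp (\<lambda>f x. f \<star> x) {..<?r} ((!) vs) ((!) gs)"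
    have ann: "\<forall>i<?r. (gs ! i) \<star> (vs ! i) = 0"
      using cyclic_decomp_annihilates[OF pmod.module_axioms c] by simp
    have "\<exists>c. x = lincomb scale c (orbits vs gs)" for x
    proof -
      obtain f where "x = (\<Sum>i<?r. f i \<star> (vs ! i))" using c unfolding cyclic_decomp_def by blast
      then have "x = (\<Sum>i<?r. (f i mod gs ! i) \<star> (vs ! i))" using sum_mod[OF ann] by simp
      moreover obtain c where "lincomb scale c (orbits vs gs) = (\<Sum>i<?r. (f i mod gs ! i) \<star> (vs ! i))"
        using low_to_lincomb[OF len low_mod, of f] by blast
      ultimately have "x = lincomb scale c (orbits vs gs)" by simp
      then show ?thesis by blast
    qed
    moreover have "\<forall>i<length (orbits vs gs). c' i = 0" if "lincomb scale c' (orbits vs gs) = 0" for c'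
    proof -
      obtain f where f: "low gs f" "lincomb scale c' (orbits vs gs) = (\<Sum>i<?r. f i \<star> (vs ! i))"
        "(\<forall>i<?r. f i = 0) \<longrightarrow> (\<forall>j<length (orbits vs gs). c' j = 0)"
        using lincomb_to_low[OF len, of c'] by blast
      then have "(\<Sum>i<?r. f i \<star> (vs ! i)) = 0" using that by simp
      then have dvd: "gs ! i dvd f i" if "i < ?r" for i
        using cyclic_decomp_eq_0_iff[OF c, of f] that by simp
      \<comment> \<open>A reduced polynomial that is divisible by its modulus is zero, by
        degrees.\<close>
      have "f i = 0" if "i < ?r" for i
      proof (rule ccontr)
        assume "f i \<noteq> 0"
        then show False using dvd_imp_degree_le[OF dvd[OF that]] f(1) that by (auto simp: low_def)
      qed
      then show ?thesis using f(3) by blast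
    qed
    ultimately show "ordered_basis scale (orbits vs gs) \<and> (\<forall>i<?r. (gs ! i) \<star> (vs ! i) = 0)"
      using ann ordered_basis_iff[OF vector_space_axioms] by simp
  qed
qed

text \<open>The passage between matrices and modules: every later statement about companion blocks
  is turned into one about cyclic summands here.\<close>

lemma represents_companions_iff:
  assumes "\<forall>g\<in>set gs. monic g"
  shows "(\<exists>bs. represents scale u bs (diag_block_mat (map companion_mat gs))) \<longleftrightarrow>
    (\<exists>v. cyclic_decomp (\<lambda>f x. f \<star> x) {..<length gs} v ((!) gs))"
proof
  assume "\<exists>bs. represents scale u bs (diag_block_mat (map companion_mat gs))"
  then show "\<exists>v. cyclic_decomp (\<lambda>f x. f \<star> x) {..<length gs} v ((!) gs)"
    using rep_diag_companion[OF assms] ordered_basis_orbits_iff[OF _ assms]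
    unfolding represents_iff_rep by metis
next
  assume "\<exists>v. cyclic_decomp (\<lambda>f x. f \<star> x) {..<length gs} v ((!) gs)"
  then obtain v where v: "cyclic_decomp (\<lambda>f x. f \<star> x) {..<length gs} v ((!) gs)" by blast
  define vs where "vs = map v [0..<length gs]"
  have len: "length vs = length gs" by (simp add: vs_def)
  have "cyclic_decomp (\<lambda>f x. f \<star> x) {..<length gs} ((!) vs) ((!) gs)"
    by (rule cyclic_decomp_reindex[OF v bij_betw_id]) (simp_all add: vs_def)
  then show "\<exists>bs. represents scale u bs (diag_block_mat (map companion_mat gs))"
    using ordered_basis_orbits_iff[OF len assms] rep_diag_companion[OF assms, of "orbits vs gs"] len
    unfolding represents_iff_rep by blast
qed

end

section \<open>The polynomials\<close>

text \<open>A nonzero element of least degree in the ideal of \<open>h\<close> and \<pi> divides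
  both by division with remainder. As \<pi> is irreducible and does not divide \<open>h\<close>,
  that element is a unit.\<close>

lemma irreducible_bezout:
  fixes \<pi> h :: "'k::field poly"
  assumes irr: "irreducible \<pi>" and ndvd: "\<not> \<pi> dvd h"
  shows "\<exists>a b. a * h + b * \<pi> = 1"
proof -
  define P where "P g \<longleftrightarrow> g \<noteq> 0 \<and> (\<exists>a b. g = a * h + b * \<pi>)" for g
  have "\<pi> \<noteq> 0" using irr by auto
  moreover have "\<pi> = 0 * h + 1 * \<pi>" by simp
  ultimately have "P \<pi>" unfolding P_def by blast
  from ex_has_least_nat[of P, OF this, of degree]
  obtain g where g: "P g" and min: "\<And>g'. P g' \<Longrightarrow> degree g \<le> degree g'" by blast
  obtain a b where ab: "g = a * h + b * \<pi>" using g by (auto simp: P_def)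
  have dvd: "g dvd c * h + d * \<pi>" for c d
  proof (rule ccontr)
    let ?f = "c * h + d * \<pi>"
    assume "\<not> g dvd ?f"
    then have nz: "?f mod g \<noteq> 0" by (simp add: mod_eq_0_iff_dvd)
    have "?f mod g = ?f - ?f div g * g" by (simp add: minus_div_mult_eq_mod)
    also have "\<dots> = (c - ?f div g * a) * h + (d - ?f div g * b) * \<pi>"
      by (subst (2) ab) (simp add: algebra_simps)
    finally have "P (?f mod g)" using nz unfolding P_def by blast
    then show False using min degree_mod_less'[of g ?f] nz g unfolding P_def by fastforce
  qed
  have "g dvd h" using dvd[of 1 0] by simp
  have "g dvd \<pi>" using dvd[of 0 1] by simp
  then obtain k where k: "\<pi> = g * k" by (elim dvdE)
  have "\<not> k dvd 1"
  proof
    assume "k dvd 1"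
    then have "\<pi> dvd g" using k by (simp add: mult_unit_dvd_iff)
    then show False using ndvd \<open>g dvd h\<close> dvd_trans by blast
  qed
  then have "g dvd 1" using irreducibleD[OF irr k] by blast
  then obtain e where "1 = g * e" by (elim dvdE)
  then have "(e * a) * h + (e * b) * \<pi> = 1" by (simp add: ab algebra_simps)
  then show ?thesis by blast
qed

lemma irreducible_quadratic_no_root:
  fixes p :: "'k::field poly"
  assumes "irreducible p" "degree p = 2"
  shows "poly p c \<noteq> 0"
proof
  assume "poly p c = 0"
  then obtain h where h: "p = [:- c, 1:] * h" by (auto simp: poly_eq_0_iff_dvd elim: dvdE)
  with assms(2) have "h \<noteq> 0" by auto
  then have "degree h = 1" using h assms(2) by (simp add: degree_mult_eq del: mult_pCons_left)
  moreover have "[:- c, 1:] dvd 1 \<or> h dvd 1" using irreducibleD[OF assms(1) h] .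
  ultimately show False by (auto simp: poly_dvd_1)
qed

lemma monic_quadratic_eq:
  assumes "monic p" "degree p = 2"
  shows "p = [:coeff p 0, coeff p 1, 1:]"
proof (rule poly_eqI)
  fix n
  show "coeff p n = coeff [:coeff p 0, coeff p 1, 1:] n"
    using assms coeff_eq_0[of p n]
    by (cases n; cases "n - 1"; cases "n - 2") (auto simp: coeff_pCons numeral_2_eq_2 split: nat.splits)
qed

lemma poly_ac_poly: "poly (ac_poly f) (to_ac c) = to_ac (poly f c)"
  by (induction f) (simp_all add: ac_poly_def Polynomial.map_poly_pCons)

lemma order_linear_factor: "order a [:- b, 1:] = (if a = b then 1 else 0)" for a b :: "'a::field"
proof (cases "a = b")
  case True
  then show ?thesis using order_power_n_n[of b 1] by simp
next
  case False
  then show ?thesis by (simp add: order_0I)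
qed

lemma rsquarefree_quadratic:
  fixes a b :: "'a::field"
  shows "rsquarefree ([:- a, 1:] * [:- b, 1:]) \<longleftrightarrow> a \<noteq> b"
proof -
  have nz: "[:- a, 1:] * [:- b, 1:] \<noteq> 0" unfolding mult_eq_0_iff by simp
  then show ?thesis unfolding rsquarefree_def order_mult[OF nz] order_linear_factor by auto
qed

lemma prod_mset_eq_0_iff:
  fixes f :: "'a \<Rightarrow> 'b::{semidom}"
  shows "(\<Prod>x\<in>#A. f x) = 0 \<longleftrightarrow> (\<exists>x\<in>#A. f x = 0)"
  by (induction A) auto

text \<open>Turns d-exceptionality into the condition that all eigenvalues are roots of F.\<close>

lemma poly_ac_poly_F_poly_eq_0_iff:
  fixes p q :: "'k::field poly"
  assumes p: "monic p" "degree p = 2" and q: "monic q" "degree q = 2"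
  shows "poly (ac_poly (F_poly p q)) z = 0 \<longleftrightarrow> z \<in> {x - y | x y. x \<in> Root p \<and> y \<in> Root q}"
proof -
  have nz: "ac_poly p \<noteq> 0" "ac_poly q \<noteq> 0"
    using degree_ac_poly[of p] degree_ac_poly[of q] p(2) q(2) by force+
  have "poly (ac_poly (F_poly p q)) z =
      (\<Prod>x\<in>#proots (ac_poly p). \<Prod>y\<in>#proots (ac_poly q). z - (x - y))"
    unfolding ac_poly_F_poly[OF p q] by (simp add: poly_prod_mset image_mset.compositionality o_def algebra_simps)
  also have "\<dots> = 0 \<longleftrightarrow> (\<exists>x\<in>#proots (ac_poly p). \<exists>y\<in>#proots (ac_poly q). z - (x - y) = 0)"
    by (simp only: prod_mset_eq_0_iff)
  also have "\<dots> \<longleftrightarrow> z \<in> {x - y | x y. x \<in> Root p \<and> y \<in> Root q}"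
    using nz by (auto simp: Root_def)
  finally show ?thesis .
qed

section \<open>Characteristic 2 and the explicit form of F\<close>

locale separable_inseparable =
  fixes p q :: "'k::field poly"
  assumes p: "irreducible p" "monic p" "degree p = 2" "separable_poly p"
    and q: "irreducible q" "monic q" "degree q = 2" "\<not> separable_poly q"
begin

text \<open>In characteristic 2, which is derived below, \<tau> is both the sum and the difference
  of the two roots of \<open>p\<close>, and \<delta> is the square of the double root of
  \<open>q\<close>.\<close>

definition \<tau> :: 'k where "\<tau> = coeff p 1"
definition \<delta> :: 'k where "\<delta> = coeff q 0"
definition F :: "'k poly" where "F = F_poly p q"

lemma q_root:
  obtains y where "ac_poly q = [:- y, 1:] * [:- y, 1:]"
  using monic_quadratic_splits[OF q(2,3)] q(4) rsquarefree_quadratic unfolding separable_poly_def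
  by metis

text \<open>If 2 were invertible, the double root of \<open>q\<close> would be minus half its linear
  coefficient, hence an element of the base field, against irreducibility. With 2 = 0 the linear
  coefficient, minus twice the root, vanishes.\<close>

lemma char_2: "(2::'k) = 0" and coeff_q_1: "coeff q 1 = 0"
proof -
  obtain y where y: "ac_poly q = [:- y, 1:] * [:- y, 1:]" by (rule q_root)
  have q1: "to_ac (coeff q 1) = - (2 * y)"
    using arg_cong[OF y, of "\<lambda>f. coeff f 1"] by (simp add: ac_poly_def coeff_map_poly)
  show 2: "(2::'k) = 0"
  proof (rule ccontr)
    assume 2: "(2::'k) \<noteq> 0"
    define c where "c = - coeff q 1 / 2"
    have "2 * c = - coeff q 1" using 2 by (simp add: c_def)
    then have "to_ac (2 * c) = to_ac (- coeff q 1)" by (rule arg_cong)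
    then have "2 * to_ac c = 2 * y" using q1 by simp
    moreover have "to_ac (2::'k) \<noteq> 0" using 2 to_ac_eq_0_iff by blast
    ultimately have "to_ac c = y" by simp
    then have "poly (ac_poly q) (to_ac c) = 0" unfolding y by simp
    then show False using irreducible_quadratic_no_root[OF q(1,3)] by (simp add: poly_ac_poly)
  qed
  have "(2::'k alg_closure) = to_ac 2" by simp
  also have "\<dots> = 0" unfolding 2 by simp
  finally have "to_ac (coeff q 1) = 0" using q1 by simp
  then show "coeff q 1 = 0" by simp
qed

lemma char_2_ac: "(2::'k alg_closure) = 0"
proof -
  have "(2::'k alg_closure) = to_ac 2" by simp
  also have "\<dots> = 0" unfolding char_2 by simp
  finally show ?thesis .
qed

lemma char_2_poly: "(2::'k poly) = 0"
proof -
  have "(2::'k poly) = [:2:]" by (simp add: numeral_poly)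
  then show ?thesis by (simp add: char_2)
qed

lemma add_self [simp]: "(f::'k poly) + f = 0"
  using char_2_poly by (metis mult_2 mult_zero_left)

lemma p_roots:
  obtains x where "ac_poly p = [:- x, 1:] * [:- (x + to_ac \<tau>), 1:]"
proof -
  obtain x x' where x: "ac_poly p = [:- x, 1:] * [:- x', 1:]" using monic_quadratic_splits[OF p(2,3)] .
  have "to_ac \<tau> = - x - x'"
    using arg_cong[OF x, of "\<lambda>f. coeff f 1"] by (simp add: ac_poly_def \<tau>_def coeff_map_poly)
  then have "x + to_ac \<tau> = x' - 2 * x'" by simp
  then have "x + to_ac \<tau> = x'" by (simp add: char_2_ac)
  then show ?thesis using x that by blast
qed

lemma \<tau>_nonzero: "\<tau> \<noteq> 0"
proof
  assume "\<tau> = 0"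
  obtain x where "ac_poly p = [:- x, 1:] * [:- (x + to_ac \<tau>), 1:]" by (rule p_roots)
  then have "ac_poly p = [:- x, 1:] * [:- x, 1:]" by (simp add: \<open>\<tau> = 0\<close>)
  then show False using p(4) rsquarefree_quadratic[of x x] unfolding separable_poly_def by simp
qed

lemma p_eq: "p = [:coeff p 0, \<tau>, 1:]"
  using monic_quadratic_eq[OF p(2,3)] by (simp add: \<tau>_def)

lemma q_eq: "q = [:\<delta>, 0, 1:]"
  using monic_quadratic_eq[OF q(2,3)] by (simp only: \<delta>_def coeff_q_1)

text \<open>With roots x and x + \<tau> of \<open>p\<close> and the double root y of
  \<open>q\<close>, the polynomial F is the square of p + \<tau> y + \<delta> over the closure, and
  squaring is additive in characteristic 2.\<close>

lemma F_eq: "F = p\<^sup>2 + [:\<delta>\<^sup>2 + \<tau>\<^sup>2 * \<delta>:]"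
proof -
  interpret hom: map_poly_inj_idom_hom "to_ac :: 'k \<Rightarrow> 'k alg_closure" by (rule ac_poly_hom)
  obtain x where x: "ac_poly p = [:- x, 1:] * [:- (x + to_ac \<tau>), 1:]" by (rule p_roots)
  obtain y where y: "ac_poly q = [:- y, 1:] * [:- y, 1:]" by (rule q_root)
  have px: "proots (ac_poly p) = {#x, x + to_ac \<tau>#}" and qy: "proots (ac_poly q) = {#y, y#}"
    unfolding x y by (subst proots_mult; simp)+
  have \<delta>: "to_ac \<delta> = y * y"
    using arg_cong[OF y, of "\<lambda>f. coeff f 0"] by (simp add: ac_poly_def \<delta>_def coeff_map_poly)
  define T A Y where "T = [:to_ac \<tau>:]" and "A = [:- x, 1:]" and "Y = [:y:]"
  have 2: "(2::'k alg_closure poly) = 0" using char_2_ac by (simp add: numeral_poly)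
  have "ac_poly (p\<^sup>2 + [:\<delta>\<^sup>2 + \<tau>\<^sup>2 * \<delta>:]) = (ac_poly p)\<^sup>2 + ((Y * Y)\<^sup>2 + T\<^sup>2 * (Y * Y))"
    unfolding ac_poly_def hom.hom_add hom.hom_power
    by (simp add: Y_def T_def \<delta> Polynomial.map_poly_pCons power2_eq_square mult_ac)
  also have "\<dots> = (A * (A - T))\<^sup>2 + ((Y * Y)\<^sup>2 + T\<^sup>2 * (Y * Y))"
    unfolding x by (simp add: A_def T_def)
  \<comment> \<open>The multiple of 2 is written out so that the equation is an identity in every
    commutative ring; only then is 2 set to 0.\<close>
  also have "\<dots> = ((A + Y) * (A + Y)) * (((A - T) + Y) * ((A - T) + Y))
      - 2 * ((A * (A - T)) * (Y * (2 * A - T)) + (A * (A - T)) * (Y * Y)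
        + 2 * ((Y * Y) * (A * (A - T))) + Y * Y * Y * (2 * A - T))"
    by (simp add: power2_eq_square algebra_simps)
  also have "\<dots> = ((A + Y) * (A + Y)) * (((A - T) + Y) * ((A - T) + Y))" by (simp add: 2)
  also have "\<dots> = (\<Prod>x\<in>#proots (ac_poly p). \<Prod>y\<in>#proots (ac_poly q). [:- (x - y), 1:])"
    unfolding px qy by (simp add: A_def T_def Y_def algebra_simps)
  also have "\<dots> = ac_poly F" unfolding F_def by (rule ac_poly_F_poly[OF p(2,3) q(2,3), symmetric])
  finally show ?thesis using ac_poly_inj by metis
qed

end

lemma ac_poly_mult: "ac_poly (f * g) = ac_poly f * ac_poly g"
proof -
  interpret hom: map_poly_inj_idom_hom "to_ac :: 'a \<Rightarrow> 'a alg_closure" by (rule ac_poly_hom)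
  show ?thesis by (simp add: ac_poly_def hom.hom_mult)
qed

section \<open>Irreducibility of F\<close>

context separable_inseparable
begin

lemma monic_F: "monic F" and degree_F: "degree F = 4"
proof -
  have d: "degree (p\<^sup>2) = 4" using p(2,3) by (subst degree_power_eq) auto
  have m: "monic (p\<^sup>2)" using p(2) by (simp add: lead_coeff_power)
  have "degree [:\<delta>\<^sup>2 + \<tau>\<^sup>2 * \<delta>:] < degree (p\<^sup>2)" using d by simp
  then show "degree F = 4" "monic F"
    unfolding F_eq using d m by (simp_all add: degree_add_eq_left lead_coeff_add_le coeff_eq_0)
qed

lemma minus_ac: "- z = z" for z :: "'k alg_closure"
  using char_2_ac by (metis add.inverse_unique mult_2 mult_zero_left)

lemma eq_if_add_eq_0_ac: "z + z' = 0 \<Longrightarrow> z = z'" for z z' :: "'k alg_closure"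
  using minus_ac[of z'] by (metis eq_neg_iff_add_eq_0)

lemma p_root_square:
  assumes "poly (ac_poly p) x = 0"
  shows "x * x = to_ac (coeff p 0) + to_ac \<tau> * x"
proof -
  have "ac_poly p = [:to_ac (coeff p 0), to_ac \<tau>, 1:]"
    using arg_cong[OF p_eq, of ac_poly] by (simp add: ac_poly_def Polynomial.map_poly_pCons)
  then have "x * x + (to_ac (coeff p 0) + to_ac \<tau> * x) = 0" using assms by (simp add: algebra_simps)
  then show ?thesis by (rule eq_if_add_eq_0_ac)
qed

lemma q_root_square:
  assumes "poly (ac_poly q) y = 0"
  shows "y * y = to_ac \<delta>"
proof -
  have "ac_poly q = [:to_ac \<delta>, 0, 1:]"
    using arg_cong[OF q_eq, of ac_poly] by (simp add: ac_poly_def Polynomial.map_poly_pCons)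
  then have "y * y + to_ac \<delta> = 0" using assms by (simp add: algebra_simps)
  then show ?thesis by (rule eq_if_add_eq_0_ac)
qed

text \<open>The elements 1, x, y, xy are independent over the base field. A relation reads z = w y
  with z and w affine in x; squaring removes y. Squares of such elements are again affine in x, so
  comparing coefficients leaves equations over the base field in which \<delta> would have to be a
  square.\<close>

lemma linear_independence:
  assumes x: "poly (ac_poly p) x = 0" and y: "poly (ac_poly q) y = 0"
    and eq: "(to_ac a + to_ac b * x) + (to_ac c + to_ac d * x) * y = 0"
  shows "a = 0 \<and> b = 0 \<and> c = 0 \<and> d = 0"
proof -
  define e where "e = coeff p 0"
  have xx: "x * x = to_ac e + to_ac \<tau> * x" unfolding e_def using x by (rule p_root_square)
  have yy: "y * y = to_ac \<delta>" using y by (rule q_root_square)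
  have x_notin: "x \<noteq> to_ac k" for k
    using irreducible_quadratic_no_root[OF p(1,3), of k] x by (auto simp: poly_ac_poly)
  have no_sqrt: "k * k \<noteq> \<delta>" for k
  proof
    assume "k * k = \<delta>"
    then have "poly q k = 2 * \<delta>" by (subst q_eq) simp
    then show False using irreducible_quadratic_no_root[OF q(1,3), of k] char_2 by simp
  qed
  have minus_k: "- k = k" for k :: 'k
    using char_2 by (metis add.inverse_unique mult_2 mult_zero_left)
  \<comment> \<open>This form is anisotropic because \<delta> is not a square, \<open>q\<close>
    having no root in the base field.\<close>
  have vanish: "b * b + \<delta> * (d * d) = 0 \<Longrightarrow> b = 0 \<and> d = 0" for b d
  proof (cases "d = 0")
    case False
    assume "b * b + \<delta> * (d * d) = 0"
    then have "b * b = \<delta> * (d * d)" using minus_k[of "b * b"] by (simp add: eq_neg_iff_add_eq_0 add_eq_0_iff)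
    then have "(b / d) * (b / d) = \<delta>" using False by (simp add: field_simps)
    then show ?thesis using no_sqrt by blast
  qed auto
  have sq: "z * z = to_ac (a * a + e * (b * b)) + to_ac (\<tau> * (b * b)) * x"
    if "z = to_ac a + to_ac b * x" for z a b
  proof -
    have "z * z = to_ac a * to_ac a + to_ac b * to_ac b * (x * x) + 2 * (to_ac a * to_ac b * x)"
      unfolding that by (simp add: algebra_simps)
    then show ?thesis unfolding xx char_2_ac by (simp add: algebra_simps)
  qed
  define z w where "z = to_ac a + to_ac b * x" and "w = to_ac c + to_ac d * x"
  have "z = w * y" using eq unfolding z_def w_def by (rule eq_if_add_eq_0_ac)
  then have "z * z = w * w * to_ac \<delta>" by (simp add: yy[symmetric] mult_ac)
  then have "z * z + w * w * to_ac \<delta> = 0" using char_2_ac by (metis mult_2 mult_zero_left)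
  \<comment> \<open>The constant and the linear part in x vanish separately, since x is not in the
    base field. The linear part gives \<open>b = d = 0\<close>, and then the constant part gives
    \<open>a = c = 0\<close>.\<close>
  then have "to_ac (a * a + e * (b * b) + \<delta> * (c * c + e * (d * d))) + to_ac (\<tau> * (b * b + \<delta> * (d * d))) * x = 0"
    unfolding sq[OF z_def] sq[OF w_def] by (simp add: algebra_simps)
  moreover have "k = 0 \<and> l = 0" if "to_ac k + to_ac l * x = 0" for k l
  proof (cases "l = 0")
    case False
    then have "x = to_ac (- k / l)" using that by (simp add: field_simps add_eq_0_iff)
    then show ?thesis using x_notin by blast
  qed (use that in simp)
  ultimately have k: "a * a + e * (b * b) + \<delta> * (c * c + e * (d * d)) = 0" "\<tau> * (b * b + \<delta> * (d * d)) = 0"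
    by blast+
  then have "b = 0" "d = 0" using \<tau>_nonzero vanish[of b d] by auto
  with k(1) have "a = 0 \<and> c = 0" using vanish[of a c] by simp
  with \<open>b = 0\<close> \<open>d = 0\<close> show ?thesis by blast
qed

text \<open>Shows that x - y has degree at least 4 over the base field: the powers of z up to the
  third are expanded in the independent elements 1, x, y, xy.\<close>

lemma degree_less_4_root:
  assumes x: "poly (ac_poly p) x = 0" and y: "poly (ac_poly q) y = 0"
    and g: "degree g < 4" "poly (ac_poly g) (x - y) = 0"
  shows "g = 0"
proof -
  define a b c d where "a = coeff g 0" and "b = coeff g 1" and "c = coeff g 2" and "d = coeff g 3"
  have "g = [:a, b, c, d:]"
  proof (rule poly_eqI)
    fix n
    show "coeff g n = coeff [:a, b, c, d:] n"
    proof (cases "n < 4")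
      case True
      then consider "n = 0" | "n = 1" | "n = 2" | "n = 3" by linarith
      then show ?thesis by cases (simp_all add: a_def b_def c_def d_def numeral_eq_Suc)
    next
      case False
      moreover have "degree [:a, b, c, d:] < 4" by simp
      ultimately show ?thesis using g(1) by (simp only: coeff_eq_0 less_le_trans not_less)
    qed
  qed
  then have ac_g: "ac_poly g = [:to_ac a, to_ac b, to_ac c, to_ac d:]"
    using arg_cong[of g _ ac_poly] by (simp add: ac_poly_def Polynomial.map_poly_pCons)
  define z where "z = x + y"
  have z: "x - y = z" using minus_ac[of y] by (metis diff_conv_add_uminus z_def)
  define e where "e = coeff p 0"
  have xx: "x * x = to_ac e + to_ac \<tau> * x" unfolding e_def using x by (rule p_root_square)
  have yy: "y * y = to_ac \<delta>" using y by (rule q_root_square)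
  define s where "s = e + \<delta>"
  have "z * z = x * x + y * y + 2 * (x * y)" by (simp add: z_def algebra_simps)
  then have zz: "z * z = to_ac s + to_ac \<tau> * x" unfolding xx yy char_2_ac by (simp add: s_def algebra_simps)
  have "z * (z * z) = to_ac s * x + to_ac s * y + to_ac \<tau> * (x * x) + to_ac \<tau> * x * y"
    unfolding zz by (simp add: z_def algebra_simps)
  then have zzz: "z * (z * z) = to_ac (\<tau> * e) + to_ac (s + \<tau> * \<tau>) * x + to_ac s * y + to_ac \<tau> * x * y"
    unfolding xx by (simp add: algebra_simps)
  have "0 = to_ac a + to_ac b * z + to_ac c * (z * z) + to_ac d * (z * (z * z))"
    using g(2) unfolding ac_g z by (simp add: algebra_simps)
  also have "\<dots> = (to_ac (a + c * s + d * \<tau> * e) + to_ac (b + c * \<tau> + d * (s + \<tau> * \<tau>)) * x)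
      + (to_ac (b + d * s) + to_ac (d * \<tau>) * x) * y"
    unfolding zzz unfolding zz by (simp add: z_def algebra_simps)
  finally have "a + c * s + d * \<tau> * e = 0 \<and> b + c * \<tau> + d * (s + \<tau> * \<tau>) = 0 \<and> b + d * s = 0 \<and> d * \<tau> = 0"
    by (intro linear_independence[OF x y]) simp
  \<comment> \<open>Read off in this order from the coordinates at xy, y, x and 1; the first and the
    third use that \<tau> is nonzero.\<close>
  then have "d = 0" "b = 0" "c = 0" "a = 0" using \<tau>_nonzero by auto
  then show ?thesis using \<open>g = _\<close> by simp
qed

text \<open>The root x - y of F would be a root of one of two proper factors, whose degree is below
  4.\<close>

lemma irreducible_F: "irreducible F"
proof (rule irreducibleI)
  show "F \<noteq> 0" using degree_F by auto
  show "\<not> F dvd 1" using degree_F by (auto simp: poly_dvd_1)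
  fix g h assume gh: "F = g * h"
  show "g dvd 1 \<or> h dvd 1"
  proof (rule ccontr)
    assume "\<not> (g dvd 1 \<or> h dvd 1)"
    moreover have nz: "g \<noteq> 0" "h \<noteq> 0" using gh \<open>F \<noteq> 0\<close> by auto
    ultimately have "degree g > 0" "degree h > 0" by (auto simp: is_unit_iff_degree)
    moreover have "degree g + degree h = 4" using degree_F gh nz by (simp add: degree_mult_eq)
    ultimately have deg: "degree g < 4" "degree h < 4" by linarith+
    obtain x where "ac_poly p = [:- x, 1:] * [:- (x + to_ac \<tau>), 1:]" by (rule p_roots)
    then have x: "poly (ac_poly p) x = 0" by simp
    obtain y where "ac_poly q = [:- y, 1:] * [:- y, 1:]" by (rule q_root)
    then have y: "poly (ac_poly q) y = 0" by simp
    have "poly (ac_poly F) (x - y) = 0"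
      unfolding F_def poly_ac_poly_F_poly_eq_0_iff[OF p(2,3) q(2,3)] Root_def using x y by blast
    then have "poly (ac_poly g) (x - y) = 0 \<or> poly (ac_poly h) (x - y) = 0"
      by (simp add: gh ac_poly_mult)
    then show False using degree_less_4_root[OF x y] deg nz by blast
  qed
qed

section \<open>The involution of the polynomial ring and its invariants \<pi> and \<omega>\<close>

definition shift :: "'k poly \<Rightarrow> 'k poly" where "shift f = f \<circ>\<^sub>p [:\<tau>, 1:]"

lemma shift_add: "shift (f + g) = shift f + shift g"
  by (simp add: shift_def pcompose_add)

lemma shift_mult: "shift (f * g) = shift f * shift g"
  by (simp add: shift_def pcompose_mult)

lemma shift_const: "shift [:c:] = [:c:]"
  by (simp add: shift_def)

lemma shift_X: "shift [:0, 1:] = [:\<tau>, 1:]"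
  by (simp add: shift_def pcompose_pCons)

lemma shift_shift: "shift (shift f) = f"
proof -
  have "[:\<tau>, 1:] \<circ>\<^sub>p [:\<tau>, 1:] = [:0, 1:]" by (simp add: pcompose_pCons char_2)
  then show ?thesis by (simp only: shift_def pcompose_assoc[symmetric] pcompose_idR)
qed

lemma shift_p: "shift p = p"
proof -
  have "shift [:coeff p 0, \<tau>, 1:] = [:coeff p 0, \<tau>, 1:]"
    by (simp add: shift_def pcompose_pCons algebra_simps char_2)
  then show ?thesis using p_eq by metis
qed

definition \<pi> :: "'k poly" where "\<pi> = smult (1 / \<tau>\<^sup>2) F"

lemma shift_\<pi>: "shift \<pi> = \<pi>"
proof -
  have "shift F = F"
    unfolding F_eq power2_eq_square shift_add shift_mult shift_p shift_const ..
  then show ?thesis by (simp add: \<pi>_def shift_def pcompose_smult)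
qed

lemma \<pi>_pow_dvd: "\<pi> ^ n dvd f \<longleftrightarrow> F ^ n dvd f"
  by (simp add: \<pi>_def smult_power smult_dvd_iff \<tau>_nonzero)

lemma bezout_\<pi>: "\<not> \<pi> dvd h \<Longrightarrow> \<exists>a b. a * h + b * \<pi> = 1"
proof -
  assume "\<not> \<pi> dvd h"
  then have "\<not> F dvd h" using \<pi>_pow_dvd[of 1 h] by simp
  then obtain a b where "a * h + b * F = 1" using irreducible_bezout[OF irreducible_F] by blast
  moreover have "F = smult (\<tau>\<^sup>2) \<pi>" using \<tau>_nonzero by (simp add: \<pi>_def)
  ultimately have "a * h + smult (\<tau>\<^sup>2) b * \<pi> = 1" by simp
  then show ?thesis by blast
qed

definition \<omega> :: "'k poly" where "\<omega> = smult (1 / \<tau>) (p + [:\<delta>:])"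

lemma shift_\<omega>: "shift \<omega> = \<omega>"
proof -
  have "shift (p + [:\<delta>:]) = p + [:\<delta>:]" by (simp only: shift_add shift_p shift_const)
  then show ?thesis by (simp add: \<omega>_def shift_def pcompose_smult)
qed

lemma \<pi>_\<omega>: "\<pi> = \<omega>\<^sup>2 + [:\<delta>:]"
proof -
  define s where "s = p + [:\<delta>:]"
  \<comment> \<open>The cross term carries the factor 2.\<close>
  have "s\<^sup>2 = p\<^sup>2 + [:\<delta>:]\<^sup>2" unfolding s_def power2_sum char_2_poly by simp
  then have "F = s\<^sup>2 + smult (\<tau>\<^sup>2) [:\<delta>:]" unfolding F_eq by (simp add: power2_eq_square)
  then show ?thesis using \<tau>_nonzero
    by (simp add: \<pi>_def \<omega>_def smult_add_right power2_eq_square flip: s_def)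
qed

end

section \<open>Differences and semilinear square roots\<close>

locale pair_endomorphism = endomorphism scale u + separable_inseparable p q
  for scale :: "'k::field \<Rightarrow> 'v::ab_group_add \<Rightarrow> 'v" and u :: "'v \<Rightarrow> 'v" and p q :: "'k poly"
begin

definition semilinear_sqrt :: "('v \<Rightarrow> 'v) \<Rightarrow> bool" where
  "semilinear_sqrt \<beta> \<longleftrightarrow> (\<forall>x y. \<beta> (x + y) = \<beta> x + \<beta> y) \<and>
     (\<forall>f x. \<beta> (f \<star> x) = shift f \<star> \<beta> x) \<and> (\<forall>x. \<beta> (\<beta> x) = \<pi> \<star> x)"

lemma add_self_vec [simp]: "x + x = 0" for x :: 'v
proof -
  have "x + x = scale (1 + 1) x" unfolding scale_left_distrib by simp
  also have "(1::'k) + 1 = 0" using char_2 by (simp only: one_add_one)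
  finally show ?thesis by simp
qed

lemma add_self_vec_left [simp]: "x + (x + y) = y" for x :: 'v
  by (simp flip: add.assoc)

lemma minus_vec: "- x = x" for x :: 'v
  by (rule minus_unique) simp

lemma diff_vec: "x - y = x + y" for x y :: 'v
  using minus_vec[of y] by (metis diff_conv_add_uminus)

text \<open>This is \<tau> times the action of \<omega>; computing with it avoids fractions.\<close>

definition s :: "'v \<Rightarrow> 'v" where "s x = (p + [:\<delta>:]) \<star> x"

lemma s_eq: "s x = scale (coeff p 0) x + scale \<tau> (u x) + u (u x) + scale \<delta> x"
proof -
  have "p \<star> x = scale (coeff p 0) x + scale \<tau> (u x) + u (u x)"
    by (subst p_eq) (simp add: pact_pCons u_add u_scale add_ac)
  then show ?thesis by (simp add: s_def pact_add_left pact_const)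
qed

lemma \<omega>_pact: "\<omega> \<star> x = scale (1 / \<tau>) (s x)"
  by (simp add: \<omega>_def pact_smult s_def)

lemma scale_\<tau>_\<omega>: "scale \<tau> (\<omega> \<star> x) = s x"
  using \<tau>_nonzero by (simp add: \<omega>_pact)

lemma \<pi>_pact: "\<pi> \<star> x = \<omega> \<star> \<omega> \<star> x + scale \<delta> x"
  unfolding \<pi>_\<omega> power2_eq_square by (simp only: pact_add_left pact_mult pact_const)

lemma linearI:
  assumes "\<And>x y. f (x + y) = f x + f y" "\<And>c x. f (scale c x) = scale c (f x)"
  shows "Vector_Spaces.linear scale scale f"
  using assms vector_space_axioms by (simp add: Vector_Spaces.linear_iff)

lemma endomorphismI: "Vector_Spaces.linear scale scale f \<Longrightarrow> endomorphism scale f"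
  by (intro endomorphism.intro vector_space_axioms endomorphism_axioms.intro)

lemma poly_endo_p:
  assumes "Vector_Spaces.linear scale scale a"
  shows "poly_endo scale p a x = scale (coeff p 0) x + (scale \<tau> (a x) + a (a x))"
proof -
  interpret A: endomorphism scale a using \<open>Vector_Spaces.linear scale scale a\<close> by (rule endomorphismI)
  show ?thesis by (subst p_eq) (simp add: A.pact_pCons A.u_add A.u_scale add_ac)
qed

lemma poly_endo_q:
  assumes "Vector_Spaces.linear scale scale b"
  shows "poly_endo scale q b x = scale \<delta> x + b (b x)"
proof -
  interpret B: endomorphism scale b using \<open>Vector_Spaces.linear scale scale b\<close> by (rule endomorphismI)
  show ?thesis by (subst q_eq) (simp add: B.pact_pCons B.u_add B.u_scale add_ac)
qed

lemma eq_if_add_eq_0: "x + y = 0 \<Longrightarrow> x = y" for x y :: 'v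
  using minus_vec[of y] by (metis eq_neg_iff_add_eq_0)

text \<open>Writing u = a + b, one finds s = a b + b a + \<tau> b, which commutes with b because the
  square of b is the scalar \<delta>. Then \<beta> = b + \<omega>(u) satisfies both required
  identities by direct computation.\<close>

lemma difference_imp_semilinear_sqrt:
  assumes "is_difference scale p q u"
  shows "\<exists>\<beta>. semilinear_sqrt \<beta>"
proof -
  obtain a b where a: "Vector_Spaces.linear scale scale a" and b: "Vector_Spaces.linear scale scale b"
    and u: "u = (\<lambda>v. a v - b v)" and pa: "poly_endo scale p a = (\<lambda>v. 0)"
    and qb: "poly_endo scale q b = (\<lambda>v. 0)"
    using assms unfolding is_difference_def by blast
  interpret A: endomorphism scale a using \<open>Vector_Spaces.linear scale scale a\<close> by (rule endomorphismI)
  interpret B: endomorphism scale b using \<open>Vector_Spaces.linear scale scale b\<close> by (rule endomorphismI)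
  have ux: "u x = a x + b x" for x by (simp add: u diff_vec)
  have bb: "b (b x) = scale \<delta> x" for x
    using poly_endo_q[OF b, of x] fun_cong[OF qb, of x] eq_if_add_eq_0[of "b (b x)"] by (simp add: add.commute)
  have aa: "a (a x) = scale (coeff p 0) x + scale \<tau> (a x)" for x
    using poly_endo_p[OF a, of x] fun_cong[OF pa, of x] eq_if_add_eq_0[of "a (a x)"] by (simp add: add_ac)
  \<comment> \<open>Expanding (p + \<delta>)(a + b), the quadratic relations of \<open>a\<close> and
    \<open>b\<close> cancel everything else.\<close>
  have s: "s x = a (b x) + (b (a x) + scale \<tau> (b x))" for x
    unfolding s_eq ux A.u_add B.u_add aa bb scale_right_distrib by (simp add: add_ac)
  have bs: "b (s x) = s (b x)" for x
    unfolding s A.u_add B.u_add aa bb A.u_scale B.u_scale by (simp add: add_ac)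
  have b\<omega>: "b (\<omega> \<star> x) = \<omega> \<star> b x" for x by (simp add: \<omega>_pact B.u_scale bs)
  define \<beta> where "\<beta> x = b x + \<omega> \<star> x" for x
  have add: "\<beta> (x + y) = \<beta> x + \<beta> y" for x y by (simp add: \<beta>_def B.u_add pact_add_right add_ac)
  have sc: "\<beta> (scale c x) = scale c (\<beta> x)" for c x
    by (simp add: \<beta>_def B.u_scale pact_scale scale_right_distrib)
  \<comment> \<open>As \<open>b\<close> commutes with \<omega>(u), the cross terms are equal and
    cancel.\<close>
  have sq: "\<beta> (\<beta> x) = \<pi> \<star> x" for x
    by (simp add: \<beta>_def B.u_add pact_add_right b\<omega> bb \<pi>_pact add_ac)
  \<comment> \<open>The commutator of \<beta> and u is that of b and u, namely a b + b a = s +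
    \<tau> b = \<tau> \<beta>.\<close>
  have \<beta>u: "\<beta> (u x) = u (\<beta> x) + scale \<tau> (\<beta> x)" for x
  proof -
    have "\<beta> (u x) = b (a x) + (scale \<delta> x + u (\<omega> \<star> x))"
    proof -
      have "b (u x) = b (a x) + scale \<delta> x" by (simp only: ux[of x] B.u_add bb)
      then show ?thesis by (simp add: \<beta>_def pact_u add_ac)
    qed
    moreover have "u (\<beta> x) + scale \<tau> (\<beta> x) = a (b x) + (scale \<delta> x + (u (\<omega> \<star> x) + (scale \<tau> (b x) + s x)))"
      unfolding \<beta>_def u_add scale_right_distrib scale_\<tau>_\<omega> by (simp add: ux[of "b x"] bb add_ac)
    ultimately show ?thesis unfolding s by (simp add: add_ac)
  qed
  \<comment> \<open>The case of the indeterminate is \<open>\<beta>u\<close>; additivity and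
    linearity over the field extend it to all polynomials.\<close>
  have "\<beta> (f \<star> x) = shift f \<star> \<beta> x" for f x
  proof (induction f)
    case 0
    have "\<beta> 0 = 0" using add[of 0 0] by simp
    then show ?case by (simp add: shift_def)
  next
    case (pCons c f)
    have "shift (pCons c f) = [:c:] + [:\<tau>, 1:] * shift f" by (simp add: shift_def pcompose_pCons)
    then have "shift (pCons c f) \<star> \<beta> x = scale c (\<beta> x) + (u (shift f \<star> \<beta> x) + scale \<tau> (shift f \<star> \<beta> x))"
      by (simp only: pact_add_left pact_mult pact_const pact_pCons) (simp add: pact_pCons add_ac)
    then show ?case using pCons.IH by (simp add: pact_pCons add sc \<beta>u)
  qed
  then show ?thesis using add sq unfolding semilinear_sqrt_def by blast
qed

text \<open>Reverses the construction. Since \<open>shift\<close> fixes \<omega>, the map \<beta>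
  commutes with \<omega>(u), and the square of b = \<beta> + \<omega>(u) is \<pi>(u) plus the square
  of \<omega>(u), that is \<delta>.\<close>

lemma semilinear_sqrt_imp_difference:
  assumes "semilinear_sqrt \<beta>"
  shows "is_difference scale p q u"
proof -
  have add: "\<beta> (x + y) = \<beta> x + \<beta> y" and semi: "\<beta> (f \<star> x) = shift f \<star> \<beta> x"
    and sq: "\<beta> (\<beta> x) = \<pi> \<star> x" for x y f
    using assms unfolding semilinear_sqrt_def by blast+
  have sc: "\<beta> (scale c x) = scale c (\<beta> x)" for c x
    using semi[of "[:c:]" x] by (simp only: shift_const pact_const)
  have \<beta>u: "\<beta> (u x) = u (\<beta> x) + scale \<tau> (\<beta> x)" for x
    using semi[of "[:0, 1:]" x] unfolding shift_X by (simp add: pact_pCons add.commute)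
  have \<beta>\<omega>: "\<beta> (\<omega> \<star> x) = \<omega> \<star> \<beta> x" for x using semi[of \<omega> x] by (simp only: shift_\<omega>)
  define b where "b x = \<beta> x + \<omega> \<star> x" for x
  define a where "a x = u x + b x" for x
  have b_add: "b (x + y) = b x + b y" for x y by (simp add: b_def add pact_add_right add_ac)
  have b: "Vector_Spaces.linear scale scale b"
  proof (rule linearI)
    show "b (scale c x) = scale c (b x)" for c x
      unfolding b_def sc pact_scale scale_right_distrib ..
  qed (rule b_add)
  interpret B: endomorphism scale b using \<open>Vector_Spaces.linear scale scale b\<close> by (rule endomorphismI)
  have a_add: "a (x + y) = a x + a y" for x y by (simp add: a_def b_add u_add add_ac)
  have a: "Vector_Spaces.linear scale scale a"
  proof (rule linearI)
    show "a (scale c x) = scale c (a x)" for c x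
      unfolding a_def B.u_scale u_scale scale_right_distrib ..
  qed (rule a_add)
  have bb: "b (b x) = scale \<delta> x" for x
    by (simp add: b_def add pact_add_right sq \<beta>\<omega> \<pi>_pact add_ac)
  have bu: "b (u x) = u (b x) + (scale \<tau> (b x) + s x)" for x
    unfolding b_def \<beta>u pact_u u_add scale_right_distrib scale_\<tau>_\<omega> by (simp add: add_ac)
  \<comment> \<open>In the square of u + b the terms u b cancel by \<open>bu\<close>, leaving u
    squared, \<tau> b, s and \<delta>; expanding s cancels u squared and \<delta>.\<close>
  have "a (a x) = scale (coeff p 0) x + scale \<tau> (a x)" for x
    unfolding a_def u_add b_add bb bu s_eq scale_right_distrib by (simp add: add_ac)
  then have "poly_endo scale p a x = 0" for x
    unfolding poly_endo_p[OF a] by (simp add: add_ac)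
  moreover have "poly_endo scale q b x = 0" for x
    unfolding poly_endo_q[OF b] bb by simp
  moreover have "u = (\<lambda>x. a x - b x)" by (simp add: a_def)
  ultimately show ?thesis unfolding is_difference_def using a b by blast
qed

end

section \<open>Eigenvalues in the algebraic closure\<close>

text \<open>Vectors over the algebraic closure are modelled as sequences supported on \<open>{..<n}\<close>: unlike
  the type of vectors of unspecified dimension, these form an abelian group type, so that the
  locale \<open>endomorphism\<close> applies to a matrix over the closure.\<close>

definition coord_scale :: "'k::field \<Rightarrow> (nat \<Rightarrow> 'k) \<Rightarrow> nat \<Rightarrow> 'k" where
  "coord_scale c w = (\<lambda>i. c * w i)"

definition mat_action :: "'k::field mat \<Rightarrow> (nat \<Rightarrow> 'k) \<Rightarrow> nat \<Rightarrow> 'k" where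
  "mat_action A w = (\<lambda>i. if i < dim_row A then \<Sum>j<dim_row A. A $$ (i, j) * w j else 0)"

lemma vector_space_coord_scale: "vector_space coord_scale"
  by unfold_locales (auto simp: coord_scale_def fun_eq_iff algebra_simps)

lemma endomorphism_mat_action: "endomorphism coord_scale (mat_action A)"
proof (intro endomorphism.intro endomorphism_axioms.intro vector_space_coord_scale)
  show "Vector_Spaces.linear coord_scale coord_scale (mat_action A)"
    unfolding Vector_Spaces.linear_iff using vector_space_coord_scale
    by (auto simp: mat_action_def coord_scale_def fun_eq_iff algebra_simps sum.distrib sum_distrib_left)
qed

lemma sum_fun_apply: "(\<Sum>j\<in>J. h j) i = (\<Sum>j\<in>J. h j i :: 'b::comm_monoid_add)"
  by (induction J rule: infinite_finite_induct) auto

lemma ac_poly_power: "ac_poly (f ^ n) = ac_poly f ^ n"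
  by (induction n) (simp_all add: ac_poly_mult, simp add: ac_poly_def)

lemma eigenvalue_iff_coord:
  fixes B :: "'b::field mat"
  assumes "B \<in> carrier_mat n n"
  shows "eigenvalue B l \<longleftrightarrow> (\<exists>w. (\<forall>i\<ge>n. w i = 0) \<and> w \<noteq> 0 \<and> mat_action B w = coord_scale l w)"
proof
  assume "eigenvalue B l"
  then obtain v where v: "v \<in> carrier_vec n" "v \<noteq> 0\<^sub>v n" "B *\<^sub>v v = l \<cdot>\<^sub>v v"
    using assms by (auto simp: eigenvalue_def eigenvector_def)
  define w where "w i = (if i < n then v $ i else 0)" for i
  have "w \<noteq> 0"
  proof
    assume "w = 0"
    then have "v = 0\<^sub>v n" using v(1) by (intro eq_vecI) (auto simp: w_def fun_eq_iff split: if_splits)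
    then show False using v(2) by blast
  qed
  moreover have "mat_action B w i = coord_scale l w i" for i
  proof (cases "i < n")
    case True
    have "mat_action B w i = (B *\<^sub>v v) $ i"
      using True assms v(1) by (simp add: mat_action_def w_def scalar_prod_def lessThan_atLeast0)
    then show ?thesis unfolding v(3) using True v(1) by (simp add: coord_scale_def w_def)
  next
    case False
    then show ?thesis using assms by (simp add: mat_action_def coord_scale_def w_def)
  qed
  ultimately show "\<exists>w. (\<forall>i\<ge>n. w i = 0) \<and> w \<noteq> 0 \<and> mat_action B w = coord_scale l w"
    by (intro exI[of _ w]) (auto simp: w_def)
next
  assume "\<exists>w. (\<forall>i\<ge>n. w i = 0) \<and> w \<noteq> 0 \<and> mat_action B w = coord_scale l w"
  then obtain w where w: "\<forall>i\<ge>n. w i = 0" "w \<noteq> 0" "mat_action B w = coord_scale l w" by blast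
  define v where "v = vec n w"
  have "v \<noteq> 0\<^sub>v n"
  proof
    assume "v = 0\<^sub>v n"
    have "w i = 0" for i
    proof (cases "i < n")
      case True
      then have "w i = vec_index v i" by (simp add: v_def)
      then show ?thesis using True \<open>v = 0\<^sub>v n\<close> by simp
    qed (use w(1) in simp)
    then show False using w(2) by (simp add: fun_eq_iff)
  qed
  moreover have "B *\<^sub>v v = l \<cdot>\<^sub>v v"
  proof (rule eq_vecI)
    fix i assume "i < dim_vec (l \<cdot>\<^sub>v v)"
    then have i: "i < n" by (simp add: v_def)
    have "(B *\<^sub>v v) $ i = mat_action B w i"
      using i assms by (simp add: mat_action_def v_def scalar_prod_def lessThan_atLeast0)
    then show "(B *\<^sub>v v) $ i = (l \<cdot>\<^sub>v v) $ i" using i by (simp add: w(3) coord_scale_def v_def)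
  qed (use assms in \<open>simp add: v_def\<close>)
  ultimately show "eigenvalue B l"
    using assms unfolding eigenvalue_def eigenvector_def by (intro exI[of _ v]) (simp add: v_def)
qed

section \<open>Eigenvalues and nilpotency under extension of scalars\<close>

context endomorphism
begin

lemma pact_eigenvector: "u x = scale l x \<Longrightarrow> f \<star> x = scale (poly f l) x"
  by (induction f) (simp_all add: pact_pCons u_scale scale_left_distrib mult.commute)

lemma pact_closed:
  assumes "subspace W" "\<And>x. x \<in> W \<Longrightarrow> u x \<in> W" "x \<in> W"
  shows "f \<star> x \<in> W"
  by (induction f) (use assms in \<open>simp_all add: pact_pCons subspace_0 subspace_add subspace_scale\<close>)

text \<open>Applying all linear factors but one to \<open>x\<close> gives zero or an eigenvector,
  which \<open>g\<close> kills either way; so \<open>g \<star> x\<close> is killed by one factor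
  fewer. The invariant subspace \<open>W\<close> is there to restrict sequences to those supported
  on the matrix indices.\<close>

lemma power_kills:
  assumes W: "subspace W" "\<And>x. x \<in> W \<Longrightarrow> u x \<in> W"
    and eig: "\<And>x l. x \<in> W \<Longrightarrow> x \<noteq> 0 \<Longrightarrow> u x = scale l x \<Longrightarrow> poly g l = 0"
    and x: "x \<in> W" "(\<Prod>l\<in>#M. [:- l, 1:]) \<star> x = 0"
  shows "g ^ size M \<star> x = 0"
  using x
proof (induction M arbitrary: x)
  case empty
  then show ?case by simp
next
  case (add l M)
  define y where "y = (\<Prod>l\<in>#M. [:- l, 1:]) \<star> x"
  have yW: "y \<in> W" unfolding y_def using W add.prems(1) by (rule pact_closed)
  have ly: "[:- l, 1:] \<star> y = 0" using add.prems(2) by (simp add: y_def pact_mult)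
  have "g \<star> y = 0"
  proof (cases "y = 0")
    case False
    have "u y = scale l y" using ly by (simp add: pact_pCons)
    then have "poly g l = 0" using eig yW False by blast
    then show ?thesis using pact_eigenvector[OF \<open>u y = scale l y\<close>] by simp
  qed simp
  then have "(\<Prod>l\<in>#M. [:- l, 1:]) \<star> (g \<star> x) = 0"
    unfolding y_def pact_mult[symmetric] by (simp only: mult.commute)
  then have "g ^ size M \<star> (g \<star> x) = 0" using add.IH pact_closed[OF W add.prems(1)] by blast
  then show ?case by (simp add: mult.commute flip: pact_mult)
qed

lemma annihilating_poly_vec:
  assumes "finite_dimensional_vector_space scale Basis"
  shows "\<exists>f. f \<noteq> 0 \<and> f \<star> x = 0"
proof -
  interpret fd: finite_dimensional_vector_space scale Basis by fact
  \<comment> \<open>One more iterate than the dimension, so that the iterates satisfy a nontrivial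
    relation.\<close>
  define n where "n = Suc (card Basis)"
  define bs where "bs = map (\<lambda>i. (u ^^ i) x) [0..<n]"
  have len: "length bs = n" by (simp add: bs_def)
  have "\<not> (\<forall>c. lincomb scale c bs = 0 \<longrightarrow> (\<forall>i<length bs. c i = 0))"
  proof
    assume "\<forall>c. lincomb scale c bs = 0 \<longrightarrow> (\<forall>i<length bs. c i = 0)"
    then have "distinct bs" "independent (set bs)" using independent_list[OF vector_space_axioms] by blast+
    then have "card (set bs) = n" "card (set bs) \<le> card Basis"
      using distinct_card len independent_span_bound[OF fd.finite_Basis, of "set bs"] fd.span_Basis by auto
    then show False by (simp add: n_def)
  qed
  then obtain c i where c: "lincomb scale c bs = 0" "i < n" "c i \<noteq> 0" using len by blast
  define f where "f = (\<Sum>i<n. monom (c i) i)"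
  have "coeff f i \<noteq> 0" using c by (simp add: f_def coeff_sum)
  moreover have "f \<star> x = lincomb scale c bs"
    unfolding f_def lincomb_def len pmod.scale_sum_left pact_monom by (simp add: bs_def)
  ultimately show ?thesis using c(1) by (metis coeff_0)
qed

lemma annihilating_poly:
  assumes "finite_dimensional_vector_space scale Basis"
  shows "\<exists>f. f \<noteq> 0 \<and> (\<forall>x. f \<star> x = 0)"
proof -
  interpret fd: finite_dimensional_vector_space scale Basis by fact
  obtain f where f: "\<And>x. f x \<noteq> 0" "\<And>x. f x \<star> x = 0"
    using annihilating_poly_vec[OF assms] by metis
  define g where "g = (\<Prod>b\<in>Basis. f b)"
  have "g \<noteq> 0" using f(1) fd.finite_Basis by (simp add: g_def)
  moreover have "g \<star> x = 0" for x
  proof -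
    have "x \<in> span Basis" using fd.span_Basis by simp
    then show ?thesis
    proof (induction rule: span_induct_alt)
      case (step c b y)
      have "g = prod f (Basis - {b}) * f b"
        unfolding g_def using fd.finite_Basis step.hyps by (simp add: prod.remove mult.commute)
      then have "g \<star> b = 0" by (simp add: pact_mult f(2))
      then show ?case using step.IH by (simp add: pact_add_right pact_scale)
    qed simp
  qed
  ultimately show ?thesis by blast
qed

lemma exists_represents:
  assumes "finite_dimensional_vector_space scale Basis"
  shows "\<exists>bs A. represents scale u bs A"
proof -
  interpret fd: finite_dimensional_vector_space scale Basis by fact
  obtain bs where bs: "set bs = Basis" "distinct bs" using finite_distinct_list[OF fd.finite_Basis] by blast
  then have ob: "ordered_basis scale bs"
    using fd.independent_Basis fd.span_Basis by (simp add: ordered_basis_def)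
  then have "\<forall>x. \<exists>c. x = lincomb scale c bs" using ordered_basis_iff[OF vector_space_axioms] by blast
  then obtain c where c: "\<And>x. x = lincomb scale (c x) bs" by metis
  define A where "A = mat (length bs) (length bs) (\<lambda>(i, j). c (u (bs ! j)) i)"
  have "represents scale u bs A"
    unfolding represents_def using ob c by (simp add: A_def lincomb_def)
  then show ?thesis by blast
qed

text \<open>The coordinates of f(u) on a basis vector, mapped into the closure, are those obtained
  by letting the matrix act over the closure on the unit vector.\<close>

lemma pact_coordinates:
  assumes r: "represents scale u bs A" and j: "j < length bs"
  shows "\<exists>c. f \<star> (bs ! j) = lincomb scale c bs \<and>
    poly_endo coord_scale (ac_poly f) (mat_action (map_mat to_ac A)) (\<lambda>i. if i = j then 1 else 0) =
      (\<lambda>i. if i < length bs then to_ac (c i) else 0)"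
proof -
  define n where "n = length bs"
  have A: "dim_row A = n" "dim_col A = n" and ub: "\<And>j. j < n \<Longrightarrow> u (bs ! j) = lincomb scale (\<lambda>i. A $$ (i, j)) bs"
    using r by (auto simp: represents_def lincomb_def n_def)
  interpret M: endomorphism coord_scale "mat_action (map_mat to_ac A)" by (rule endomorphism_mat_action)
  show ?thesis
  proof (induction f)
    case 0
    show ?case by (rule exI[of _ "\<lambda>_. 0"]) (simp add: lincomb_def ac_poly_def fun_eq_iff)
  next
    case (pCons a f)
    then obtain c where c: "f \<star> (bs ! j) = lincomb scale c bs"
      "poly_endo coord_scale (ac_poly f) (mat_action (map_mat to_ac A)) (\<lambda>i. if i = j then 1 else 0) =
        (\<lambda>i. if i < length bs then to_ac (c i) else 0)" by blast
    define c' where "c' i = (if i = j then a else 0) + (\<Sum>k<n. A $$ (i, k) * c k)" for i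
    have "u (lincomb scale c bs) = (\<Sum>k<n. \<Sum>i<n. scale (A $$ (i, k) * c k) (bs ! i))"
      by (simp add: lincomb_def n_def[symmetric] u_sum u_scale ub scale_sum_right mult.commute)
    also have "\<dots> = (\<Sum>i<n. scale (\<Sum>k<n. A $$ (i, k) * c k) (bs ! i))"
      by (subst sum.swap) (simp add: scale_sum_left)
    moreover have "scale a (bs ! j) = (\<Sum>i<n. scale (if i = j then a else 0) (bs ! i))"
    proof -
      have "(\<Sum>i<n. scale (if i = j then a else 0) (bs ! i)) = (\<Sum>i<n. if i = j then scale a (bs ! i) else 0)"
        by (rule sum.cong) auto
      then show ?thesis using j by (simp add: n_def)
    qed
    ultimately have "pCons a f \<star> (bs ! j) = lincomb scale c' bs"
      by (simp add: pact_pCons c(1) lincomb_def c'_def scale_left_distrib sum.distrib n_def)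
    moreover have "ac_poly (pCons a f) = pCons (to_ac a) (ac_poly f)"
      by (simp add: ac_poly_def Polynomial.map_poly_pCons)
    then have "poly_endo coord_scale (ac_poly (pCons a f)) (mat_action (map_mat to_ac A)) (\<lambda>i. if i = j then 1 else 0) =
        (\<lambda>i. if i < length bs then to_ac (c' i) else 0)"
      using j by (simp add: M.pact_pCons c(2) fun_eq_iff coord_scale_def mat_action_def A c'_def to_ac_sum n_def)
    ultimately show ?case by blast
  qed
qed

text \<open>Annihilation by a polynomial is unaffected by extending scalars: it is tested on basis
  vectors, whose images have matching coordinates, and \<open>to_ac\<close> is injective.\<close>

lemma pact_kills_iff:
  assumes r: "represents scale u bs A"
  shows "(\<forall>x. f \<star> x = 0) \<longleftrightarrow> (\<forall>w. (\<forall>i\<ge>length bs. w i = 0) \<longrightarrow>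
    poly_endo coord_scale (ac_poly f) (mat_action (map_mat to_ac A)) w = 0)"
proof -
  interpret M: endomorphism coord_scale "mat_action (map_mat to_ac A)" by (rule endomorphism_mat_action)
  define n where "n = length bs"
  define e where "e j = (\<lambda>i. if i = j then 1 else 0 :: 'k alg_closure)" for j :: nat
  have ex: "\<forall>x. \<exists>c. x = lincomb scale c bs"
    and un: "\<forall>c. lincomb scale c bs = 0 \<longrightarrow> (\<forall>i<length bs. c i = 0)"
    using r ordered_basis_iff[OF vector_space_axioms, of bs] unfolding represents_def by blast+
  have "f \<star> (bs ! j) = 0 \<longleftrightarrow> M.pact (ac_poly f) (e j) = 0" if j: "j < n" for j
  proof -
    obtain c where c: "f \<star> (bs ! j) = lincomb scale c bs"
      "M.pact (ac_poly f) (e j) = (\<lambda>i. if i < length bs then to_ac (c i) else 0)"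
      using pact_coordinates[OF r j[unfolded n_def], of f] unfolding e_def by blast
    have "f \<star> (bs ! j) = 0 \<longleftrightarrow> (\<forall>i<n. c i = 0)"
      unfolding c(1) n_def using un by (auto simp: lincomb_def)
    also have "\<dots> \<longleftrightarrow> M.pact (ac_poly f) (e j) = 0"
      unfolding c(2) by (auto simp: fun_eq_iff n_def)
    finally show ?thesis .
  qed
  moreover have "(\<forall>x. f \<star> x = 0) \<longleftrightarrow> (\<forall>j<n. f \<star> (bs ! j) = 0)"
  proof (intro iffI allI)
    fix x assume z: "\<forall>j<n. f \<star> (bs ! j) = 0"
    obtain c where "x = lincomb scale c bs" using ex by blast
    then show "f \<star> x = 0" using z by (simp add: lincomb_def pmod.scale_sum_right pact_scale n_def)
  qed auto
  moreover have "(\<forall>w. (\<forall>i\<ge>n. w i = 0) \<longrightarrow> M.pact (ac_poly f) w = 0) \<longleftrightarrow> (\<forall>j<n. M.pact (ac_poly f) (e j) = 0)"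
  proof (intro iffI allI impI)
    fix w :: "nat \<Rightarrow> 'k alg_closure" assume z: "\<forall>j<n. M.pact (ac_poly f) (e j) = 0" and w: "\<forall>i\<ge>n. w i = 0"
    have "w = (\<Sum>j<n. coord_scale (w j) (e j))"
    proof
      fix i
      have "(\<Sum>j<n. coord_scale (w j) (e j)) i = (\<Sum>j<n. if i = j then w j else 0)"
        unfolding sum_fun_apply by (rule sum.cong) (auto simp: coord_scale_def e_def)
      also have "\<dots> = w i" using w by simp
      finally show "w i = (\<Sum>j<n. coord_scale (w j) (e j)) i" ..
    qed
    then have "M.pact (ac_poly f) w = M.pact (ac_poly f) (\<Sum>j<n. coord_scale (w j) (e j))" by (rule arg_cong)
    also have "\<dots> = 0" using z by (simp add: M.pmod.scale_sum_right M.pact_scale M.scale_zero_right)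
    finally show "M.pact (ac_poly f) w = 0" .
  qed (auto simp: e_def)
  ultimately show ?thesis by (simp add: n_def)
qed

text \<open>Forwards, some nonzero polynomial annihilates \<open>u\<close> and splits over the
  closure; \<open>power_kills\<close> gives a power of \<open>g\<close> there, and
  \<open>pact_kills_iff\<close> brings it back. Backwards, an eigenvector turns the vanishing of the
  power into that of a power of the value of \<open>g\<close>.\<close>

lemma eigenvalues_roots_iff:
  assumes fd: "finite_dimensional_vector_space scale Basis"
  shows "(\<forall>l. ac_eigenvalue scale u l \<longrightarrow> poly (ac_poly g) l = 0) \<longleftrightarrow> (\<exists>N. \<forall>x. g ^ N \<star> x = 0)"
proof
  assume eig: "\<forall>l. ac_eigenvalue scale u l \<longrightarrow> poly (ac_poly g) l = 0"
  obtain bs A where r: "represents scale u bs A" using exists_represents[OF fd] by blast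
  let ?B = "map_mat to_ac A" and ?n = "length bs"
  interpret M: endomorphism coord_scale "mat_action ?B" by (rule endomorphism_mat_action)
  have B: "?B \<in> carrier_mat ?n ?n" using r by (auto simp: represents_def)
  define W where "W = {w. \<forall>i\<ge>?n. w i = (0::'k alg_closure)}"
  have sW: "M.subspace W" unfolding M.subspace_def by (auto simp: W_def coord_scale_def)
  have uW: "mat_action ?B w \<in> W" for w using B by (auto simp: W_def mat_action_def)
  have root: "poly (ac_poly g) l = 0" if "w \<in> W" "w \<noteq> 0" "mat_action ?B w = coord_scale l w" for w l
    using eig that r eigenvalue_iff_coord[OF B, of l] unfolding ac_eigenvalue_def W_def by blast
  obtain f where f: "f \<noteq> 0" "\<forall>x. f \<star> x = 0" using annihilating_poly[OF fd] by blast
  have "ac_poly f \<noteq> 0" using f(1) ac_poly_inj[of f 0] by (auto simp: ac_poly_def)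
  then obtain S where S: "ac_poly f = smult (lead_coeff (ac_poly f)) (\<Prod>x\<in>#S. [:- x, 1:])"
    using alg_closed_imp_factorization by blast
  have "M.pact (ac_poly (g ^ size S)) w = 0" if "w \<in> W" for w
  proof -
    have "M.pact (ac_poly f) w = 0" using f(2) pact_kills_iff[OF r] that by (simp add: W_def)
    then have "coord_scale (lead_coeff (ac_poly f)) (M.pact (\<Prod>x\<in>#S. [:- x, 1:]) w) = 0"
      by (subst (asm) S) (simp add: M.pact_smult)
    then have "M.pact (\<Prod>x\<in>#S. [:- x, 1:]) w = 0"
      using \<open>ac_poly f \<noteq> 0\<close> by (simp add: M.scale_eq_0_iff)
    then have "M.pact (ac_poly g ^ size S) w = 0"
      by (intro M.power_kills[OF sW uW _ that]) (rule root)
    then show ?thesis by (simp add: ac_poly_power)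
  qed
  then have "\<forall>x. g ^ size S \<star> x = 0" unfolding pact_kills_iff[OF r] by (simp add: W_def)
  then show "\<exists>N. \<forall>x. g ^ N \<star> x = 0" by blast
next
  assume "\<exists>N. \<forall>x. g ^ N \<star> x = 0"
  then obtain N where N: "\<forall>x. g ^ N \<star> x = 0" by blast
  show "\<forall>l. ac_eigenvalue scale u l \<longrightarrow> poly (ac_poly g) l = 0"
  proof (intro allI impI)
    fix l assume "ac_eigenvalue scale u l"
    then obtain bs A where r: "represents scale u bs A" and e: "eigenvalue (map_mat to_ac A) l"
      unfolding ac_eigenvalue_def by blast
    let ?B = "map_mat to_ac A" and ?n = "length bs"
    interpret M: endomorphism coord_scale "mat_action ?B" by (rule endomorphism_mat_action)
    have B: "?B \<in> carrier_mat ?n ?n" using r by (auto simp: represents_def)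
    obtain w where w: "\<forall>i\<ge>?n. w i = 0" "w \<noteq> 0" "mat_action ?B w = coord_scale l w"
      using e eigenvalue_iff_coord[OF B] by blast
    have "M.pact (ac_poly (g ^ N)) w = 0" using N w(1) unfolding pact_kills_iff[OF r] by blast
    then have "coord_scale (poly (ac_poly (g ^ N)) l) w = 0" using M.pact_eigenvector[OF w(3)] by simp
    then have "poly (ac_poly (g ^ N)) l = 0" using w(2) by (simp add: M.scale_eq_0_iff)
    then show "poly (ac_poly g) l = 0" by (simp add: ac_poly_power)
  qed
qed

end

section \<open>Paired decompositions\<close>

lemma cyclic_decomp_cong_dvd:
  assumes "cyclic_decomp scale I v g" "\<And>i f. i \<in> I \<Longrightarrow> g' i dvd f \<longleftrightarrow> g i dvd f"
  shows "cyclic_decomp scale I v g'"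
  using assms unfolding cyclic_decomp_def by simp

text \<open>Adds zero summands, so that a list of invariant factors can be padded by 1 until its
  members come in pairs.\<close>

lemma cyclic_decomp_extend:
  assumes "Modules.module scale" and D: "cyclic_decomp scale I v g" and "I \<subseteq> J" "finite J"
    and unit: "\<And>j. j \<in> J - I \<Longrightarrow> v j = 0 \<and> g j dvd 1"
  shows "cyclic_decomp scale J v g"
proof -
  interpret Modules.module scale by fact
  have sum: "(\<Sum>j\<in>J. scale (f j) (v j)) = (\<Sum>i\<in>I. scale (f i) (v i))" for f
  proof (rule sum.mono_neutral_right[OF assms(4,3)], rule ballI)
    fix j assume "j \<in> J - I"
    then have "v j = 0" using unit by blast
    then show "scale (f j) (v j) = 0" by simp
  qed
  have dvd: "(\<forall>j\<in>J. g j dvd f j) \<longleftrightarrow> (\<forall>i\<in>I. g i dvd f i)" for f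
  proof
    assume I: "\<forall>i\<in>I. g i dvd f i"
    show "\<forall>j\<in>J. g j dvd f j"
    proof
      fix j assume j: "j \<in> J"
      show "g j dvd f j"
      proof (cases "j \<in> I")
        case False
        then have "g j dvd 1" using unit j by blast
        then show ?thesis using one_dvd dvd_trans by blast
      qed (use I in blast)
    qed
  qed (use assms(3) in blast)
  show ?thesis using D assms(4) unfolding cyclic_decomp_def sum dvd by blast
qed

lemma diag_block_mat_concat:
  "diag_block_mat (map diag_block_mat Lss) = diag_block_mat (concat Lss)"
  by (induction Lss) (simp_all add: diag_block_mat_append Let_def)

lemma concat_map_pairs: "concat (map (\<lambda>i. [f (2 * i), f (Suc (2 * i))]) [0..<r]) = map f [0..<2 * r]"
  by (induction r) simp_all

section \<open>Sorting exponents that come in close pairs\<close>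

lemma sorted_enumeration:
  fixes K :: "nat \<Rightarrow> nat"
  obtains h where "bij_betw h {..<n} {..<n}" "\<And>i j. i \<le> j \<Longrightarrow> j < n \<Longrightarrow> K (h j) \<le> K (h i)"
proof -
  define xs where "xs = rev (sort_key K [0..<n])"
  have xs: "length xs = n" "distinct xs" "set xs = {..<n}" by (auto simp: xs_def)
  have sorted: "sorted (rev (map K xs))" by (simp add: xs_def rev_map)
  have "bij_betw ((!) xs) {..<n} {..<n}" by (rule bij_betw_nth[OF xs(2)]) (simp_all add: xs)
  moreover have "K (xs ! j) \<le> K (xs ! i)" if "i \<le> j" "j < n" for i j
    using sorted_rev_nth_mono[OF sorted, of i j] that xs(1) by simp
  ultimately show ?thesis using that by blast
qed

text \<open>A parity argument. A drop of at least 2 after the sorted position \<open>2 * i\<close>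
  would leave exactly \<open>2 * i + 1\<close> exponents above each of two consecutive thresholds.
  Since the members of a pair differ by at most 1, the lower threshold must then be met by equally
  many larger and smaller members, making the count even.\<close>

lemma paired_sequence_gap:
  fixes \<kappa> nn ee :: "nat \<Rightarrow> nat" and K :: "nat \<Rightarrow> nat"
  assumes h: "bij_betw h {..<2 * r} {..<2 * r}"
    and mono: "\<And>i j. i \<le> j \<Longrightarrow> j < 2 * r \<Longrightarrow> K (h j) \<le> K (h i)"
    and even: "\<And>i. i < r \<Longrightarrow> K (2 * i) = nn i + ee i" and odd: "\<And>i. i < r \<Longrightarrow> K (Suc (2 * i)) = nn i"
    and ee: "\<And>i. i < r \<Longrightarrow> ee i \<le> 1"
    and i: "i < r"
  shows "K (h (2 * i)) \<le> Suc (K (h (Suc (2 * i))))"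
proof (rule ccontr)
  assume gap: "\<not> K (h (2 * i)) \<le> Suc (K (h (Suc (2 * i))))"
  \<comment> \<open>Just above the smaller entry, so that \<open>t\<close> and \<open>Suc t\<close>
    both lie in the supposed gap.\<close>
  define t where "t = Suc (K (h (Suc (2 * i))))"
  define A B where "A s = card {l. l < r \<and> s \<le> nn l + ee l}" and "B s = card {l. l < r \<and> s \<le> nn l}" for s
  have count: "card {l. l < 2 * r \<and> s \<le> K (h l)} = A s + B s" for s
  proof -
    have inj: "inj_on h {l. l < 2 * r \<and> s \<le> K (h l)}"
      using h by (auto simp: bij_betw_def intro: inj_on_subset)
    have "h ` {l. l < 2 * r \<and> s \<le> K (h l)} = {l. l < 2 * r \<and> s \<le> K l}" (is "_ ` ?L = ?R")
    proof (intro equalityI subsetI)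
      fix l assume "l \<in> h ` ?L"
      then show "l \<in> ?R" using bij_betwE[OF h] by auto
    next
      fix l assume l: "l \<in> ?R"
      then obtain l' where "l' < 2 * r" "l = h l'" using bij_betw_imp_surj_on[OF h] by blast
      then show "l \<in> h ` ?L" using l by blast
    qed
    then have "card {l. l < 2 * r \<and> s \<le> K (h l)} = card {l. l < 2 * r \<and> s \<le> K l}"
      using card_image[OF inj] by simp
    also have "{l. l < 2 * r \<and> s \<le> K l} =
        (\<lambda>l. 2 * l) ` {l. l < r \<and> s \<le> nn l + ee l} \<union> (\<lambda>l. Suc (2 * l)) ` {l. l < r \<and> s \<le> nn l}"
      (is "?R = ?E \<union> ?O")
    proof (intro equalityI subsetI)
      fix l assume l: "l \<in> ?R"
      show "l \<in> ?E \<union> ?O"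
      proof (cases "Parity.even l")
        case True
        then obtain l' where "l = 2 * l'" by blast
        then show ?thesis using l even[of l'] by simp
      next
        case False
        then obtain l' where "l = Suc (2 * l')" by (auto elim: oddE)
        then show ?thesis using l odd[of l'] by simp
      qed
    next
      fix l assume "l \<in> ?E \<union> ?O"
      then show "l \<in> ?R" using even odd by auto
    qed
    also have "card \<dots> = card ((\<lambda>l. 2 * l) ` {l. l < r \<and> s \<le> nn l + ee l}) +
        card ((\<lambda>l. Suc (2 * l)) ` {l. l < r \<and> s \<le> nn l})"
      by (rule card_Un_disjoint) (auto, presburger)
    also have "\<dots> = A s + B s" unfolding A_def B_def by (simp add: card_image inj_on_def)
    finally show ?thesis .
  qed
  have "{l. l < 2 * r \<and> s \<le> K (h l)} = {..<Suc (2 * i)}" if s: "s = t \<or> s = Suc t" for s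
  proof (intro equalityI subsetI)
    fix l assume l: "l \<in> {l. l < 2 * r \<and> s \<le> K (h l)}"
    show "l \<in> {..<Suc (2 * i)}"
    proof (rule ccontr)
      assume "l \<notin> {..<Suc (2 * i)}"
      then have "K (h l) \<le> K (h (Suc (2 * i)))" using mono[of "Suc (2 * i)" l] l by simp
      then show False using l s by (auto simp: t_def)
    qed
  next
    fix l assume l: "l \<in> {..<Suc (2 * i)}"
    then have "K (h (2 * i)) \<le> K (h l)" using mono[of l "2 * i"] i by simp
    then show "l \<in> {l. l < 2 * r \<and> s \<le> K (h l)}" using gap s l i by (auto simp: t_def)
  qed
  then have "A t + B t = Suc (2 * i)" "A (Suc t) + B (Suc t) = Suc (2 * i)"
    using count[of t] count[of "Suc t"] by simp_all
  \<comment> \<open>A larger member reaching \<open>Suc t\<close> has a partner reaching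
    \<open>t\<close>. Together with the monotonicity inside pairs this squeezes \<open>A t\<close>
    and \<open>B t\<close> into equality.\<close>
  moreover have "A (Suc t) \<le> B t" unfolding A_def B_def
    by (rule card_mono) (use ee in \<open>auto, fastforce\<close>)
  moreover have "B t \<le> A t" "B (Suc t) \<le> A (Suc t)" unfolding A_def B_def by (rule card_mono; auto)+
  ultimately have "2 * A t = Suc (2 * i)" by linarith
  then show False by presburger
qed

section \<open>Divisibility by powers of F\<close>

context separable_inseparable
begin

lemma F_nonzero: "F \<noteq> 0" using degree_F by auto

lemma monic_F_power: "monic (F ^ n)"
  using monic_F by (simp add: lead_coeff_power)

lemma bezout_F: "\<not> F dvd h \<Longrightarrow> \<exists>a b. a * h + b * F = 1"
  by (rule irreducible_bezout[OF irreducible_F])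

lemma monic_dvd_F_power:
  assumes "monic g" "g dvd F ^ n"
  shows "\<exists>k. g = F ^ k"
  using assms
proof (induction n arbitrary: g)
  case 0
  then have "degree g = 0" by (metis is_unit_iff_degree leading_coeff_0_iff power_0 zero_neq_one)
  then have "g = 1" using 0(1) monic_degree_0 by blast
  then show ?case by (metis power_0)
next
  case (Suc n)
  show ?case
  proof (cases "F dvd g")
    case True
    then obtain h where h: "g = F * h" by (elim dvdE)
    have "monic h" using Suc.prems(1) monic_F unfolding h lead_coeff_mult by simp
    moreover have "h dvd F ^ n" using Suc.prems(2) F_nonzero by (simp add: h)
    ultimately obtain k where "h = F ^ k" using Suc.IH by blast
    then have "g = F ^ Suc k" by (simp add: h)
    then show ?thesis by blast
  next
    case False
    \<comment> \<open>When F does not divide \<open>g\<close>, the Bezout relation lowers the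
      exponent without changing \<open>g\<close>.\<close>
    then obtain a b where ab: "a * g + b * F = 1" using bezout_F by blast
    have "F ^ n = F ^ n * (a * g + b * F)" by (simp add: ab)
    also have "\<dots> = (F ^ n * a) * g + b * F ^ Suc n" by (simp add: algebra_simps)
    finally have "g dvd F ^ n" using Suc.prems(2) by (metis dvd_add dvd_mult dvd_triv_right)
    then show ?thesis using Suc by blast
  qed
qed

text \<open>The powers of F and \<pi> are associates, and \<open>shift\<close> fixes \<pi>.\<close>

lemma F_power_dvd_shift: "F ^ n dvd f \<Longrightarrow> F ^ n dvd shift f"
proof -
  assume "F ^ n dvd f"
  then have "\<pi> ^ n dvd f" by (simp only: \<pi>_pow_dvd)
  then obtain h where h: "f = \<pi> ^ n * h" by (elim dvdE)
  have "shift (\<pi> ^ n) = \<pi> ^ n"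
    by (induction n) (simp_all add: shift_mult shift_\<pi>, simp add: shift_def)
  then have "\<pi> ^ n dvd shift f" unfolding h shift_mult by simp
  then show "F ^ n dvd shift f" by (simp only: \<pi>_pow_dvd)
qed

lemma F_dvd_\<pi>: "F dvd \<pi>" by (simp add: \<pi>_def dvd_smult)

end

section \<open>Paired decompositions as the common form of the three conditions\<close>

context pair_endomorphism
begin

definition paired_exponent :: "(nat \<Rightarrow> nat) \<Rightarrow> (nat \<Rightarrow> nat) \<Rightarrow> nat \<Rightarrow> nat" where
  "paired_exponent nn ee j = (if even j then nn (j div 2) + ee (j div 2) else nn (j div 2))"

text \<open>The hub of the equivalence: each of the three conditions of the theorem is shown
  equivalent to the existence of such data. Summands \<open>2 * i\<close> and
  \<open>2 * i + 1\<close> form the \<open>i\<close>-th pair.\<close>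

definition paired_decomp :: "nat \<Rightarrow> (nat \<Rightarrow> nat) \<Rightarrow> (nat \<Rightarrow> nat) \<Rightarrow> (nat \<Rightarrow> 'v) \<Rightarrow> bool" where
  "paired_decomp r nn ee v \<longleftrightarrow> (\<forall>i<r. ee i \<le> 1) \<and>
     cyclic_decomp (\<lambda>f x. f \<star> x) {..<2 * r} v (\<lambda>j. F ^ paired_exponent nn ee j)"

lemma paired_decomp_kills:
  assumes "paired_decomp r nn ee v"
  shows "\<exists>N. \<forall>x. F ^ N \<star> x = 0"
proof -
  \<comment> \<open>The sum is a convenient common upper bound for the exponents.\<close>
  define N where "N = (\<Sum>j<2 * r. paired_exponent nn ee j)"
  have D: "cyclic_decomp (\<lambda>f x. f \<star> x) {..<2 * r} v (\<lambda>j. F ^ paired_exponent nn ee j)"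
    using assms by (simp add: paired_decomp_def)
  have z: "F ^ N \<star> v j = 0" if "j < 2 * r" for j
  proof -
    have "paired_exponent nn ee j \<le> N" unfolding N_def using that by (intro member_le_sum) auto
    then show ?thesis
      using cyclic_decomp_annihilates[OF pmod.module_axioms D, of j "F ^ N"] that by (simp add: le_imp_power_dvd)
  qed
  have "F ^ N \<star> x = 0" for x
  proof -
    obtain f where "x = (\<Sum>j<2 * r. f j \<star> v j)" using D unfolding cyclic_decomp_def by blast
    then have "F ^ N \<star> x = (\<Sum>j<2 * r. f j \<star> (F ^ N \<star> v j))"
      by (simp add: pmod.scale_sum_right mult.commute flip: pact_mult)
    then show ?thesis by (simp add: z)
  qed
  then show ?thesis by blast
qed

text \<open>A map \<open>T\<close> on coordinate families, that is on the free module, is semilinear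
  with square \<pi>. It preserves the relations and hence induces \<beta> on the quotient.\<close>

lemma paired_decomp_semilinear_sqrt:
  assumes P: "paired_decomp r nn ee v"
  shows "\<exists>\<beta>. semilinear_sqrt \<beta>"
proof -
  let ?k = "paired_exponent nn ee"
  define \<Phi> where "\<Phi> f = (\<Sum>j<2 * r. f j \<star> v j)" for f
  define T where "T f j = (if even j then \<pi> * shift (f (Suc j)) else shift (f (j - 1)))" for f :: "nat \<Rightarrow> 'k poly" and j
  have D: "cyclic_decomp (\<lambda>f x. f \<star> x) {..<2 * r} v (\<lambda>j. F ^ ?k j)" and ee: "\<And>i. i < r \<Longrightarrow> ee i \<le> 1"
    using P by (auto simp: paired_decomp_def)
  have zero: "\<Phi> f = 0 \<longleftrightarrow> (\<forall>j<2 * r. F ^ ?k j dvd f j)" for f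
    using cyclic_decomp_eq_0_iff[OF D, of f] by (auto simp: \<Phi>_def)
  have \<Phi>_add: "\<Phi> (\<lambda>j. f j + g j) = \<Phi> f + \<Phi> g" for f g
    by (simp add: \<Phi>_def pact_add_left sum.distrib)
  have \<Phi>_scale: "\<Phi> (\<lambda>j. h * f j) = h \<star> \<Phi> f" for h f
    by (simp only: \<Phi>_def pact_mult pmod.scale_sum_right)
  have T_add: "T (\<lambda>j. f j + g j) = (\<lambda>j. T f j + T g j)" for f g
    by (auto simp: T_def shift_add algebra_simps)
  have T_scale: "T (\<lambda>j. h * f j) = (\<lambda>j. shift h * T f j)" for h f
    by (auto simp: T_def shift_mult mult_ac)
  have TT: "T (T f) = (\<lambda>j. \<pi> * f j)" for f
  proof
    fix j
    show "T (T f) j = \<pi> * f j"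
      by (cases "even j") (auto simp: T_def shift_shift shift_mult shift_\<pi> elim!: oddE)
  qed
  have T_zero: "\<Phi> (T f) = 0" if "\<Phi> f = 0" for f
    unfolding zero
  proof (intro allI impI)
    fix j assume j: "j < 2 * r"
    have f: "F ^ ?k l dvd f l" if "l < 2 * r" for l using \<open>\<Phi> f = 0\<close> that unfolding zero by blast
    show "F ^ ?k j dvd T f j"
    proof (cases "even j")
      case True
      then have j': "Suc j < 2 * r" using j by presburger
      have "F ^ nn (j div 2) dvd f (Suc j)" using f[OF j'] True by (simp add: paired_exponent_def)
      then have "F * F ^ nn (j div 2) dvd \<pi> * shift (f (Suc j))"
        by (intro mult_dvd_mono F_dvd_\<pi> F_power_dvd_shift)
      \<comment> \<open>The larger exponent exceeds the smaller by at most 1, and the factor \<pi>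
        in \<open>T\<close> supplies this one power of F.\<close>
      moreover have "?k j \<le> Suc (nn (j div 2))" using ee[of "j div 2"] j True by (simp add: paired_exponent_def)
      then have "F ^ ?k j dvd F ^ Suc (nn (j div 2))" by (rule le_imp_power_dvd)
      ultimately have "F ^ ?k j dvd \<pi> * shift (f (Suc j))" unfolding power_Suc by (rule dvd_trans[rotated])
      then show ?thesis using True by (simp only: T_def if_True)
    next
      case False
      then have d: "(j - 1) div 2 = j div 2" "even (j - 1)" "j - 1 < 2 * r" using j by presburger+
      have "?k j \<le> ?k (j - 1)" using False d by (simp add: paired_exponent_def)
      then have "F ^ ?k j dvd f (j - 1)" using f[OF d(3)] le_imp_power_dvd dvd_trans by blast
      then show ?thesis using False by (simp add: T_def F_power_dvd_shift)
    qed
  qed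
  \<comment> \<open>Independence of the chosen coordinates; in characteristic 2 the sum of two
    families serves as their difference.\<close>
  have T_cong: "\<Phi> (T f) = \<Phi> (T g)" if "\<Phi> f = \<Phi> g" for f g
  proof -
    have "\<Phi> (\<lambda>j. f j + g j) = 0" unfolding \<Phi>_add that by simp
    then have "\<Phi> (T (\<lambda>j. f j + g j)) = 0" by (rule T_zero)
    then show ?thesis unfolding T_add \<Phi>_add by (rule eq_if_add_eq_0)
  qed
  obtain c where c: "\<And>x. x = \<Phi> (c x)"
    using D unfolding cyclic_decomp_def \<Phi>_def by metis
  define \<beta> where "\<beta> x = \<Phi> (T (c x))" for x
  have \<beta>: "\<beta> (\<Phi> f) = \<Phi> (T f)" for f
    unfolding \<beta>_def by (rule T_cong) (rule c[symmetric])
  have "\<beta> (x + y) = \<beta> x + \<beta> y" for x y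
  proof -
    have "x + y = \<Phi> (\<lambda>j. c x j + c y j)" unfolding \<Phi>_add by (simp flip: c)
    then have "\<beta> (x + y) = \<Phi> (T (\<lambda>j. c x j + c y j))" by (simp only: \<beta>)
    then show ?thesis unfolding T_add \<Phi>_add \<beta>_def .
  qed
  moreover have "\<beta> (h \<star> x) = shift h \<star> \<beta> x" for h x
  proof -
    have "h \<star> x = \<Phi> (\<lambda>j. h * c x j)" unfolding \<Phi>_scale by (simp flip: c)
    then have "\<beta> (h \<star> x) = \<Phi> (T (\<lambda>j. h * c x j))" by (simp only: \<beta>)
    then show ?thesis unfolding T_scale \<Phi>_scale \<beta>_def .
  qed
  moreover have "\<beta> (\<beta> x) = \<pi> \<star> x" for x
  proof -
    have "\<beta> (\<beta> x) = \<Phi> (T (T (c x)))" unfolding \<beta>_def[of x] by (rule \<beta>)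
    then show ?thesis unfolding TT \<Phi>_scale by (simp flip: c)
  qed
  ultimately show ?thesis unfolding semilinear_sqrt_def by blast
qed

lemma semilinear_sqrt_paired_decomp:
  assumes fd: "finite_dimensional_vector_space scale Basis"
    and \<beta>: "semilinear_sqrt \<beta>" and N: "\<forall>x. F ^ N \<star> x = 0"
  shows "\<exists>r nn ee v. paired_decomp r nn ee v"
proof -
  interpret fd: finite_dimensional_vector_space scale Basis by fact
  interpret R: semilinear_root "\<lambda>f x. f \<star> x" shift \<beta> \<pi> dim
  proof unfold_locales
    fix W U assume "pmod.subspace W" "pmod.subspace U" "W \<subset> U"
    then show "dim W < dim U"
      using subspace_pmod fd.dim_psubset[of W U] span_eq_iff by metis
  qed (use \<beta> in \<open>auto simp: semilinear_sqrt_def shift_mult shift_shift shift_\<pi> bezout_\<pi>\<close>)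
  \<comment> \<open>Nilpotency of F(u) gives that of \<beta>, with twice the exponent because
    \<beta> squared is \<pi>(u).\<close>
  have "(\<beta> ^^ (2 * N)) x = 0" for x
  proof -
    have "\<pi> ^ N \<star> x = 0" using N by (simp add: \<pi>_def smult_power pact_smult)
    then show ?thesis by (simp only: R.\<beta>_pow_even)
  qed
  then obtain r :: nat and v m where D: "cyclic_decomp (\<lambda>f x. f \<star> x) ({..<r} \<times> UNIV)
    (\<lambda>(i, b). if b then \<beta> (v i) else v i) (\<lambda>(i, b). if b then \<pi> ^ (m i div 2) else \<pi> ^ ((m i + 1) div 2))"
    by (rule R.decomposition)
  \<comment> \<open>A block of order m splits with exponents the floor and the ceiling of m / 2, so
    the excess is the parity of m.\<close>
  define nn ee where "nn i = m i div 2" and "ee i = m i mod 2" for i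
  have me: "Suc (m i) div 2 = nn i + ee i" for i unfolding nn_def ee_def by presburger
  let ?h = "\<lambda>j::nat. (j div 2, odd j)"
  \<comment> \<open>The generator \<open>v i\<close> goes to the even position \<open>2 * i\<close>
    and its image under \<beta> to the next odd one.\<close>
  have "bij_betw ?h {..<2 * r} ({..<r} \<times> UNIV)"
    by (rule bij_betwI[where g = "\<lambda>(i, b). 2 * i + of_bool b"]) (auto simp: less_mult_imp_div_less split: if_splits)
  from cyclic_decomp_reindex[OF D this]
  have "cyclic_decomp (\<lambda>f x. f \<star> x) {..<2 * r} (\<lambda>j. (\<lambda>(i, b). if b then \<beta> (v i) else v i) (?h j))
     (\<lambda>j. (\<lambda>(i, b). if b then \<pi> ^ (m i div 2) else \<pi> ^ ((m i + 1) div 2)) (?h j))" by simp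
  then have "cyclic_decomp (\<lambda>f x. f \<star> x) {..<2 * r} (\<lambda>j. (\<lambda>(i, b). if b then \<beta> (v i) else v i) (?h j))
     (\<lambda>j. F ^ paired_exponent nn ee j)"
    by (rule cyclic_decomp_cong_dvd) (simp add: paired_exponent_def me \<pi>_pow_dvd flip: nn_def)
  moreover have "ee i \<le> 1" for i unfolding ee_def by linarith
  ultimately show ?thesis unfolding paired_decomp_def by blast
qed

lemma exceptional_difference_iff:
  assumes fd: "finite_dimensional_vector_space scale Basis"
  shows "is_difference scale p q u \<and> d_exceptional scale p q u \<longleftrightarrow> (\<exists>r nn ee v. paired_decomp r nn ee v)"
proof -
  have "d_exceptional scale p q u \<longleftrightarrow> (\<forall>l. ac_eigenvalue scale u l \<longrightarrow> poly (ac_poly F) l = 0)"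
    unfolding d_exceptional_def F_def poly_ac_poly_F_poly_eq_0_iff[OF p(2,3) q(2,3)] by blast
  then have "d_exceptional scale p q u \<longleftrightarrow> (\<exists>N. \<forall>x. F ^ N \<star> x = 0)"
    using eigenvalues_roots_iff[OF fd] by simp
  then show ?thesis
    using difference_imp_semilinear_sqrt semilinear_sqrt_imp_difference semilinear_sqrt_paired_decomp[OF fd]
      paired_decomp_kills paired_decomp_semilinear_sqrt by blast
qed

text \<open>For the least annihilating power, suppose an annihilator \<open>f\<close> contains F
  only to a smaller exponent. By Bezout the next lower power of F is then a combination of
  \<open>f\<close> and \<open>F ^ n\<close>, so it annihilates too, against minimality.\<close>

lemma exists_minimal_power:
  assumes "\<forall>x. F ^ N \<star> x = 0"
  shows "\<exists>n. is_minimal_poly scale u (F ^ n)"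
proof -
  define n where "n = (LEAST n. \<forall>x. F ^ n \<star> x = 0)"
  have n: "\<forall>x. F ^ n \<star> x = 0" unfolding n_def using assms by (rule LeastI)
  have "F ^ n dvd f" if f: "\<forall>x. f \<star> x = 0" for f
  proof -
    have "F ^ j dvd f" if "j \<le> n" for j
      using that
    proof (induction j)
      case (Suc j)
      then have "F ^ j dvd f" by simp
      then obtain h where h: "f = F ^ j * h" by (rule dvdE)
      have "F dvd h"
      proof (rule ccontr)
        assume "\<not> F dvd h"
        then obtain a b where ab: "a * h + b * F = 1" using bezout_F by blast
        define d where "d = n - Suc j"
        have d: "n = d + Suc j" using Suc.prems by (simp add: d_def)
        have "F ^ (d + j) = F ^ (d + j) * (a * h + b * F)" by (simp add: ab)
        also have "\<dots> = a * F ^ d * f + b * F ^ n" unfolding h d by (simp add: algebra_simps power_add)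
        finally have "F ^ (d + j) \<star> x = 0" for x
          using f n by (simp add: pact_add_left pact_mult)
        then have "n \<le> d + j" unfolding n_def by (intro Least_le) blast
        then show False using d by simp
      qed
      then show ?case unfolding h by (simp add: F_nonzero mult.commute)
    qed simp
    then show ?thesis by blast
  qed
  then have "is_minimal_poly scale u (F ^ n)"
    unfolding is_minimal_poly_def using n monic_F_power by (simp add: fun_eq_iff)
  then show ?thesis by blast
qed

lemma paired_decomp_invariant_factors:
  assumes P: "paired_decomp r nn ee v"
  shows "\<exists>R. is_invariant_factors scale u R \<and>
    (\<forall>k\<ge>1. R (2 * k) = R (2 * k - 1) \<or> R (2 * k - 1) = R (2 * k) * F)"
proof -
  define K where "K = paired_exponent nn ee"
  obtain h where h: "bij_betw h {..<2 * r} {..<2 * r}"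
    and mono: "\<And>i j. i \<le> j \<Longrightarrow> j < 2 * r \<Longrightarrow> K (h j) \<le> K (h i)"
    using sorted_enumeration[of "2 * r" K] by blast
  \<comment> \<open>Sorted exponents, continued by 0 to produce the trailing invariant factors 1;
    the index shift in \<open>R\<close> accounts for invariant factors being numbered from
    1.\<close>
  define \<kappa> where "\<kappa> i = (if i < 2 * r then K (h i) else 0)" for i
  define R where "R i = F ^ \<kappa> (i - 1)" for i
  have \<kappa>_mono: "\<kappa> j \<le> \<kappa> i" if "i \<le> j" for i j
    using mono[OF that] that by (cases "j < 2 * r") (simp_all add: \<kappa>_def)
  have D: "cyclic_decomp (\<lambda>f x. f \<star> x) {..<2 * r} v (\<lambda>j. F ^ K j)"
    using P unfolding paired_decomp_def K_def by blast
  define gs where "gs = map (\<lambda>j. F ^ \<kappa> j) [0..<2 * r]"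
  have "cyclic_decomp (\<lambda>f x. f \<star> x) {..<length gs} (\<lambda>j. v (h j)) ((!) gs)"
    unfolding gs_def by (rule cyclic_decomp_reindex[OF D, where h = h]) (simp_all add: h \<kappa>_def)
  moreover have "\<forall>g\<in>set gs. monic g" by (auto simp: gs_def monic_F_power simp del: lead_coeff_power coeff_degree_mult)
  ultimately obtain bs where bs: "represents scale u bs (diag_block_mat (map companion_mat gs))"
    using represents_companions_iff by blast
  have "map companion_mat gs = map (\<lambda>i. companion_mat (R i)) [1..<Suc (2 * r)]"
    unfolding gs_def R_def One_nat_def by (rule nth_equalityI) (simp_all del: upt_Suc)
  then have "\<exists>bs. represents scale u bs (diag_block_mat (map (\<lambda>i. companion_mat (R i)) [1..<Suc (2 * r)]))"
    using bs by auto
  moreover have "\<forall>i\<ge>1. monic (R i) \<and> R (Suc i) dvd R i"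
    unfolding R_def using monic_F_power \<kappa>_mono by (auto intro!: le_imp_power_dvd)
  moreover have "\<forall>i>2 * r. R i = 1" by (auto simp: R_def \<kappa>_def)
  ultimately have "is_invariant_factors scale u R" unfolding is_invariant_factors_def by blast
  moreover have "R (2 * k) = R (2 * k - 1) \<or> R (2 * k - 1) = R (2 * k) * F" if k1: "k \<ge> 1" for k
  proof -
    obtain i where k: "k = Suc i" using k1 by (cases k) auto
    \<comment> \<open>The invariant factors numbered \<open>2 * k - 1\<close> and
      \<open>2 * k\<close> sit at the sorted positions \<open>2 * i\<close> and
      \<open>2 * i + 1\<close>, to which the gap bound applies.\<close>
    have "\<kappa> (2 * i) \<le> Suc (\<kappa> (Suc (2 * i)))"
    proof (cases "i < r")
      case True
      have "K (h (2 * i)) \<le> Suc (K (h (Suc (2 * i))))"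
        using P by (intro paired_sequence_gap[of h r K nn ee i, OF h mono])
          (simp_all add: True K_def paired_exponent_def paired_decomp_def)
      then show ?thesis using True by (simp add: \<kappa>_def)
    qed (simp add: \<kappa>_def)
    then consider "\<kappa> (2 * i) = \<kappa> (Suc (2 * i))" | "\<kappa> (2 * i) = Suc (\<kappa> (Suc (2 * i)))"
      using \<kappa>_mono[of "2 * i" "Suc (2 * i)"] by linarith
    then show ?thesis by cases (simp_all add: R_def k mult.commute)
  qed
  ultimately show ?thesis by blast
qed

text \<open>The invariant factors divide the minimal polynomial and are therefore powers of F; the
  hypothesis on consecutive ones pairs their exponents.\<close>

lemma invariant_factors_paired_decomp:
  assumes m: "is_minimal_poly scale u (F ^ n)" and R: "is_invariant_factors scale u R"
    and pair: "\<forall>k\<ge>1. R (2 * k) = R (2 * k - 1) \<or> R (2 * k - 1) = R (2 * k) * F"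
  shows "\<exists>r nn ee v. paired_decomp r nn ee v"
proof -
  obtain M bs where one: "\<forall>i>M. R i = 1"
    and bs: "represents scale u bs (diag_block_mat (map (\<lambda>i. companion_mat (R i)) [1..<Suc M]))"
    and monic: "\<And>i. i \<ge> 1 \<Longrightarrow> monic (R i)"
    using R unfolding is_invariant_factors_def by blast
  define gs where "gs = map R [1..<Suc M]"
  have gs: "length gs = M" "\<And>i. i < M \<Longrightarrow> gs ! i = R (Suc i)" by (simp_all add: gs_def del: upt_Suc)
  have "\<forall>g\<in>set gs. monic g" using monic by (auto simp: gs_def simp del: upt_Suc)
  moreover have "map companion_mat gs = map (\<lambda>i. companion_mat (R i)) [1..<Suc M]"
    by (simp add: gs_def del: upt_Suc)
  ultimately obtain v where "cyclic_decomp (\<lambda>f x. f \<star> x) {..<M} v ((!) gs)"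
    using represents_companions_iff[of gs] bs gs(1) by metis
  then have D: "cyclic_decomp (\<lambda>f x. f \<star> x) {..<M} v (\<lambda>i. R (Suc i))"
    by (rule cyclic_decomp_cong_dvd) (simp add: gs)
  \<comment> \<open>The number \<open>M\<close> of listed factors may be odd; padding with zero
    generators up to \<open>2 * M\<close> completes all pairs.\<close>
  define w where "w i = (if i < M then v i else 0)" for i
  have "cyclic_decomp (\<lambda>f x. f \<star> x) {..<M} w (\<lambda>i. R (Suc i))"
    by (rule cyclic_decomp_reindex[OF D bij_betw_id]) (simp_all add: w_def)
  then have E: "cyclic_decomp (\<lambda>f x. f \<star> x) {..<2 * M} w (\<lambda>i. R (Suc i))"
    by (rule cyclic_decomp_extend[OF pmod.module_axioms]) (auto simp: w_def one)
  have kill: "F ^ n \<star> x = 0" for x using m unfolding is_minimal_poly_def by (metis)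
  have "\<exists>k. R (Suc i) = F ^ k" for i
  proof (cases "i < M")
    case True
    then have "R (Suc i) dvd F ^ n"
      using cyclic_decomp_annihilates[OF pmod.module_axioms D, of i "F ^ n"] kill by simp
    then show ?thesis using monic_dvd_F_power monic[of "Suc i"] by simp
  next
    case False
    then have "R (Suc i) = F ^ 0" using one by simp
    then show ?thesis by blast
  qed
  then obtain k where k: "\<And>i. R (Suc i) = F ^ k i" by metis
  define nn ee where "nn i = k (Suc (2 * i))" and "ee i = (if R (2 * Suc i) = R (2 * Suc i - 1) then 0 else 1 :: nat)" for i
  have "R (Suc j) = F ^ paired_exponent nn ee j" for j
  proof (cases "even j")
    case True
    then obtain i where j: "j = 2 * i" by blast
    have "R (2 * Suc i) = F ^ nn i" using k[of "Suc (2 * i)"] by (simp add: nn_def)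
    then have "R (2 * Suc i - 1) = F ^ (nn i + ee i)"
      using pair[rule_format, of "Suc i"] by (auto simp: ee_def mult.commute)
    then show ?thesis by (simp add: j paired_exponent_def)
  next
    case False
    then obtain i where j: "j = Suc (2 * i)" by (auto elim: oddE)
    then show ?thesis using k[of j] by (simp add: nn_def paired_exponent_def)
  qed
  then have "paired_decomp M nn ee w" using E unfolding paired_decomp_def by (simp add: ee_def)
  then show ?thesis by blast
qed

text \<open>Flattening the nested block-diagonal sums turns the pairs into one list of companion
  matrices in the same order, to which \<open>represents_companions_iff\<close> applies.\<close>

lemma paired_decomp_iff_blocks:
  "(\<exists>r nn ee v. paired_decomp r nn ee v) \<longleftrightarrow>
    (\<exists>bs Ms. represents scale u bs (diag_block_mat Ms) \<and> (\<forall>M\<in>set Ms. \<exists>n. \<exists>e\<in>{0, 1}.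
       M = diag_block_mat [companion_mat (F ^ (n + e)), companion_mat (F ^ n)]))"
proof -
  define block where "block n e = diag_block_mat [companion_mat (F ^ (n + e)), companion_mat (F ^ n)]" for n e
  have blocks: "diag_block_mat (map (\<lambda>i. block (nn i) (ee i)) [0..<r]) =
      diag_block_mat (map companion_mat (map (\<lambda>j. F ^ paired_exponent nn ee j) [0..<2 * r]))" for r nn ee
  proof -
    define f where "f j = companion_mat (F ^ paired_exponent nn ee j)" for j
    have "block (nn i) (ee i) = diag_block_mat [f (2 * i), f (Suc (2 * i))]" for i
      by (simp only: block_def f_def paired_exponent_def) simp
    then have "diag_block_mat (map (\<lambda>i. block (nn i) (ee i)) [0..<r]) =
        diag_block_mat (map diag_block_mat (map (\<lambda>i. [f (2 * i), f (Suc (2 * i))]) [0..<r]))"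
      by (simp only: map_map o_def)
    also have "\<dots> = diag_block_mat (map f [0..<2 * r])"
      by (simp only: diag_block_mat_concat concat_map_pairs)
    finally show ?thesis by (simp add: f_def[abs_def] o_def)
  qed
  have decomp: "(\<exists>bs. represents scale u bs (diag_block_mat (map (\<lambda>i. block (nn i) (ee i)) [0..<r]))) \<longleftrightarrow>
      (\<exists>v. cyclic_decomp (\<lambda>f x. f \<star> x) {..<2 * r} v (\<lambda>j. F ^ paired_exponent nn ee j))" for r nn ee
  proof -
    define gs where "gs = map (\<lambda>j. F ^ paired_exponent nn ee j) [0..<2 * r]"
    have "\<forall>g\<in>set gs. monic g" unfolding gs_def using monic_F_power by auto
    from represents_companions_iff[OF this]
    have "(\<exists>bs. represents scale u bs (diag_block_mat (map (\<lambda>i. block (nn i) (ee i)) [0..<r]))) \<longleftrightarrow>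
        (\<exists>v. cyclic_decomp (\<lambda>f x. f \<star> x) {..<2 * r} v ((!) gs))"
      unfolding blocks by (simp add: gs_def)
    also have "\<dots> \<longleftrightarrow> (\<exists>v. cyclic_decomp (\<lambda>f x. f \<star> x) {..<2 * r} v (\<lambda>j. F ^ paired_exponent nn ee j))"
      by (intro arg_cong[where f = Ex] ext iffI; erule cyclic_decomp_cong_dvd) (simp_all add: gs_def)
    finally show ?thesis .
  qed
  show ?thesis
  proof
    assume "\<exists>r nn ee v. paired_decomp r nn ee v"
    then obtain r nn ee where ee: "\<forall>i<r. ee i \<le> 1"
      and v: "\<exists>v. cyclic_decomp (\<lambda>f x. f \<star> x) {..<2 * r} v (\<lambda>j. F ^ paired_exponent nn ee j)"
      unfolding paired_decomp_def by blast
    obtain bs where bs: "represents scale u bs (diag_block_mat (map (\<lambda>i. block (nn i) (ee i)) [0..<r]))"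
      using v decomp by blast
    have "\<exists>n. \<exists>e\<in>{0, 1}. M = block n e" if "M \<in> set (map (\<lambda>i. block (nn i) (ee i)) [0..<r])" for M
    proof -
      obtain i where "i < r" "M = block (nn i) (ee i)" using \<open>M \<in> _\<close> by auto
      moreover have "ee i \<in> {0, 1}" using ee \<open>i < r\<close> by (auto simp: le_Suc_eq)
      ultimately show ?thesis by blast
    qed
    then show "\<exists>bs Ms. represents scale u bs (diag_block_mat Ms) \<and> (\<forall>M\<in>set Ms. \<exists>n. \<exists>e\<in>{0, 1}.
       M = diag_block_mat [companion_mat (F ^ (n + e)), companion_mat (F ^ n)])"
      using bs unfolding block_def by blast
  next
    assume "\<exists>bs Ms. represents scale u bs (diag_block_mat Ms) \<and> (\<forall>M\<in>set Ms. \<exists>n. \<exists>e\<in>{0, 1}.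
       M = diag_block_mat [companion_mat (F ^ (n + e)), companion_mat (F ^ n)])"
    then obtain bs Ms where bs: "represents scale u bs (diag_block_mat Ms)"
      and Ms: "\<forall>M\<in>set Ms. \<exists>n e. e \<le> 1 \<and> M = block n e" unfolding block_def by fastforce
    have "\<forall>i. \<exists>n e. i < length Ms \<longrightarrow> e \<le> 1 \<and> Ms ! i = block n e" using Ms nth_mem by blast
    then obtain nn ee where ne: "\<And>i. i < length Ms \<Longrightarrow> ee i \<le> 1 \<and> Ms ! i = block (nn i) (ee i)" by metis
    have "Ms = map (\<lambda>i. block (nn i) (ee i)) [0..<length Ms]"
      by (rule nth_equalityI) (simp_all add: ne)
    then have "\<exists>bs. represents scale u bs (diag_block_mat (map (\<lambda>i. block (nn i) (ee i)) [0..<length Ms]))"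
      using bs by metis
    then obtain v where "cyclic_decomp (\<lambda>f x. f \<star> x) {..<2 * length Ms} v (\<lambda>j. F ^ paired_exponent nn ee j)"
      using decomp by blast
    then have "paired_decomp (length Ms) nn ee v" using ne unfolding paired_decomp_def by blast
    then show "\<exists>r nn ee v. paired_decomp r nn ee v" by blast
  qed
qed

lemma paired_decomp_iff_invariant_factors:
  "(\<exists>r nn ee v. paired_decomp r nn ee v) \<longleftrightarrow> (\<exists>n. is_minimal_poly scale u (F ^ n)) \<and>
    (\<exists>R. is_invariant_factors scale u R \<and>
      (\<forall>k\<ge>1. R (2 * k) = R (2 * k - 1) \<or> R (2 * k - 1) = R (2 * k) * F))"
proof
  assume "\<exists>r nn ee v. paired_decomp r nn ee v"
  then obtain r nn ee v where P: "paired_decomp r nn ee v" by blast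
  show "(\<exists>n. is_minimal_poly scale u (F ^ n)) \<and> (\<exists>R. is_invariant_factors scale u R \<and>
      (\<forall>k\<ge>1. R (2 * k) = R (2 * k - 1) \<or> R (2 * k - 1) = R (2 * k) * F))"
    using exists_minimal_power paired_decomp_kills[OF P] paired_decomp_invariant_factors[OF P] by blast
next
  assume "(\<exists>n. is_minimal_poly scale u (F ^ n)) \<and> (\<exists>R. is_invariant_factors scale u R \<and>
      (\<forall>k\<ge>1. R (2 * k) = R (2 * k - 1) \<or> R (2 * k - 1) = R (2 * k) * F))"
  then obtain n R where "is_minimal_poly scale u (F ^ n)" "is_invariant_factors scale u R"
    "\<forall>k\<ge>1. R (2 * k) = R (2 * k - 1) \<or> R (2 * k - 1) = R (2 * k) * F" by blast
  then show "\<exists>r nn ee v. paired_decomp r nn ee v" by (rule invariant_factors_paired_decomp)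
qed

end

theorem theorem3p34:
  fixes p q :: "'k::field poly"
    and scale :: "'k \<Rightarrow> 'v::ab_group_add \<Rightarrow> 'v"
    and Basis :: "'v set"
    and u :: "'v \<Rightarrow> 'v"
  assumes "irreducible p" and "monic p" and "degree p = 2"
    and "irreducible q" and "monic q" and "degree q = 2"
    and "separable_poly p" and "\<not> separable_poly q"
    and "finite_dimensional_vector_space scale Basis"
    and "Vector_Spaces.linear scale scale u"
  shows
    "(is_difference scale p q u \<and> d_exceptional scale p q u \<longleftrightarrow>
       (\<exists>n. is_minimal_poly scale u (F_poly p q ^ n)) \<and>
       (\<exists>r. is_invariant_factors scale u r \<and>
          (\<forall>k\<ge>1. r (2 * k) = r (2 * k - 1) \<or> r (2 * k - 1) = r (2 * k) * F_poly p q)))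
     \<and>
     (is_difference scale p q u \<and> d_exceptional scale p q u \<longleftrightarrow>
       (\<exists>bs Ms. represents scale u bs (diag_block_mat Ms) \<and>
          (\<forall>M\<in>set Ms. \<exists>n. \<exists>e\<in>{0, 1}.
             M = diag_block_mat
               [companion_mat (F_poly p q ^ (n + e)), companion_mat (F_poly p q ^ n)])))"
proof -
  interpret fd: finite_dimensional_vector_space scale Basis by fact
  interpret pair_endomorphism scale u p q
    by (intro pair_endomorphism.intro endomorphism.intro endomorphism_axioms.intro
        fd.vector_space_axioms separable_inseparable.intro assms)
  note iff = exceptional_difference_iff[OF assms(9)]
  show ?thesis
    using trans[OF iff paired_decomp_iff_invariant_factors[unfolded F_def]]
      trans[OF iff paired_decomp_iff_blocks[unfolded F_def]] by (rule conjI)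
qed

end
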